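(* Let $d\ge 1$ be an integer, $T>0$, and let $p,q\in[1,\infty]$ satisfy $\frac1p+\frac1q\le\frac12$. Let $b\in L^2([0,T];L^p(\mathbb{T}^d))$ be a divergence-free vector field, let $u_0\in L^q(\mathbb{T}^d)$, and let $u\in L^\infty([0,T];L^q(\mathbb{T}^d))$ be a distributional solution to the Cauchy problem $\partial_t u+\operatorname{div}(bu)=\Delta u$ in $(0,T)\times\mathbb{T}^d$, $u|_{t=0}=u_0$. Then $u\in L^2([0,T];H^1(\mathbb{T}^d))$, and $u$ satisfies the energy balance $$\frac12\int_{\mathbb{T}^d}|u(T,x)|^2\,dx+\int_0^T\int_{\mathbb{T}^d}|\nabla u(t,x)|^2\,dx\,dt=\frac12\int_{\mathbb{T}^d}|u_0(x)|^2\,dx.$$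
   Context: $\mathbb{T}^d=\mathbb{R}^d/\mathbb{Z}^d$ is the flat torus with Lebesgue measure. A vector field $b:[0,T]\times\mathbb{T}^d\to\mathbb{R}^d$ is divergence-free if $\operatorname{div}_x b=0$ in the sense of distributions. Distributional solution: for $\frac1p+\frac1q\le1$, $b\in L^1([0,T];L^p(\mathbb{T}^d))$ divergence-free and $u_0\in L^q(\mathbb{T}^d)$, a function $u\in L^\infty([0,T];L^q(\mathbb{T}^d))$ is a distributional solution to the Cauchy problem if for every $\varphi\in C_c^\infty([0,T)\times\mathbb{T}^d)$ $$\int_0^T\int_{\mathbb{T}^d}u(\partial_t\varphi+b\cdot\nabla\varphi+\Delta\varphi)\,dx\,dt+\int_{\mathbb{T}^d}u_0\,\varphi(0,\cdot)\,dx=0.$$ The value $u(T,\cdot)$ refers to the representative of $u$ (modified on a null set of times) which is continuous from $[0,T]$ to $L^2(\mathbb{T}^d)$ endowed with the weak topology. *)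

theory Defs
  imports "HOL-Analysis.Analysis" "HOL-Probability.Essential_Supremum"
begin

text \<open>
  Functions on the flat torus are \<open>\<int>\<^sup>d\<close>-periodic functions on \<open>\<real>\<^sup>d\<close> (the type \<^typ>\<open>real^'n\<close>, so that
  \<open>d = CARD('n) \<ge> 1\<close>); integration over the torus is integration over the unit cube.
  Functions of time and space are curried, \<open>u t x\<close>.
\<close>

definition torus_periodic :: "(real^'n \<Rightarrow> 'b) \<Rightarrow> bool" where
  "torus_periodic f \<longleftrightarrow> (\<forall>x k. (\<forall>i. k $ i \<in> \<int>) \<longrightarrow> f (x + k) = f x)"

abbreviation torus :: "(real^'n) measure" where
  "torus \<equiv> lebesgue_on (cbox 0 1)"


section \<open>Lebesgue spaces\<close>

definition ennreal_powr :: "ennreal \<Rightarrow> real \<Rightarrow> ennreal" where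
  "ennreal_powr a r = (if a = \<infinity> then \<infinity> else ennreal (enn2real a powr r))"

text \<open>
  The \<open>L\<^sup>p\<close> norm, \<open>p \<in> [1,\<infinity>]\<close>, of a function with values in \<open>[0,\<infinity>]\<close>. Extended values are allowed so
  that it can be applied to \<open>t \<mapsto> \<parallel>u(t)\<parallel>\<close> as well.
\<close>

definition Lp_enorm :: "ennreal \<Rightarrow> 'a measure \<Rightarrow> ('a \<Rightarrow> ennreal) \<Rightarrow> ennreal" where
  "Lp_enorm p M g =
     (if p = \<infinity> then esssup M g
      else ennreal_powr (\<integral>\<^sup>+ x. ennreal_powr (g x) (enn2real p) \<partial>M) (1 / enn2real p))"

definition torus_Lp :: "ennreal \<Rightarrow> (real^'n \<Rightarrow> 'b::euclidean_space) \<Rightarrow> bool" where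
  "torus_Lp p f \<longleftrightarrow>
     torus_periodic f \<and> f \<in> borel_measurable torus \<and>
     Lp_enorm p torus (\<lambda>x. ennreal (norm (f x))) < \<infinity>"

text \<open>
  \<open>L\<^sup>r([0,T]; L\<^sup>p)\<close>. Measurability is joint Lebesgue measurability in \<open>(t,x)\<close>; for \<open>p < \<infinity>\<close> this agrees,
  up to modification on null sets, with strong measurability of \<open>t \<mapsto> u(t)\<close>.
\<close>

definition Lr_Lp :: "real \<Rightarrow> ennreal \<Rightarrow> ennreal \<Rightarrow> (real \<Rightarrow> real^'n \<Rightarrow> 'b::euclidean_space) \<Rightarrow> bool" where
  "Lr_Lp T r p u \<longleftrightarrow>
     (\<forall>t\<in>{0..T}. torus_periodic (u t)) \<and>
     (\<lambda>(t, x). u t x) \<in> borel_measurable (lebesgue_on ({0..T} \<times> cbox 0 1)) \<and>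
     Lp_enorm r (lebesgue_on {0..T}) (\<lambda>t. Lp_enorm p torus (\<lambda>x. ennreal (norm (u t x)))) < \<infinity>"


section \<open>Test functions\<close>

primrec C_k :: "nat \<Rightarrow> ('a::real_normed_vector \<Rightarrow> real) \<Rightarrow> bool" where
  "C_k 0 f \<longleftrightarrow> continuous_on UNIV f"
| "C_k (Suc k) f \<longleftrightarrow>
     (\<forall>x. f differentiable (at x)) \<and> (\<forall>v. C_k k (\<lambda>x. frechet_derivative f (at x) v))"

definition smooth :: "('a::real_normed_vector \<Rightarrow> real) \<Rightarrow> bool" where
  "smooth f \<longleftrightarrow> (\<forall>k. C_k k f)"

definition partial :: "'n \<Rightarrow> (real^'n \<Rightarrow> real) \<Rightarrow> real^'n \<Rightarrow> real" where
  "partial i f x = frechet_derivative f (at x) (axis i 1)"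

definition grad :: "(real^'n \<Rightarrow> real) \<Rightarrow> real^'n \<Rightarrow> real^'n" where
  "grad f x = (\<chi> i. partial i f x)"

definition laplacian :: "(real^'n \<Rightarrow> real) \<Rightarrow> real^'n \<Rightarrow> real" where
  "laplacian f x = (\<Sum>i\<in>UNIV. partial i (partial i f) x)"

definition spacetime_smooth :: "(real \<Rightarrow> real^'n \<Rightarrow> real) \<Rightarrow> bool" where
  "spacetime_smooth \<phi> \<longleftrightarrow> smooth (\<lambda>(t, x). \<phi> t x) \<and> (\<forall>t. torus_periodic (\<phi> t))"

text \<open>
  The torus is compact, so compact support is a condition on time only. An element of
  \<open>C\<^sub>c\<^sup>\<infinity>([0,T) \<times> \<T>\<^sup>d)\<close> is represented by a smooth extension to all times; values at negative times play
  no role.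
\<close>

definition test_fun_initial :: "real \<Rightarrow> (real \<Rightarrow> real^'n \<Rightarrow> real) \<Rightarrow> bool" where
  "test_fun_initial T \<phi> \<longleftrightarrow>
     spacetime_smooth \<phi> \<and> (\<exists>c<T. \<forall>t x. c \<le> t \<longrightarrow> \<phi> t x = 0)"

definition test_fun_interior :: "real \<Rightarrow> (real \<Rightarrow> real^'n \<Rightarrow> real) \<Rightarrow> bool" where
  "test_fun_interior T \<phi> \<longleftrightarrow>
     spacetime_smooth \<phi> \<and> (\<exists>a>0. \<exists>c<T. \<forall>t x. t \<le> a \<or> c \<le> t \<longrightarrow> \<phi> t x = 0)"


section \<open>The advection-diffusion equation\<close>

definition divergence_free :: "real \<Rightarrow> (real \<Rightarrow> real^'n \<Rightarrow> real^'n) \<Rightarrow> bool" where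
  "divergence_free T b \<longleftrightarrow>
     (\<forall>\<phi>. test_fun_interior T \<phi> \<longrightarrow>
        (LINT t|lebesgue_on {0..T}. (LINT x|torus. b t x \<bullet> grad (\<phi> t) x)) = 0)"

definition distributional_solution ::
  "real \<Rightarrow> ennreal \<Rightarrow> (real \<Rightarrow> real^'n \<Rightarrow> real^'n) \<Rightarrow> (real^'n \<Rightarrow> real) \<Rightarrow>
     (real \<Rightarrow> real^'n \<Rightarrow> real) \<Rightarrow> bool" where
  "distributional_solution T q b u0 u \<longleftrightarrow>
     Lr_Lp T \<infinity> q u \<and>
     (\<forall>\<phi>. test_fun_initial T \<phi> \<longrightarrow>
        (LINT t|lebesgue_on {0..T}. (LINT x|torus.
           u t x * (deriv (\<lambda>s. \<phi> s x) t + b t x \<bullet> grad (\<phi> t) x + laplacian (\<phi> t) x)))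
        + (LINT x|torus. u0 x * \<phi> 0 x) = 0)"

text \<open>\<open>g\<close> is the distributional gradient of \<open>f\<close>, both being square integrable.\<close>

definition H1_gradient :: "(real^'n \<Rightarrow> real) \<Rightarrow> (real^'n \<Rightarrow> real^'n) \<Rightarrow> bool" where
  "H1_gradient f g \<longleftrightarrow>
     torus_Lp 2 f \<and> torus_Lp 2 g \<and>
     (\<forall>\<psi>. smooth \<psi> \<and> torus_periodic \<psi> \<longrightarrow>
        (\<forall>i. (LINT x|torus. f x * partial i \<psi> x) = - (LINT x|torus. g x $ i * \<psi> x)))"

text \<open>A representative of the weak gradient (unique up to null sets) of a function in \<open>H\<^sup>1(\<T>\<^sup>d)\<close>.\<close>

definition weak_grad :: "(real^'n \<Rightarrow> real) \<Rightarrow> real^'n \<Rightarrow> real^'n" where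
  "weak_grad f = (SOME g. H1_gradient f g)"

definition L2_H1 :: "real \<Rightarrow> (real \<Rightarrow> real^'n \<Rightarrow> real) \<Rightarrow> bool" where
  "L2_H1 T u \<longleftrightarrow>
     Lr_Lp T 2 2 u \<and>
     (\<exists>G. Lr_Lp T 2 2 G \<and> (AE t in lebesgue_on {0..T}. H1_gradient (u t) (G t)))"

text \<open>
  \<open>v\<close> is the modification of \<open>u\<close> on a null set of times that is continuous from \<open>[0,T]\<close> to
  \<open>L\<^sup>2(\<T>\<^sup>d)\<close> with the weak topology.
\<close>

definition weakly_continuous_rep ::
  "real \<Rightarrow> (real \<Rightarrow> real^'n \<Rightarrow> real) \<Rightarrow> (real \<Rightarrow> real^'n \<Rightarrow> real) \<Rightarrow> bool" where
  "weakly_continuous_rep T u v \<longleftrightarrow>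
     (AE t in lebesgue_on {0..T}. AE x in torus. v t x = u t x) \<and>
     (\<forall>t\<in>{0..T}. torus_Lp 2 (v t)) \<and>
     (\<forall>w::real^'n \<Rightarrow> real. torus_Lp 2 w \<longrightarrow> continuous_on {0..T} (\<lambda>t. LINT x|torus. v t x * w x))"

end

theory Submission
  imports Defs
begin

text \<open>
  Since \<open>1/p + 1/q \<le> 1/2\<close>, the flux \<open>u b\<close> is square integrable in space-time, so \<open>u\<close> solves a heat equation
  whose right hand side is the divergence of an \<open>L\<^sup>2\<close> field. In a real orthonormal basis of eigenfunctions of
  the Laplacian this is a scalar linear ODE for every coefficient of \<open>u\<close>; its energy balance, summed over
  the modes, gives \<open>u \<in> L\<^sup>2 H\<^sup>1\<close>, the weakly continuous representative, and the energy identity up to the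
  transport term \<open>\<integral>\<integral> u b \<bullet> \<nabla>u\<close>. That term vanishes: for the Fejer means \<open>u\<^sub>N\<close> it does, because
  \<open>u\<^sub>N \<nabla>u\<^sub>N\<close> is the gradient of a trigonometric polynomial and \<open>b\<close> is divergence-free, and one can pass to the limit
  since \<open>\<nabla>u\<^sub>N \<rightarrow> \<nabla>u\<close> strongly while \<open>u\<^sub>N b\<close> stays bounded in \<open>L\<^sup>2\<close> (the Fejer kernel is nonnegative, and the
  Hoelder bound on \<open>u b\<close> is invariant under translations of \<open>u\<close>) and converges to \<open>u b\<close>.
\<close>

section \<open>Square integrable functions\<close>

text \<open>A priori u is only in L^q, so the transport term cannot even be stated. The Fourier
  energy estimate therefore treats u b as a given L^2 source and yields H^1 regularity without any
  cancellation, at the price of a bound containing the flux; only with the gradient in hand does the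
  cancellation make sense. There, square partial sums of the Fourier series do not serve: those of a
  bounded function need not stay bounded. A Fejer mean is an average of translates, so its product
  with b inherits the Hoelder bound for every admissible pair of exponents. Convergence of the means
  in L^q fails for q = infinity and is avoided: the gradient of \<open>u_N\<close> is exchanged for
  that of a fixed mean \<open>u_M\<close>, which is bounded, so that L^2 convergence of
  \<open>u_N\<close> and square integrability of b suffice. Moreover, a jointly Lebesgue measurable
  function need not be measurable for the product of the Lebesgue measures, and most information
  holds only at almost every time. The analysis is therefore done for periodic Borel versions of u
  and b, set to zero on a null set of times.\<close>

definition square_integrable :: "'a measure \<Rightarrow> ('a \<Rightarrow> real) \<Rightarrow> bool" where
  "square_integrable M f \<longleftrightarrow> f \<in> borel_measurable M \<and> integrable M (\<lambda>x. (f x)\<^sup>2)"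

lemma square_integrable_measurable [measurable_dest]:
  "square_integrable M f \<Longrightarrow> f \<in> borel_measurable M"
  by (simp add: square_integrable_def)

lemma square_integrable_square: "square_integrable M f \<Longrightarrow> integrable M (\<lambda>x. (f x)\<^sup>2)"
  by (simp add: square_integrable_def)

lemma square_integrable_mult:
  assumes f: "square_integrable M f" and g: "square_integrable M g"
  shows "integrable M (\<lambda>x. f x * g x)"
proof (rule Bochner_Integration.integrable_bound)
  show "integrable M (\<lambda>x. (f x)\<^sup>2 + (g x)\<^sup>2)"
    using f g by (simp add: square_integrable_def)
  show "(\<lambda>x. f x * g x) \<in> borel_measurable M"
    using f g by measurable
  have "\<bar>f x * g x\<bar> \<le> (f x)\<^sup>2 + (g x)\<^sup>2" for x
    using sum_squares_bound[of "\<bar>f x\<bar>" "\<bar>g x\<bar>"] mult_nonneg_nonneg[OF abs_ge_zero[of "f x"] abs_ge_zero[of "g x"]]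
    unfolding abs_mult power2_abs by linarith
  then show "AE x in M. norm (f x * g x) \<le> norm ((f x)\<^sup>2 + (g x)\<^sup>2)"
    by simp
qed

lemma square_integrable_add:
  assumes f: "square_integrable M f" and g: "square_integrable M g"
  shows "square_integrable M (\<lambda>x. f x + g x)"
  using square_integrable_mult[OF f g] f g
  by (auto simp: square_integrable_def power2_sum mult.assoc)

lemma square_integrable_cmult:
  assumes f: "square_integrable M f"
  shows "square_integrable M (\<lambda>x. c * f x)"
  using f by (auto simp: square_integrable_def power_mult_distrib)

lemma square_integrable_diff:
  assumes f: "square_integrable M f" and g: "square_integrable M g"
  shows "square_integrable M (\<lambda>x. f x - g x)"
  using square_integrable_add[OF f square_integrable_cmult[OF g, of "-1"]] by simp

lemma square_integrable_sum:
  assumes "\<And>i. i \<in> S \<Longrightarrow> square_integrable M (f i)"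
  shows "square_integrable M (\<lambda>x. \<Sum>i\<in>S. f i x)"
proof (cases "finite S")
  case True
  from True assms show ?thesis
    by (induction S) (simp_all add: square_integrable_def[of _ "\<lambda>x. 0"] square_integrable_add)
qed (simp add: square_integrable_def)

lemma square_integrable_bounded_mult:
  assumes f: "square_integrable M f" and g: "g \<in> borel_measurable M" "\<And>x. x \<in> space M \<Longrightarrow> \<bar>g x\<bar> \<le> C"
  shows "square_integrable M (\<lambda>x. g x * f x)"
  unfolding square_integrable_def
proof
  have [measurable]: "f \<in> borel_measurable M" "g \<in> borel_measurable M"
    using f g by auto
  show "(\<lambda>x. g x * f x) \<in> borel_measurable M" by simp
  show "integrable M (\<lambda>x. (g x * f x)\<^sup>2)"
  proof (rule Bochner_Integration.integrable_bound)
    show "integrable M (\<lambda>x. C\<^sup>2 * (f x)\<^sup>2)" using f by (simp add: square_integrable_def)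
    have "(g x * f x)\<^sup>2 \<le> C\<^sup>2 * (f x)\<^sup>2" if "x \<in> space M" for x
      using power_mono[OF g(2)[OF that], of 2] by (simp add: power_mult_distrib mult_right_mono)
    then show "AE x in M. norm ((g x * f x)\<^sup>2) \<le> norm (C\<^sup>2 * (f x)\<^sup>2)" by auto
  qed simp
qed

lemma (in finite_measure) square_integrable_bounded:
  assumes "g \<in> borel_measurable M" "\<And>x. x \<in> space M \<Longrightarrow> \<bar>g x\<bar> \<le> C"
  shows "square_integrable M g"
proof -
  have "square_integrable M (\<lambda>x. 1::real)" by (simp add: square_integrable_def)
  from square_integrable_bounded_mult[OF this assms] show ?thesis by simp
qed

lemma square_integrable_cong_AE:
  assumes "square_integrable M f" "AE x in M. f x = g x" "g \<in> borel_measurable M"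
  shows "square_integrable M g"
  using assms unfolding square_integrable_def
  by (auto intro: integrable_cong_AE_imp)

lemma square_integral_add:
  assumes f: "square_integrable M f" and g: "square_integrable M g"
  shows "(LINT x|M. (f x + g x)\<^sup>2)
    = (LINT x|M. (f x)\<^sup>2) + 2 * (LINT x|M. f x * g x) + (LINT x|M. (g x)\<^sup>2)"
  using square_integrable_mult[OF f g] f g
  by (simp add: square_integrable_def power2_sum mult.assoc)

lemma square_integral_diff:
  assumes f: "square_integrable M f" and g: "square_integrable M g"
  shows "(LINT x|M. (f x - g x)\<^sup>2)
    = (LINT x|M. (f x)\<^sup>2) - 2 * (LINT x|M. f x * g x) + (LINT x|M. (g x)\<^sup>2)"
  using square_integral_add[OF f square_integrable_cmult[OF g, of "-1"]] by simp

lemma square_integral_add_le: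
  assumes f: "square_integrable M f" and g: "square_integrable M g"
  shows "(LINT x|M. (f x + g x)\<^sup>2) \<le> 2 * (LINT x|M. (f x)\<^sup>2) + 2 * (LINT x|M. (g x)\<^sup>2)"
proof -
  have "0 \<le> (LINT x|M. (f x - g x)\<^sup>2)" by simp
  then show ?thesis
    using square_integral_add[OF f g] square_integral_diff[OF f g] by linarith
qed

text \<open>The integral of (f - s g)^2 is a nonnegative quadratic polynomial in s. Its minimum at s
  = b / c gives the claim; if c = 0 it is linear in s, which forces b = 0.\<close>

lemma Cauchy_Schwarz_integral:
  assumes f: "square_integrable M f" and g: "square_integrable M g"
  shows "(LINT x|M. f x * g x)\<^sup>2 \<le> (LINT x|M. (f x)\<^sup>2) * (LINT x|M. (g x)\<^sup>2)"
proof -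
  let ?a = "LINT x|M. (f x)\<^sup>2" and ?b = "LINT x|M. f x * g x" and ?c = "LINT x|M. (g x)\<^sup>2"
  have *: "0 \<le> ?a - 2 * s * ?b + s\<^sup>2 * ?c" for s
  proof -
    have "0 \<le> (LINT x|M. (f x - s * g x)\<^sup>2)" by simp
    also have "\<dots> = ?a - 2 * s * ?b + s\<^sup>2 * ?c"
      using square_integral_diff[OF f square_integrable_cmult[OF g, of s]]
      by (simp add: power_mult_distrib mult.left_commute[of _ s])
    finally show ?thesis .
  qed
  have c0: "0 \<le> ?c" by simp
  show ?thesis
  proof (cases "?c = 0")
    case True
    have "?b = 0"
    proof (rule ccontr)
      assume b: "?b \<noteq> 0"
      \<comment> \<open>This choice of s makes the linear expression equal to -1.\<close>
      have "0 \<le> ?a - 2 * ((?a + 1) / (2 * ?b)) * ?b" using *[of "(?a + 1) / (2 * ?b)"] True by simp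
      also have "2 * ((?a + 1) / (2 * ?b)) * ?b = ?a + 1" using b by (simp add: field_simps)
      finally show False by simp
    qed
    then show ?thesis using True by simp
  next
    case False
    then have "0 < ?c" using c0 by linarith
    then show ?thesis using *[of "?b / ?c"]
      by (simp add: field_simps power2_eq_square)
  qed
qed

lemma (in finite_measure) square_integrable_integrable:
  "square_integrable M f \<Longrightarrow> integrable M f"
  using square_integrable_imp_integrable by (auto simp: square_integrable_def)

text \<open>The limit is given by an explicit formula so that it inherits measurability with respect to
  other \<open>\<sigma>\<close>-algebras.\<close>

lemma (in finite_measure) square_integrable_complete:
  fixes s :: "nat \<Rightarrow> 'a \<Rightarrow> real"
  assumes s: "\<And>n. square_integrable M (s n)"
    and Cauchy: "\<And>e. 0 < e \<Longrightarrow> \<exists>N. \<forall>i\<ge>N. \<forall>j\<ge>N. (LINT x|M. (s i x - s j x)\<^sup>2) < e"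
  shows "\<exists>r. square_integrable M (\<lambda>x. lim (\<lambda>i. s (r i) x)) \<and>
    (\<lambda>n. LINT x|M. (s n x - lim (\<lambda>i. s (r i) x))\<^sup>2) \<longlonglongrightarrow> 0"
proof -
  have [measurable]: "s n \<in> borel_measurable M" for n using s by auto
  \<comment> \<open>On a finite measure an L^2 Cauchy sequence is L^1 Cauchy, and L^1 Cauchy
    sequences have subsequences that converge almost everywhere. The summand 1 in the bound guards
    against a measure of total mass zero.\<close>
  have L1: "\<exists>N. \<forall>i\<ge>N. \<forall>j\<ge>N. (LINT x|M. norm (s i x - s j x)) < e" if "0 < e" for e :: real
  proof -
    have mpos: "0 < measure M (space M) + 1" by (simp add: add_nonneg_pos)
    have "0 < e\<^sup>2 / (measure M (space M) + 1)"
      using that mpos by (intro divide_pos_pos) auto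
    then obtain N where N: "\<And>i j. i \<ge> N \<Longrightarrow> j \<ge> N \<Longrightarrow>
      (LINT x|M. (s i x - s j x)\<^sup>2) < e\<^sup>2 / (measure M (space M) + 1)" using Cauchy by blast
    have "(LINT x|M. norm (s i x - s j x)) < e" if "i \<ge> N" "j \<ge> N" for i j
    proof -
      have d: "square_integrable M (\<lambda>x. norm (s i x - s j x))"
        using square_integrable_diff[OF s s, of i j] by (simp add: square_integrable_def)
      have one: "square_integrable M (\<lambda>x. 1::real)" by (simp add: square_integrable_def)
      have "(LINT x|M. norm (s i x - s j x))\<^sup>2 \<le> (LINT x|M. (s i x - s j x)\<^sup>2) * measure M (space M)"
        using Cauchy_Schwarz_integral[OF d one] by simp
      also have "\<dots> \<le> (LINT x|M. (s i x - s j x)\<^sup>2) * (measure M (space M) + 1)"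
        by (intro mult_left_mono) auto
      also have "\<dots> < e\<^sup>2"
        using N[OF that] mpos by (simp add: pos_less_divide_eq)
      finally show ?thesis using \<open>0 < e\<close> by (simp add: power2_less_imp_less)
    qed
    then show ?thesis by blast
  qed
  obtain r where r: "strict_mono r" "AE x in M. Cauchy (\<lambda>i. s (r i) x)"
    using cauchy_L1_AE_cauchy_subseq[of M s] L1 square_integrable_integrable[OF s] by metis
  define g where "g x = lim (\<lambda>i. s (r i) x)" for x
  have conv: "AE x in M. (\<lambda>i. s (r i) x) \<longlonglongrightarrow> g x"
    using r(2) by eventually_elim (simp add: g_def Cauchy_convergent_iff convergent_LIMSEQ_iff)
  have [measurable]: "g \<in> borel_measurable M" unfolding g_def by measurable
  \<comment> \<open>Fatou's lemma along the subsequence transfers the Cauchy estimate to the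
    limit.\<close>
  have est: "\<exists>N. \<forall>n\<ge>N. (\<integral>\<^sup>+x. ennreal ((s n x - g x)\<^sup>2) \<partial>M) \<le> ennreal e" if "0 < e" for e
  proof -
    obtain N where N: "\<And>i j. i \<ge> N \<Longrightarrow> j \<ge> N \<Longrightarrow> (LINT x|M. (s i x - s j x)\<^sup>2) < e"
      using Cauchy[OF \<open>0 < e\<close>] by blast
    have "(\<integral>\<^sup>+x. ennreal ((s n x - g x)\<^sup>2) \<partial>M) \<le> ennreal e" if "n \<ge> N" for n
    proof -
      have "(\<integral>\<^sup>+x. ennreal ((s n x - g x)\<^sup>2) \<partial>M)
          = (\<integral>\<^sup>+x. liminf (\<lambda>i. ennreal ((s n x - s (r i) x)\<^sup>2)) \<partial>M)"
      proof (rule nn_integral_cong_AE, use conv in eventually_elim)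
        fix x assume "(\<lambda>i. s (r i) x) \<longlonglongrightarrow> g x"
        then have "(\<lambda>i. ennreal ((s n x - s (r i) x)\<^sup>2)) \<longlonglongrightarrow> ennreal ((s n x - g x)\<^sup>2)"
          by (intro tendsto_ennrealI tendsto_intros)
        then show "ennreal ((s n x - g x)\<^sup>2) = liminf (\<lambda>i. ennreal ((s n x - s (r i) x)\<^sup>2))"
          by (rule lim_imp_Liminf[OF sequentially_bot, symmetric])
      qed
      also have "\<dots> \<le> liminf (\<lambda>i. \<integral>\<^sup>+x. ennreal ((s n x - s (r i) x)\<^sup>2) \<partial>M)"
        by (rule nn_integral_liminf) simp
      also have "\<dots> \<le> liminf (\<lambda>i. ennreal e)"
      proof (rule Liminf_mono)
        show "\<forall>\<^sub>F i in sequentially. (\<integral>\<^sup>+x. ennreal ((s n x - s (r i) x)\<^sup>2) \<partial>M) \<le> ennreal e"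
          using eventually_ge_at_top[of N]
        proof eventually_elim
          fix i assume "N \<le> i"
          then have "N \<le> r i" using seq_suble[OF r(1), of i] by simp
          then show "(\<integral>\<^sup>+x. ennreal ((s n x - s (r i) x)\<^sup>2) \<partial>M) \<le> ennreal e"
            using N[OF \<open>n \<ge> N\<close>, of "r i"] square_integrable_diff[OF s s]
            by (subst nn_integral_eq_integral) (auto simp: square_integrable_def intro!: ennreal_leI)
        qed
      qed
      finally show ?thesis by (simp add: Liminf_const)
    qed
    then show ?thesis by blast
  qed
  have sg: "square_integrable M (\<lambda>x. s n x - g x)" if "(\<integral>\<^sup>+x. ennreal ((s n x - g x)\<^sup>2) \<partial>M) \<le> ennreal e" for n e
    using that le_less_trans[OF that ennreal_less_top] by (auto simp: square_integrable_def integrable_iff_bounded)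
  have g: "square_integrable M g"
  proof -
    obtain N where "\<And>n. n\<ge>N \<Longrightarrow> (\<integral>\<^sup>+x. ennreal ((s n x - g x)\<^sup>2) \<partial>M) \<le> ennreal 1"
      using est[of 1] by auto
    from square_integrable_diff[OF s sg[OF this[of N]], of N] show ?thesis by simp
  qed
  have "(\<lambda>n. LINT x|M. (s n x - g x)\<^sup>2) \<longlonglongrightarrow> 0"
  proof (rule LIMSEQ_I)
    fix e :: real assume "0 < e"
    then obtain N where N: "\<And>n. n\<ge>N \<Longrightarrow> (\<integral>\<^sup>+x. ennreal ((s n x - g x)\<^sup>2) \<partial>M) \<le> ennreal (e/2)"
      using est[of "e/2"] by auto
    have "(LINT x|M. (s n x - g x)\<^sup>2) \<le> e/2" if "n \<ge> N" for n
      using N[OF that] \<open>0 < e\<close> square_integrable_diff[OF s g]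
      by (subst (asm) nn_integral_eq_integral) (auto simp: square_integrable_def)
    then show "\<exists>N. \<forall>n\<ge>N. norm ((LINT x|M. (s n x - g x)\<^sup>2) - 0) < e"
      using \<open>0 < e\<close> by (intro exI[of _ N]) fastforce
  qed
  with g show ?thesis unfolding g_def by blast
qed

section \<open>Sums over countable types\<close>

text \<open>An exhaustion of a countable type by finite sets, through which integrals over
  \<open>count_space\<close> become limits of sequences of finite sums.\<close>

definition first_indices :: "nat \<Rightarrow> 'k::countable set" where
  "first_indices n = {k. to_nat k < n}"

lemma finite_first_indices [simp]: "finite (first_indices n)"
proof -
  have "inj_on to_nat (first_indices n)" by (simp add: inj_on_def)
  moreover have "finite (to_nat ` first_indices n)"
    by (rule finite_subset[of _ "{..<n}"]) (auto simp: first_indices_def)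
  ultimately show ?thesis using finite_imageD by blast
qed

lemma first_indices_mono: "m \<le> n \<Longrightarrow> first_indices m \<subseteq> first_indices n"
  by (auto simp: first_indices_def)

lemma eventually_first_indices: "\<forall>\<^sub>F n in sequentially. k \<in> first_indices n"
  using eventually_gt_at_top[of "to_nat k"] by eventually_elim (simp add: first_indices_def)

lemma integral_count_space_indicator:
  fixes c :: "'k \<Rightarrow> real"
  assumes B: "finite B"
  shows "integrable (count_space UNIV) (\<lambda>k. indicator B k * c k)"
    and "(LINT k|count_space UNIV. indicator B k * c k) = (\<Sum>k\<in>B. c k)"
proof -
  have supp: "{k. indicator B k * c k \<noteq> 0} = {k \<in> B. c k \<noteq> 0}"
    by (auto simp: indicator_def)
  then show "(LINT k|count_space UNIV. indicator B k * c k) = (\<Sum>k\<in>B. c k)"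
    using B by (subst lebesgue_integral_count_space_finite_support)
      (auto intro!: sum.mono_neutral_cong_left simp: indicator_def)
  have eq: "(\<lambda>k. indicator B k * c k) = (\<lambda>k. \<Sum>l\<in>B. indicator {l} k * c l)"
    using B by (auto simp: fun_eq_iff indicator_def if_distrib sum.If_cases cong: if_cong)
  show "integrable (count_space UNIV) (\<lambda>k. indicator B k * c k)"
    unfolding eq
    by (intro Bochner_Integration.integrable_sum integrable_mult_left) (simp add: integrable_indicator_iff)
qed

lemma sum_first_indices_tendsto:
  fixes c :: "'k::countable \<Rightarrow> real"
  assumes c: "integrable (count_space UNIV) c"
  shows "(\<lambda>n. \<Sum>k\<in>first_indices n. c k) \<longlonglongrightarrow> (LINT k|count_space UNIV. c k)"
proof -
  have "(\<lambda>n. LINT k|count_space UNIV. indicator (first_indices n) k * c k) \<longlonglongrightarrow> (LINT k|count_space UNIV. c k)"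
  proof (rule integral_dominated_convergence[where w = "\<lambda>k. \<bar>c k\<bar>"])
    have "(\<lambda>n. indicator (first_indices n) k * c k) \<longlonglongrightarrow> c k" for k
      by (rule tendsto_eventually) (use eventually_first_indices[of k] in eventually_elim, simp)
    then show "AE k in count_space UNIV. (\<lambda>n. indicator (first_indices n) k * c k) \<longlonglongrightarrow> c k" by simp
  qed (use c in \<open>auto simp: indicator_def\<close>)
  then show ?thesis by (simp add: integral_count_space_indicator)
qed

text \<open>Monotone convergence along the exhaustion \<open>first_indices\<close>.\<close>

lemma nn_integral_count_le:
  fixes c :: "'k::countable \<Rightarrow> ennreal"
  assumes "\<And>S. finite S \<Longrightarrow> (\<Sum>k\<in>S. c k) \<le> C"
  shows "(\<integral>\<^sup>+k. c k \<partial>count_space UNIV) \<le> C"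
proof -
  have "(\<integral>\<^sup>+k. c k \<partial>count_space UNIV)
      = (\<integral>\<^sup>+k. (SUP n. indicator (first_indices n) k * c k) \<partial>count_space UNIV)"
  proof (rule nn_integral_cong)
    fix k :: 'k
    obtain n where n: "k \<in> first_indices n"
      using eventually_first_indices[of k] by (auto simp: eventually_sequentially)
    show "c k = (SUP n. indicator (first_indices n) k * c k)"
      by (rule antisym, rule SUP_upper2[of n]) (auto intro!: SUP_least simp: n indicator_def)
  qed
  also have "\<dots> = (SUP n. \<integral>\<^sup>+k. indicator (first_indices n) k * c k \<partial>count_space UNIV)"
  proof (rule nn_integral_monotone_convergence_SUP)
    show "incseq (\<lambda>n k. indicator (first_indices n) k * c k)"
      using first_indices_mono by (auto simp: incseq_def le_fun_def indicator_def)
  qed simp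
  also have "\<dots> \<le> C"
  proof (rule SUP_least)
    fix n
    have "(\<integral>\<^sup>+k. indicator (first_indices n) k * c k \<partial>count_space UNIV) = (\<Sum>k\<in>first_indices n. c k)"
      by (subst nn_integral_count_space'[of "first_indices n"]) auto
    then show "(\<integral>\<^sup>+k. indicator (first_indices n) k * c k \<partial>count_space UNIV) \<le> C"
      using assms[of "first_indices n"] by simp
  qed
  finally show ?thesis .
qed

lemma square_summableI:
  fixes c :: "'k::countable \<Rightarrow> real"
  assumes "\<And>S. finite S \<Longrightarrow> (\<Sum>k\<in>S. (c k)\<^sup>2) \<le> C"
  shows "square_integrable (count_space UNIV) c" "(LINT k|count_space UNIV. (c k)\<^sup>2) \<le> C"
proof -
  have "(\<integral>\<^sup>+k. ennreal ((c k)\<^sup>2) \<partial>count_space UNIV) \<le> ennreal C"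
    using assms by (intro nn_integral_count_le) (simp add: sum_ennreal ennreal_leI)
  moreover have "0 \<le> C" using assms[of "{}"] by simp
  moreover from calculation(1) show i: "square_integrable (count_space UNIV) c"
    by (auto simp: square_integrable_def integrable_iff_bounded intro: le_less_trans)
  ultimately show "(LINT k|count_space UNIV. (c k)\<^sup>2) \<le> C"
    by (subst (asm) nn_integral_eq_integral) (auto simp: square_integrable_def)
qed

section \<open>Orthonormal systems\<close>

text \<open>The sequence space l^2 over the index type is \<open>square_integrable\<close> for
  \<open>count_space\<close>, so the same lemmas serve functions and their coefficients.\<close>

locale orthonormal_system = finite_measure M for M :: "'a measure" +
  fixes h :: "'k::countable \<Rightarrow> 'a \<Rightarrow> real"
  assumes h_sq [simp]: "square_integrable M (h k)"
    and orthonormal: "(LINT x|M. h k x * h l x) = (if k = l then 1 else 0)"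
begin

definition coef :: "('a \<Rightarrow> real) \<Rightarrow> 'k \<Rightarrow> real" where
  "coef f k = (LINT x|M. f x * h k x)"

lemma square_integrable_comb [simp]: "square_integrable M (\<lambda>x. \<Sum>k\<in>S. c k * h k x)"
  by (intro square_integrable_sum square_integrable_cmult h_sq)

lemma inner_comb:
  assumes f: "square_integrable M f"
  shows "(LINT x|M. f x * (\<Sum>k\<in>S. c k * h k x)) = (\<Sum>k\<in>S. c k * coef f k)"
proof -
  have "(LINT x|M. f x * (\<Sum>k\<in>S. c k * h k x)) = (LINT x|M. (\<Sum>k\<in>S. c k * (f x * h k x)))"
    by (simp add: sum_distrib_left algebra_simps)
  also have "\<dots> = (\<Sum>k\<in>S. c k * coef f k)"
    by (subst Bochner_Integration.integral_sum)
      (auto simp: coef_def intro!: square_integrable_mult[OF f])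
  finally show ?thesis .
qed

lemma coef_comb:
  assumes "finite S"
  shows "coef (\<lambda>x. \<Sum>k\<in>S. c k * h k x) l = (if l \<in> S then c l else 0)"
proof -
  have "coef (\<lambda>x. \<Sum>k\<in>S. c k * h k x) l = (LINT x|M. h l x * (\<Sum>k\<in>S. c k * h k x))"
    by (simp add: coef_def mult.commute)
  also have "\<dots> = (\<Sum>k\<in>S. c k * (if l = k then 1 else 0))"
    by (simp add: inner_comb coef_def orthonormal)
  also have "\<dots> = (if l \<in> S then c l else 0)" using assms by (simp add: if_distrib cong: if_cong)
  finally show ?thesis .
qed

lemma square_integral_comb:
  assumes "finite S"
  shows "(LINT x|M. (\<Sum>k\<in>S. c k * h k x)\<^sup>2) = (\<Sum>k\<in>S. (c k)\<^sup>2)"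
  using inner_comb[OF square_integrable_comb, of c S c S] assms
  by (simp add: power2_eq_square coef_comb cong: sum.cong)

lemma coef_diff:
  assumes "square_integrable M f" "square_integrable M g"
  shows "coef (\<lambda>x. f x - g x) k = coef f k - coef g k"
  using assms by (simp add: coef_def left_diff_distrib square_integrable_mult)

lemma Bessel_finite:
  assumes f: "square_integrable M f" and "finite S"
  shows "(\<Sum>k\<in>S. (coef f k)\<^sup>2) \<le> (LINT x|M. (f x)\<^sup>2)"
proof -
  let ?p = "\<lambda>x. \<Sum>k\<in>S. coef f k * h k x"
  have "0 \<le> (LINT x|M. (f x - ?p x)\<^sup>2)" by simp
  also have "\<dots> = (LINT x|M. (f x)\<^sup>2) - 2 * (\<Sum>k\<in>S. coef f k * coef f k) + (\<Sum>k\<in>S. (coef f k)\<^sup>2)"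
    using square_integral_diff[OF f square_integrable_comb, of "coef f" S]
    by (simp add: inner_comb[OF f] square_integral_comb[OF assms(2)])
  finally show ?thesis by (simp add: power2_eq_square)
qed

lemma coef_square_le:
  assumes f: "square_integrable M f"
  shows "(coef f k)\<^sup>2 \<le> (LINT x|M. (f x)\<^sup>2)"
  using Bessel_finite[OF f, of "{k}"] by simp

lemma square_summable_coef:
  assumes f: "square_integrable M f"
  shows "square_integrable (count_space UNIV) (coef f)"
    and Bessel: "(LINT k|count_space UNIV. (coef f k)\<^sup>2) \<le> (LINT x|M. (f x)\<^sup>2)"
  using square_summableI[OF Bessel_finite[OF f]] by auto

text \<open>By orthonormality, the squared distance of two partial sums is the difference of two
  partial sums of the squared coefficients, so the series is Cauchy. A single coefficient is
  continuous in L^2 by Bessel, which identifies the coefficients of the limit.\<close>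

lemma Riesz_Fischer:
  fixes c :: "'k \<Rightarrow> real"
  assumes c: "square_integrable (count_space UNIV) c"
  obtains g where "square_integrable M g" "\<And>k. coef g k = c k"
    "(\<lambda>n. LINT x|M. ((\<Sum>k\<in>first_indices n. c k * h k x) - g x)\<^sup>2) \<longlonglongrightarrow> 0"
proof -
  define s where "s n x = (\<Sum>k\<in>first_indices n. c k * h k x)" for n x
  have s: "square_integrable M (s n)" for n by (simp add: s_def[abs_def])
  have diff: "s j x - s i x = (\<Sum>k\<in>first_indices j - first_indices i. c k * h k x)" if "i \<le> j" for i j x
  proof -
    have "first_indices i \<subseteq> (first_indices j :: 'k set)" by (rule first_indices_mono[OF that])
    then show ?thesis by (simp add: s_def sum_diff)
  qed
  have conv: "(\<lambda>n. \<Sum>k\<in>first_indices n. (c k)\<^sup>2) \<longlonglongrightarrow> (LINT k|count_space UNIV. (c k)\<^sup>2)"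
    using c by (intro sum_first_indices_tendsto) (simp add: square_integrable_def)
  have dist: "(LINT x|M. (s j x - s i x)\<^sup>2) = (\<Sum>k\<in>first_indices j. (c k)\<^sup>2) - (\<Sum>k\<in>first_indices i. (c k)\<^sup>2)"
    if "i \<le> j" for i j
    unfolding diff[OF that]
    by (subst square_integral_comb) (auto intro!: sum_diff first_indices_mono that)
  have "\<exists>N. \<forall>i\<ge>N. \<forall>j\<ge>N. (LINT x|M. (s i x - s j x)\<^sup>2) < e" if "0 < e" for e
  proof -
    obtain N where N: "\<And>i j. i \<ge> N \<Longrightarrow> j \<ge> N \<Longrightarrow>
        dist (\<Sum>k\<in>first_indices i. (c k)\<^sup>2) (\<Sum>k\<in>first_indices j. (c k)\<^sup>2) < e"
      using LIMSEQ_imp_Cauchy[OF conv] \<open>0 < e\<close> unfolding Cauchy_def by meson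
    have "(LINT x|M. (s i x - s j x)\<^sup>2) < e" if "i \<ge> N" "j \<ge> N" for i j
    proof (cases "i \<le> j")
      case True
      have "(LINT x|M. (s i x - s j x)\<^sup>2) = (LINT x|M. (s j x - s i x)\<^sup>2)"
        by (simp add: power2_commute)
      with dist[OF True] N[OF that] show ?thesis by (auto simp: dist_real_def)
    next
      case False
      with dist[of j i] N[OF that] show ?thesis by (auto simp: dist_real_def)
    qed
    then show ?thesis by blast
  qed
  from square_integrable_complete[OF s this] obtain r where
    r: "square_integrable M (\<lambda>x. lim (\<lambda>i. s (r i) x))"
      "(\<lambda>n. LINT x|M. (s n x - lim (\<lambda>i. s (r i) x))\<^sup>2) \<longlonglongrightarrow> 0" by blast
  define g where "g x = lim (\<lambda>i. s (r i) x)" for x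
  have g: "square_integrable M g" and lim: "(\<lambda>n. LINT x|M. (s n x - g x)\<^sup>2) \<longlonglongrightarrow> 0"
    using r by (auto simp: g_def[abs_def])
  have "coef g k = c k" for k
  proof -
    have "\<forall>\<^sub>F n in sequentially. (c k - coef g k)\<^sup>2 \<le> (LINT x|M. (s n x - g x)\<^sup>2)"
      using eventually_first_indices[of k]
    proof eventually_elim
      fix n assume "k \<in> first_indices n"
      then have "coef (s n) k = c k" by (simp add: s_def[abs_def] coef_comb)
      then show "(c k - coef g k)\<^sup>2 \<le> (LINT x|M. (s n x - g x)\<^sup>2)"
        using coef_square_le[OF square_integrable_diff[OF s g], of n k] coef_diff[OF s g, of n k] by simp
    qed
    from tendsto_le[OF _ lim tendsto_const this] have "(c k - coef g k)\<^sup>2 \<le> 0" by simp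
    then show ?thesis by simp
  qed
  with g lim that show ?thesis by (auto simp: s_def)
qed

end

locale orthonormal_basis = orthonormal_system +
  assumes complete: "square_integrable M f \<Longrightarrow> (\<And>k. coef f k = 0) \<Longrightarrow> AE x in M. f x = 0"
begin

text \<open>By completeness, f agrees almost everywhere with the function that Riesz-Fischer builds
  from its coefficients. The partial sums thus converge to f in L^2, and their pairings with g
  converge by Cauchy-Schwarz.\<close>

lemma Parseval:
  assumes f: "square_integrable M f" and g: "square_integrable M g"
  shows "(LINT k|count_space UNIV. coef f k * coef g k) = (LINT x|M. f x * g x)"
proof -
  obtain f' where f': "square_integrable M f'" "\<And>k. coef f' k = coef f k"
    "(\<lambda>n. LINT x|M. ((\<Sum>k\<in>first_indices n. coef f k * h k x) - f' x)\<^sup>2) \<longlonglongrightarrow> 0"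
    using Riesz_Fischer[OF square_summable_coef(1)[OF f]] by blast
  have "AE x in M. f x - f' x = 0"
    by (intro complete) (auto simp: coef_diff f f' square_integrable_diff)
  then have ae: "AE x in M. f' x = f x" by eventually_elim simp
  define s where "s n x = (\<Sum>k\<in>first_indices n. coef f k * h k x)" for n x
  have s: "square_integrable M (s n)" for n by (simp add: s_def[abs_def])
  have "(\<lambda>n. (LINT x|M. (s n x - f' x) * g x)) \<longlonglongrightarrow> 0"
  proof (rule Lim_null_comparison)
    show "\<forall>\<^sub>F n in sequentially. norm (LINT x|M. (s n x - f' x) * g x)
        \<le> sqrt ((LINT x|M. (s n x - f' x)\<^sup>2) * (LINT x|M. (g x)\<^sup>2))"
      using Cauchy_Schwarz_integral[OF square_integrable_diff[OF s f'(1)] g]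
      by (auto intro!: always_eventually real_le_rsqrt)
    have "(\<lambda>n. sqrt ((LINT x|M. (s n x - f' x)\<^sup>2) * (LINT x|M. (g x)\<^sup>2))) \<longlonglongrightarrow> sqrt (0 * (LINT x|M. (g x)\<^sup>2))"
      using f'(3) unfolding s_def by (intro tendsto_intros)
    then show "(\<lambda>n. sqrt ((LINT x|M. (s n x - f' x)\<^sup>2) * (LINT x|M. (g x)\<^sup>2))) \<longlonglongrightarrow> 0" by simp
  qed
  moreover have "(LINT x|M. (s n x - f' x) * g x)
      = (\<Sum>k\<in>first_indices n. coef f k * coef g k) - (LINT x|M. f x * g x)" for n
  proof -
    have "(LINT x|M. (s n x - f' x) * g x) = (LINT x|M. s n x * g x) - (LINT x|M. f' x * g x)"
      using square_integrable_mult[OF s g] square_integrable_mult[OF f'(1) g]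
      by (simp add: left_diff_distrib)
    moreover have "(LINT x|M. s n x * g x) = (\<Sum>k\<in>first_indices n. coef f k * coef g k)"
      using inner_comb[OF g, of "coef f" "first_indices n"] by (simp add: s_def mult.commute)
    moreover have "(LINT x|M. f' x * g x) = (LINT x|M. f x * g x)"
      using f'(1) f g ae by (intro integral_cong_AE) auto
    ultimately show ?thesis by simp
  qed
  ultimately have "(\<lambda>n. \<Sum>k\<in>first_indices n. coef f k * coef g k) \<longlonglongrightarrow> (LINT x|M. f x * g x)"
    by (simp add: LIM_zero_iff)
  moreover have "(\<lambda>n. \<Sum>k\<in>first_indices n. coef f k * coef g k) \<longlonglongrightarrow> (LINT k|count_space UNIV. coef f k * coef g k)"
    by (intro sum_first_indices_tendsto square_integrable_mult square_summable_coef f g)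
  ultimately show ?thesis by (rule LIMSEQ_unique[OF _, symmetric])
qed

lemma Parseval_square:
  assumes "square_integrable M f"
  shows "(LINT k|count_space UNIV. (coef f k)\<^sup>2) = (LINT x|M. (f x)\<^sup>2)"
  using Parseval[OF assms assms] by (simp add: power2_eq_square)

end

section \<open>Smooth functions\<close>

text \<open>Replaces the \<open>frechet_derivative\<close> in the recursion of \<open>C_k\<close> by
  any explicit derivative D; with the elimination rule below, the closure properties become
  inductions on k.\<close>

lemma C_k_SucI:
  assumes "\<And>x. (f has_derivative D x) (at x)" "\<And>v. C_k k (\<lambda>x. D x v)"
  shows "C_k (Suc k) f"
proof -
  have "frechet_derivative f (at x) = D x" for x
    using frechet_derivative_at[OF assms(1)] by simp
  then show ?thesis using assms by (auto simp: differentiable_def)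
qed

lemma C_k_SucE:
  assumes "C_k (Suc k) f"
  obtains D where "\<And>x. (f has_derivative D x) (at x)" "\<And>v. C_k k (\<lambda>x. D x v)"
  using that[of "\<lambda>x. frechet_derivative f (at x)"] assms by (auto simp: frechet_derivative_works)

lemma C_k_continuous: "C_k k f \<Longrightarrow> continuous_on UNIV f"
  by (cases k) (auto intro!: differentiable_imp_continuous_on simp: differentiable_on_def differentiable_at_withinI)

lemma C_k_mono: "C_k (Suc k) f \<Longrightarrow> C_k k f"
proof (induction k arbitrary: f)
  case 0
  then show ?case using C_k_continuous[OF 0] by simp
next
  case (Suc k)
  from Suc.prems obtain D where D: "\<And>x. (f has_derivative D x) (at x)" "\<And>v. C_k (Suc k) (\<lambda>x. D x v)"
    by (rule C_k_SucE) blast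
  show ?case using C_k_SucI[OF D(1) Suc.IH[OF D(2)]] .
qed

lemma C_k_const: "C_k k (\<lambda>x. c)"
  by (induction k arbitrary: c) (auto intro: C_k_SucI[OF has_derivative_const])

lemma C_k_add: "C_k k f \<Longrightarrow> C_k k g \<Longrightarrow> C_k k (\<lambda>x. f x + g x)"
proof (induction k arbitrary: f g)
  case 0
  then show ?case by (simp add: continuous_on_add)
next
  case (Suc k)
  obtain D where D: "\<And>x. (f has_derivative D x) (at x)" "\<And>v. C_k k (\<lambda>x. D x v)"
    using Suc.prems(1) by (rule C_k_SucE) blast
  obtain E where E: "\<And>x. (g has_derivative E x) (at x)" "\<And>v. C_k k (\<lambda>x. E x v)"
    using Suc.prems(2) by (rule C_k_SucE) blast
  show ?case
    by (rule C_k_SucI[OF has_derivative_add[OF D(1) E(1)]]) (rule Suc.IH[OF D(2) E(2)])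
qed

lemma C_k_mult: "C_k k f \<Longrightarrow> C_k k g \<Longrightarrow> C_k k (\<lambda>x. f x * g x)"
proof (induction k arbitrary: f g)
  case 0
  then show ?case by (simp add: continuous_on_mult)
next
  case (Suc k)
  obtain D where D: "\<And>x. (f has_derivative D x) (at x)" "\<And>v. C_k k (\<lambda>x. D x v)"
    using Suc.prems(1) by (rule C_k_SucE) blast
  obtain E where E: "\<And>x. (g has_derivative E x) (at x)" "\<And>v. C_k k (\<lambda>x. E x v)"
    using Suc.prems(2) by (rule C_k_SucE) blast
  show ?case
    by (rule C_k_SucI[OF has_derivative_mult[OF D(1) E(1)]])
      (intro C_k_add Suc.IH C_k_mono[OF Suc.prems(1)] C_k_mono[OF Suc.prems(2)] D(2) E(2))
qed

lemma C_k_compose_linear: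
  assumes L: "bounded_linear L"
  shows "C_k k f \<Longrightarrow> C_k k (\<lambda>x. f (L x))"
proof (induction k arbitrary: f)
  case 0
  then show ?case
    using continuous_on_compose2[of UNIV f UNIV L] linear_continuous_on[OF L] by simp
next
  case (Suc k)
  obtain D where D: "\<And>x. (f has_derivative D x) (at x)" "\<And>v. C_k k (\<lambda>x. D x v)"
    using Suc.prems(1) by (rule C_k_SucE) blast
  show ?case
    by (rule C_k_SucI[OF has_derivative_compose[OF bounded_linear_imp_has_derivative[OF L] D(1)]])
      (rule Suc.IH[OF D(2)])
qed

lemma C_k_Suc_real:
  assumes "\<And>x. (f has_real_derivative f' x) (at x)" "C_k k f'"
  shows "C_k (Suc k) f"
proof (rule C_k_SucI)
  show "(f has_derivative (\<lambda>v. f' x * v)) (at x)" for x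
    using assms(1)[of x] by (simp add: has_field_derivative_def)
  show "C_k k (\<lambda>x. f' x * v)" for v
    by (intro C_k_mult C_k_const assms)
qed

lemma smooth_const: "smooth (\<lambda>x. c)"
  by (simp add: smooth_def C_k_const)

lemma smooth_add: "smooth f \<Longrightarrow> smooth g \<Longrightarrow> smooth (\<lambda>x. f x + g x)"
  by (simp add: smooth_def C_k_add)

lemma smooth_mult: "smooth f \<Longrightarrow> smooth g \<Longrightarrow> smooth (\<lambda>x. f x * g x)"
  by (simp add: smooth_def C_k_mult)

lemma smooth_compose_linear: "bounded_linear L \<Longrightarrow> smooth f \<Longrightarrow> smooth (\<lambda>x. f (L x))"
  by (simp add: smooth_def C_k_compose_linear)

lemma smooth_real_antiderivative:
  assumes "\<And>x. (f has_real_derivative f' x) (at x)" "smooth f'"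
  shows "smooth f"
proof -
  have "C_k (Suc k) f" for k
    using C_k_Suc_real[OF assms(1)] assms(2) unfolding smooth_def by blast
  then show ?thesis by (auto simp: smooth_def intro: C_k_mono)
qed

lemma smooth_C_k_Suc: "smooth f \<Longrightarrow> C_k (Suc k) f"
  by (simp only: smooth_def)

lemma smooth_has_derivative:
  assumes "smooth f"
  shows "(f has_derivative frechet_derivative f (at x)) (at x)"
  using smooth_C_k_Suc[OF assms, of 0] by (simp add: frechet_derivative_works)

lemma smooth_frechet_derivative: "smooth f \<Longrightarrow> smooth (\<lambda>x. frechet_derivative f (at x) v)"
  using smooth_C_k_Suc[of f] unfolding smooth_def[of "\<lambda>x. frechet_derivative f (at x) v"] by simp

lemma smooth_continuous:
  assumes "smooth f"
  shows "continuous_on S f"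
proof (rule continuous_on_subset[of UNIV])
  have "C_k 0 f" using assms by (simp only: smooth_def)
  then show "continuous_on UNIV f" by (rule C_k_continuous)
qed simp

lemma smooth_real_affine:
  assumes "smooth (f :: real \<Rightarrow> real)"
  shows "smooth (\<lambda>x. f (a * x + b))"
proof -
  have "C_k k (\<lambda>x. g (a * x + b))" if "C_k k g" for k and g :: "real \<Rightarrow> real"
    using that
  proof (induction k arbitrary: g)
    case 0
    then have "continuous_on UNIV g" by simp
    then have "continuous_on UNIV (\<lambda>x. g (a * x + b))"
      by (rule continuous_on_compose2) (auto intro!: continuous_intros)
    then show ?case by simp
  next
    case (Suc k)
    obtain D where D: "\<And>x. (g has_derivative D x) (at x)" "\<And>v. C_k k (\<lambda>x. D x v)"
      using Suc.prems by (rule C_k_SucE) blast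
    have "((\<lambda>x. a * x + b) has_derivative (\<lambda>v. a * v)) (at x)" for x
      by (auto intro!: derivative_eq_intros)
    from has_derivative_compose[OF this D(1)] show ?case
      by (rule C_k_SucI) (rule Suc.IH[OF D(2)])
  qed
  then show ?thesis using assms by (simp add: smooth_def)
qed

text \<open>Both coefficients are arbitrary because differentiation swaps sine and cosine; the
  induction needs a class that is closed under it.\<close>

lemma smooth_trig: "smooth (\<lambda>x::real. a * sin x + b * cos x)"
proof -
  have "C_k k (\<lambda>x::real. a * sin x + b * cos x)" for k a b
  proof (induction k arbitrary: a b)
    case 0
    show ?case by (auto intro!: continuous_intros)
  next
    case (Suc k)
    have "((\<lambda>x::real. a * sin x + b * cos x) has_real_derivative (-b) * sin x + a * cos x) (at x)" for x
      by (auto intro!: derivative_eq_intros)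
    then show ?case by (rule C_k_Suc_real[OF _ Suc.IH])
  qed
  then show ?thesis by (simp add: smooth_def)
qed

section \<open>Smooth functions that vanish on a half-line, and cutoffs in time\<close>

definition flat :: "real poly \<Rightarrow> real \<Rightarrow> real" where
  "flat p x = (if 0 < x then poly p (1 / x) * exp (- 1 / x) else 0)"

lemma flat_div_tendsto: "((\<lambda>h. flat p h / h) \<longlongrightarrow> 0) (at 0)"
proof -
  have "((\<lambda>y. poly q y / exp y) \<longlongrightarrow> 0) at_top" for q :: "real poly"
  proof -
    have "((\<lambda>y. \<Sum>i\<le>degree q. coeff q i * (y ^ i / exp y)) \<longlongrightarrow> (\<Sum>i\<le>degree q. coeff q i * 0)) at_top"
      by (intro tendsto_intros tendsto_power_div_exp_0)
    then show ?thesis by (simp add: poly_altdef sum_divide_distrib)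
  qed
  \<comment> \<open>With y = 1 / h, the division by h multiplies p(y) by y, which is the polynomial
    \<open>pCons 0 p\<close>.\<close>
  from filterlim_compose[OF this filterlim_inverse_at_top_right, of "pCons 0 p"]
  have "((\<lambda>h. poly (pCons 0 p) (inverse h) / exp (inverse h)) \<longlongrightarrow> 0) (at_right 0)" .
  then have "((\<lambda>h. flat p h / h) \<longlongrightarrow> 0) (at_right 0)"
  proof (rule tendsto_cong[THEN iffD1, rotated])
    show "\<forall>\<^sub>F h in at_right 0. poly (pCons 0 p) (inverse h) / exp (inverse h) = flat p h / h"
      using eventually_at_right_less[of "0::real"]
      by eventually_elim (simp add: flat_def exp_minus field_simps)
  qed
  moreover have "((\<lambda>h. flat p h / h) \<longlongrightarrow> 0) (at_left 0)"
  proof (rule tendsto_eventually)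
    show "\<forall>\<^sub>F h in at_left 0. flat p h / h = 0"
      by (auto simp: eventually_at_filter flat_def)
  qed
  ultimately show ?thesis by (simp add: filterlim_at_split)
qed

text \<open>For x > 0 the derivative is (1/x)^2 * (p - p')(1/x) * exp (-1/x), the two
  \<open>pCons 0\<close> being the factor (1/x)^2. The family is closed under differentiation, so
  \<open>smooth_flat\<close> is an induction over all p at once.\<close>

lemma flat_has_derivative:
  "(flat p has_real_derivative flat (pCons 0 (pCons 0 (p - pderiv p))) x) (at x)"
proof (cases x "0::real" rule: linorder_cases)
  case less
  have "((\<lambda>x. 0) has_real_derivative 0) (at x)" by simp
  then have "(flat p has_real_derivative 0) (at x)"
    by (rule has_field_derivative_transform_within_open[of _ _ _ "{..<0}"])
        (use less in \<open>auto simp: flat_def\<close>)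
  then show ?thesis using less by (simp add: flat_def)
next
  case equal
  have "(flat p has_real_derivative 0) (at 0)"
    using flat_div_tendsto[of p] by (simp add: has_field_derivative_iff flat_def[of p 0])
  then show ?thesis using equal by (simp add: flat_def)
next
  case greater
  have "((\<lambda>x. poly p (1 / x) * exp (- 1 / x)) has_real_derivative
      flat (pCons 0 (pCons 0 (p - pderiv p))) x) (at x)"
    using greater
    by (auto intro!: derivative_eq_intros DERIV_chain2[OF poly_DERIV]
        simp: flat_def field_simps power2_eq_square)
  then show ?thesis
    by (rule has_field_derivative_transform_within_open[of _ _ _ "{0<..}"])
        (use greater in \<open>auto simp: flat_def\<close>)
qed

lemma smooth_flat: "smooth (flat p)"
proof -
  have "C_k k (flat p)" for k
  proof (induction k arbitrary: p)
    case 0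
    show ?case using DERIV_isCont[OF flat_has_derivative]
      by (simp add: continuous_on_eq_continuous_at)
  next
    case (Suc k)
    then show ?case using C_k_Suc_real[OF flat_has_derivative] by blast
  qed
  then show ?thesis by (simp add: smooth_def)
qed

definition cutoff :: "real \<Rightarrow> real" where
  "cutoff x = flat [:1:] x"

lemma cutoff_eq: "cutoff x = (if 0 < x then exp (- 1 / x) else 0)"
  by (simp add: cutoff_def flat_def)

lemma cutoff_bounds: "0 \<le> cutoff x" "cutoff x \<le> 1"
  by (auto simp: cutoff_eq)

lemma smooth_cutoff: "smooth cutoff"
  unfolding cutoff_def[abs_def] by (rule smooth_flat)

text \<open>The shift by 1 makes the n-th function vanish for s up to 1/n, so approximations of
  indicators have their supports strictly inside the open interval.\<close>

lemma cutoff_tendsto: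
  assumes "0 < s"
  shows "(\<lambda>n. cutoff (real n * s - 1)) \<longlonglongrightarrow> 1"
proof -
  have lim: "filterlim (\<lambda>n. real n * s - 1) at_top sequentially"
  proof -
    have "filterlim (\<lambda>n. s * real n) at_top sequentially"
      by (rule filterlim_tendsto_pos_mult_at_top[OF tendsto_const assms filterlim_real_sequentially])
    from filterlim_tendsto_add_at_top[OF tendsto_const this, of "- 1"]
    show ?thesis by (simp add: algebra_simps)
  qed
  have "((\<lambda>y::real. exp (- 1 / y)) \<longlongrightarrow> exp 0) at_top"
    by (intro tendsto_intros tendsto_divide_0[OF tendsto_const] filterlim_at_top_imp_at_infinity filterlim_ident)
  from filterlim_compose[OF this lim]
  have "(\<lambda>n. exp (- 1 / (real n * s - 1))) \<longlonglongrightarrow> 1" by simp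
  then show ?thesis
  proof (rule tendsto_cong[THEN iffD1, rotated])
    show "\<forall>\<^sub>F n in sequentially. exp (- 1 / (real n * s - 1)) = cutoff (real n * s - 1)"
      using filterlim_at_top_dense[THEN iffD1, OF lim, rule_format, of 0]
      by eventually_elim (simp add: cutoff_eq)
  qed
qed

lemma smooth_antiderivative_exists:
  assumes "smooth (\<psi> :: real \<Rightarrow> real)"
  obtains \<Psi> where "smooth \<Psi>" "\<And>t. (\<Psi> has_real_derivative \<psi> t) (at t)"
proof -
  have "isCont \<psi> x" for x
    using smooth_continuous[OF assms, of UNIV] by (simp add: continuous_on_eq_continuous_at)
  then obtain \<Psi> where "\<And>t. (\<Psi> has_vector_derivative \<psi> t) (at t)"
    using einterval_antiderivative[of "-\<infinity>" \<infinity> \<psi>] by auto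
  then have "\<And>t. (\<Psi> has_real_derivative \<psi> t) (at t)"
    by (simp add: has_real_derivative_iff_has_vector_derivative)
  with that smooth_real_antiderivative[OF this assms] show ?thesis by blast
qed

section \<open>Functions determined by their integrals\<close>

text \<open>Boxes are stable under intersection and generate the Borel sets, so the integral of F
  vanishes over every Borel set, in particular over the sets where F is positive or
  negative.\<close>

lemma AE_zero_if_integral_boxes_zero:
  fixes F :: "'a::euclidean_space \<Rightarrow> real"
  assumes F: "integrable lborel F"
    and zero: "\<And>a b. (LINT x|lborel. indicator (box a b) x * F x) = 0"
  shows "AE x in lborel. F x = 0"
proof -
  have [measurable]: "F \<in> borel_measurable borel" using F by simp
  have int: "integrable lborel (\<lambda>x. indicator A x * F x)" if "A \<in> sets borel" for A
    using integrable_mult_indicator[OF _ F, of A] that by simp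
  \<comment> \<open>The complement case of the Dynkin argument needs the integral over the whole
    space, which is a limit of integrals over growing boxes.\<close>
  have tot: "(LINT x|lborel. F x) = 0"
  proof -
    have "(\<lambda>n. LINT x|lborel. indicator (box (- real n *\<^sub>R One) (real n *\<^sub>R One)) x * F x)
        \<longlonglongrightarrow> (LINT x|lborel. F x)"
    proof (rule integral_dominated_convergence[where w = "\<lambda>x. \<bar>F x\<bar>"])
      have "(\<lambda>n. indicator (box (- real n *\<^sub>R One) (real n *\<^sub>R One)) x * F x) \<longlonglongrightarrow> F x" for x :: 'a
      proof (rule tendsto_eventually)
        obtain N :: nat where N: "norm x < N" using reals_Archimedean2 by blast
        show "\<forall>\<^sub>F n in sequentially. indicator (box (- real n *\<^sub>R One) (real n *\<^sub>R One)) x * F x = F x"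
          using eventually_ge_at_top[of N]
        proof eventually_elim
          fix n assume "N \<le> n"
          then have "norm x < real n" using N by simp
          then have "- real n < x \<bullet> i \<and> x \<bullet> i < real n" if "i \<in> Basis" for i
            using Basis_le_norm[OF that, of x] by linarith
          then have "x \<in> box (- real n *\<^sub>R One) (real n *\<^sub>R One)"
            unfolding mem_box by simp
          then show "indicator (box (- real n *\<^sub>R One) (real n *\<^sub>R One)) x * F x = F x" by simp
        qed
      qed
      then show "AE x in lborel. (\<lambda>n. indicator (box (- real n *\<^sub>R One) (real n *\<^sub>R One)) x * F x) \<longlonglongrightarrow> F x"
        by simp
    qed (use F in \<open>auto simp: indicator_def\<close>)
    then show ?thesis by (simp add: zero LIMSEQ_const_iff)
  qed
  have all: "(LINT x|lborel. indicator A x * F x) = 0" if "A \<in> sets borel" for A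
  proof -
    have range: "box a b \<in> range (\<lambda>(a, b). box a b :: 'a set)" for a b
      by (rule image_eqI[of _ _ "(a, b)"]) auto
    have "Int_stable (range (\<lambda>(a, b). box a b :: 'a set))"
      unfolding Int_stable_def using range by (clarsimp simp: box_Int_box)
    moreover have "range (\<lambda>(a, b). box a b :: 'a set) \<subseteq> Pow UNIV" by simp
    moreover have "A \<in> sigma_sets UNIV (range (\<lambda>(a, b). box a b :: 'a set))"
      using that by (simp add: borel_eq_box)
    ultimately show ?thesis
    proof (induction rule: sigma_sets_induct_disjoint)
      case (basic A)
      then show ?case using zero by auto
    next
      case empty
      then show ?case by simp
    next
      case (compl A)
      then have A: "A \<in> sets borel" by (simp add: borel_eq_box)
      have "(LINT x|lborel. indicator (UNIV - A) x * F x) = (LINT x|lborel. F x - indicator A x * F x)"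
        by (intro Bochner_Integration.integral_cong) (auto simp: indicator_def)
      then show ?case using compl int[OF A] F tot by simp
    next
      case (union A)
      then have A: "\<And>i. A i \<in> sets lborel" by (auto simp: borel_eq_box)
      have "set_integrable lborel (\<Union>i. A i) F"
        using int[of "\<Union>i. A i"] A by (simp add: set_integrable_def)
      from lebesgue_integral_countable_add[OF A _ this] union(1)
      have "(LINT x|lborel. indicator (\<Union>i. A i) x * F x) = (\<Sum>i. (LINT x:A i|lborel. F x))"
        unfolding set_lebesgue_integral_def disjoint_family_on_def by simp
      also have "\<dots> = 0" using union by (simp add: set_lebesgue_integral_def)
      finally show ?case .
    qed
  qed
  have "AE x in lborel. indicator {x. 0 < F x} x * F x = 0"
    using integral_nonneg_eq_0_iff_AE[OF int[of "{x. 0 < F x}"]] all[of "{x. 0 < F x}"]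
    by (auto simp: indicator_def)
  moreover have "AE x in lborel. - (indicator {x. F x < 0} x * F x) = 0"
    using integral_nonneg_eq_0_iff_AE[OF integrable_minus[OF int[of "{x. F x < 0}"]]] all[of "{x. F x < 0}"]
    by (auto simp: indicator_def)
  ultimately show ?thesis
    by eventually_elim (auto simp: indicator_def split: if_splits)
qed

section \<open>The linear ordinary differential equation in weak form\<close>

lemma measurable_id_lebesgue_on: "(\<lambda>x. x) \<in> borel_measurable (lebesgue_on S)"
  using id_borel_measurable_lebesgue_on[of S] by (simp add: id_def)

lemma borel_imp_measurable_lebesgue_on:
  "f \<in> borel_measurable borel \<Longrightarrow> f \<in> borel_measurable (lebesgue_on S)"
  using measurable_compose[OF measurable_id_lebesgue_on] by blast

lemma integral_lebesgue_on_lborel: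
  fixes f :: "'a::euclidean_space \<Rightarrow> real"
  assumes [measurable]: "f \<in> borel_measurable borel" "S \<in> sets borel"
  shows "(LINT x|lebesgue_on S. f x) = (LINT x|lborel. indicator S x * f x)"
proof -
  have "(LINT x|lebesgue_on S. f x) = (LINT x|lebesgue. indicator S x * f x)"
    by (subst integral_restrict_space) auto
  also have "\<dots> = (LINT x|lborel. indicator S x * f x)"
    by (rule integral_completion) simp
  finally show ?thesis .
qed

lemma AE_lebesgue_on_iff:
  "S \<in> sets borel \<Longrightarrow> (AE x in lebesgue_on S. P x) \<longleftrightarrow> (AE x in lborel. x \<in> S \<longrightarrow> P x)"
  by (subst AE_restrict_space_iff) (auto simp: AE_completion_iff)

text \<open>Borel versions can be composed with translations and remain measurable for product
  measures, neither of which holds for Lebesgue measurable functions in general.\<close>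

lemma lebesgue_on_borel_version:
  fixes f :: "'a::euclidean_space \<Rightarrow> 'b::euclidean_space"
  assumes f: "f \<in> borel_measurable (lebesgue_on S)" and S: "S \<in> sets borel"
  obtains g where "g \<in> borel_measurable borel" "AE x in lebesgue_on S. f x = g x"
proof -
  let ?f = "\<lambda>x. if x \<in> S then f x else 0"
  have "?f \<in> borel_measurable lebesgue"
    using borel_measurable_if_I[OF f] S by simp
  then have "\<exists>g\<in>borel_measurable lborel. AE x in lborel. ?f x \<bullet> b = g x" for b
    by (intro completion_ex_borel_measurable_real) simp
  then obtain g where g: "\<And>b. g b \<in> borel_measurable lborel" "\<And>b. AE x in lborel. ?f x \<bullet> b = g b x"
    by metis
  show ?thesis
  proof (rule that)
    show "(\<lambda>x. \<Sum>b\<in>Basis. g b x *\<^sub>R b) \<in> borel_measurable borel"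
      using g(1) by simp
    have "AE x in lborel. \<forall>b\<in>Basis. ?f x \<bullet> b = g b x"
      unfolding AE_ball_countable[OF countable_finite[OF finite_Basis]] using g(2) by blast
    then show "AE x in lebesgue_on S. f x = (\<Sum>b\<in>Basis. g b x *\<^sub>R b)"
      unfolding AE_lebesgue_on_iff[OF S]
    proof eventually_elim
      fix x assume *: "\<forall>b\<in>Basis. ?f x \<bullet> b = g b x"
      show "x \<in> S \<longrightarrow> f x = (\<Sum>b\<in>Basis. g b x *\<^sub>R b)"
      proof
        assume "x \<in> S"
        then have "(\<Sum>b\<in>Basis. g b x *\<^sub>R b) = (\<Sum>b\<in>Basis. (f x \<bullet> b) *\<^sub>R b)"
          using * by (intro sum.cong) auto
        then show "f x = (\<Sum>b\<in>Basis. g b x *\<^sub>R b)" by (simp add: euclidean_representation)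
      qed
    qed
  qed
qed

text \<open>Only boxes inside the open box are tested, since these are the ones that compactly
  supported test functions can approximate; the boundary is a null set.\<close>

lemma AE_zero_if_integral_boxes_zero_on:
  fixes f :: "'a::euclidean_space \<Rightarrow> real"
  assumes f: "integrable (lebesgue_on (cbox u v)) f"
    and zero: "\<And>a b. box a b \<subseteq> box u v \<Longrightarrow> (LINT x|lebesgue_on (cbox u v). indicator (box a b) x * f x) = 0"
  shows "AE x in lebesgue_on (cbox u v). f x = 0"
proof -
  let ?S = "cbox u v"
  note [measurable] = measurable_id_lebesgue_on[of ?S]
  obtain g where g [measurable]: "g \<in> borel_measurable borel" and ae: "AE x in lebesgue_on ?S. f x = g x"
    using lebesgue_on_borel_version[of f ?S] f by (metis borel_measurable_integrable borel_closed closed_cbox)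
  have int: "integrable lborel (\<lambda>x. indicator ?S x * g x)"
  proof -
    have "integrable (lebesgue_on ?S) g"
      by (rule integrable_cong_AE_imp[OF f borel_imp_measurable_lebesgue_on[OF g]]) (use ae in auto)
    then have "integrable lebesgue (\<lambda>x. indicator ?S x * g x)"
      by (subst (asm) integrable_restrict_space) auto
    then show ?thesis by (subst (asm) integrable_completion) auto
  qed
  have null: "AE x in lborel. x \<in> ?S \<longrightarrow> x \<in> box u v"
  proof -
    have "negligible (?S - box u v)" by (rule negligible_frontier_interval)
    then have "?S - box u v \<in> null_sets lebesgue" by (simp add: negligible_iff_null_sets)
    then have "AE x in lebesgue. x \<notin> ?S - box u v" by (rule AE_not_in)
    then show ?thesis by (simp add: AE_completion_iff)
  qed
  have "AE x in lborel. indicator ?S x * g x = 0"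
  proof (rule AE_zero_if_integral_boxes_zero[OF int])
    fix a b :: 'a
    obtain c d where cd: "box a b \<inter> box u v = box c d" by (rule that[OF box_Int_box])
    have "(LINT x|lborel. indicator (box a b) x * (indicator ?S x * g x))
        = (LINT x|lborel. indicator ?S x * (indicator (box c d) x * g x))"
      by (rule integral_cong_AE, simp, simp, use null in eventually_elim)
        (use box_subset_cbox[of u v] in \<open>auto simp: indicator_def cd[symmetric]\<close>)
    also have "\<dots> = (LINT x|lebesgue_on ?S. indicator (box c d) x * g x)"
      by (rule integral_lebesgue_on_lborel[symmetric]) auto
    also have "\<dots> = (LINT x|lebesgue_on ?S. indicator (box c d) x * f x)"
      by (rule integral_cong_AE)
        (use ae f in \<open>auto simp: borel_imp_measurable_lebesgue_on borel_measurable_integrable\<close>)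
    also have "\<dots> = 0" by (rule zero) (use cd in blast)
    finally show "(LINT x|lborel. indicator (box a b) x * (indicator ?S x * g x)) = 0" .
  qed
  then have "AE x in lebesgue_on ?S. g x = 0"
    unfolding AE_lebesgue_on_iff[OF borel_closed[OF closed_cbox]]
    by eventually_elim (auto simp: indicator_def)
  with ae show ?thesis by eventually_elim simp
qed

text \<open>Smooth bumps converge boundedly to the indicators of open subintervals, and these
  determine f.\<close>

lemma du_Bois_Reymond:
  fixes f :: "real \<Rightarrow> real"
  assumes f: "integrable (lebesgue_on {0..T}) f"
    and zero: "\<And>\<psi>. smooth \<psi> \<Longrightarrow> \<exists>a>0. \<exists>c<T. \<forall>t. t \<le> a \<or> c \<le> t \<longrightarrow> \<psi> t = 0 \<Longrightarrow>
      (LINT t|lebesgue_on {0..T}. f t * \<psi> t) = 0"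
  shows "AE t in lebesgue_on {0..T}. f t = 0"
proof -
  note [measurable] = measurable_id_lebesgue_on[of "{0..T}"]
  have [measurable]: "f \<in> borel_measurable (lebesgue_on {0..T})" using f by simp
  have "(LINT t|lebesgue_on {0..T}. indicator {a<..<b} t * f t) = 0" if ab: "{a<..<b} \<subseteq> {0<..<T}" for a b
  proof (cases "a < b")
    case True
    with ab have a: "0 \<le> a" and b: "b \<le> T" by (auto simp: greaterThanLessThan_subseteq_greaterThanLessThan)
    \<comment> \<open>Each factor vanishes within distance 1/n of one endpoint, so the support lies
      inside (0,T) even if a = 0 or b = T.\<close>
    define \<psi> where "\<psi> n t = cutoff (real n * (t - a) - 1) * cutoff (real n * (b - t) - 1)" for n t
    have sm: "smooth (\<psi> n)" for n
    proof -
      have "smooth (\<lambda>t. cutoff (real n * t + (- real n * a - 1)) * cutoff (- real n * t + (real n * b - 1)))"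
        by (intro smooth_mult smooth_real_affine smooth_cutoff)
      then show ?thesis by (simp add: \<psi>_def[abs_def] algebra_simps)
    qed
    have supp: "\<exists>a>0. \<exists>c<T. \<forall>t. t \<le> a \<or> c \<le> t \<longrightarrow> \<psi> n t = 0" if n: "0 < n" for n
    proof (intro exI conjI allI impI)
      show "0 < a + 1 / real n" using a n by (simp add: add_nonneg_pos)
      show "b - 1 / real n < T" using b n by (smt (verit) divide_pos_pos of_nat_0_less_iff)
      fix t assume "t \<le> a + 1 / real n \<or> b - 1 / real n \<le> t"
      then have "real n * (t - a) - 1 \<le> 0 \<or> real n * (b - t) - 1 \<le> 0"
        using n by (auto simp: field_simps)
      then show "\<psi> n t = 0" by (auto simp: \<psi>_def cutoff_eq)
    qed
    have lim: "(\<lambda>n. \<psi> n t) \<longlonglongrightarrow> indicator {a<..<b} t" for t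
    proof (cases "t \<in> {a<..<b}")
      case True
      then have "(\<lambda>n. \<psi> n t) \<longlonglongrightarrow> 1 * 1"
        unfolding \<psi>_def by (intro tendsto_mult cutoff_tendsto) auto
      with True show ?thesis by simp
    next
      case False
      then have "real n * (t - a) - 1 \<le> 0 \<or> real n * (b - t) - 1 \<le> 0" for n
        by (smt (verit) greaterThanLessThan_iff mult_nonneg_nonpos of_nat_0_le_iff)
      then have "\<psi> n t = 0" for n
        by (metis \<psi>_def cutoff_eq mult_eq_0_iff not_less)
      with False show ?thesis by simp
    qed
    have [measurable]: "\<psi> n \<in> borel_measurable borel" for n
      using smooth_continuous[OF sm] by (rule borel_measurable_continuous_onI)
    have "(\<lambda>n. LINT t|lebesgue_on {0..T}. f t * \<psi> n t) \<longlonglongrightarrow> (LINT t|lebesgue_on {0..T}. f t * indicator {a<..<b} t)"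
    proof (rule integral_dominated_convergence[where w = "\<lambda>t. \<bar>f t\<bar>"])
      show "AE t in lebesgue_on {0..T}. (\<lambda>n. f t * \<psi> n t) \<longlonglongrightarrow> f t * indicator {a<..<b} t"
        by (intro AE_I2 tendsto_intros lim)
      have "\<bar>\<psi> n t\<bar> \<le> 1" for n t
        unfolding \<psi>_def abs_mult using cutoff_bounds
        by (intro mult_le_one) auto
      then show "AE t in lebesgue_on {0..T}. norm (f t * \<psi> n t) \<le> \<bar>f t\<bar>" for n
        by (auto simp: abs_mult mult_left_le)
    qed (use f in \<open>auto simp: borel_imp_measurable_lebesgue_on\<close>)
    moreover have "\<forall>\<^sub>F n in sequentially. (LINT t|lebesgue_on {0..T}. f t * \<psi> n t) = 0"
      using eventually_gt_at_top[of 0] by eventually_elim (intro zero sm supp)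
    ultimately have "(LINT t|lebesgue_on {0..T}. f t * indicator {a<..<b} t) = 0"
      by (rule LIMSEQ_unique[OF _ tendsto_eventually])
    then show ?thesis by (simp add: mult.commute)
  qed simp
  then show ?thesis
    using AE_zero_if_integral_boxes_zero_on[of 0 T f, unfolded box_real, OF f] by blast
qed

lemma finite_measure_time: "finite_measure (lebesgue_on {0..T::real})"
  using finite_measure_lebesgue_on[OF lmeasurable_cbox[of 0 T]] by simp

lemma integrable_indicator_mult_lebesgue_on:
  fixes g :: "'a::euclidean_space \<Rightarrow> real"
  assumes g: "integrable (lebesgue_on S) g" and A: "A \<in> sets borel"
  shows "integrable (lebesgue_on S) (\<lambda>s. indicator A s * g s)"
proof (rule Bochner_Integration.integrable_bound[OF g])
  have "(indicator A :: _ \<Rightarrow> real) \<in> borel_measurable (lebesgue_on S)"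
    by (rule borel_imp_measurable_lebesgue_on) (use A in simp)
  then show "(\<lambda>s. indicator A s * g s) \<in> borel_measurable (lebesgue_on S)"
    using g by simp
qed (auto simp: indicator_def)

text \<open>The integrated form of (P^2)' = 2 P g for merely integrable g. The square of P is a
  double integral over a square; the triangles on either side of the diagonal contribute equally,
  and the inner integral over one of them is again P.\<close>

lemma square_primitive:
  fixes g :: "real \<Rightarrow> real"
  assumes g: "integrable (lebesgue_on {0..T}) g"
  defines "P \<equiv> \<lambda>t. LINT s|lebesgue_on {0..T}. indicator {..t} s * g s"
  shows "(P t)\<^sup>2 = 2 * (LINT s|lebesgue_on {0..T}. indicator {..t} s * (P s * g s))"
proof -
  let ?I = "lebesgue_on {0..T}"
  interpret I: finite_measure ?I by (rule finite_measure_time)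
  interpret II: pair_sigma_finite ?I ?I ..
  note [measurable] = measurable_id_lebesgue_on[of "{0..T}"]
  have [measurable]: "g \<in> borel_measurable ?I" using g by simp
  define k where "k s = indicator {..t} s * g s" for s
  have k: "integrable ?I k"
    unfolding k_def by (rule integrable_indicator_mult_lebesgue_on[OF g]) simp
  have [measurable]: "k \<in> borel_measurable ?I" using k by simp
  have kk: "integrable (?I \<Otimes>\<^sub>M ?I) (\<lambda>(s, r). k s * k r)"
    by (rule II.Fubini_integrable) (use k in \<open>auto simp: abs_mult split_beta\<close>)
  have kk1: "integrable (?I \<Otimes>\<^sub>M ?I) (\<lambda>(s, r). (if r \<le> s then 1 else 0) * (k s * k r))"
    and kk2: "integrable (?I \<Otimes>\<^sub>M ?I) (\<lambda>(s, r). (if s < r then 1 else 0) * (k s * k r))"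
    by (rule Bochner_Integration.integrable_bound[OF kk]; auto simp: split_beta)+
  have A: "(LINT s|?I. LINT r|?I. (if r \<le> s then 1 else 0) * (k s * k r)) = (LINT s|?I. indicator {..t} s * (P s * g s))"
  proof (rule Bochner_Integration.integral_cong[OF refl])
    fix s
    have "(LINT r|?I. (if r \<le> s then 1 else 0) * (k s * k r)) = (LINT r|?I. k s * (indicator {..s} r * g r))"
      by (rule Bochner_Integration.integral_cong[OF refl]) (auto simp: k_def indicator_def)
    then show "(LINT r|?I. (if r \<le> s then 1 else 0) * (k s * k r)) = indicator {..t} s * (P s * g s)"
      by (simp add: k_def P_def)
  qed
  have "(P t)\<^sup>2 = (LINT s|?I. LINT r|?I. k s * k r)"
    by (simp add: P_def k_def[symmetric] power2_eq_square)
  also have "\<dots> = integral\<^sup>L (?I \<Otimes>\<^sub>M ?I) (\<lambda>(s, r). k s * k r)"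
    using II.integral_fst'[OF kk] by simp
  also have "\<dots> = integral\<^sup>L (?I \<Otimes>\<^sub>M ?I) (\<lambda>(s, r). (if r \<le> s then 1 else 0) * (k s * k r))
      + integral\<^sup>L (?I \<Otimes>\<^sub>M ?I) (\<lambda>(s, r). (if s < r then 1 else 0) * (k s * k r))"
    by (subst Bochner_Integration.integral_add[symmetric, OF kk1 kk2])
      (intro Bochner_Integration.integral_cong, auto)
  also have "integral\<^sup>L (?I \<Otimes>\<^sub>M ?I) (\<lambda>(s, r). (if r \<le> s then 1 else 0) * (k s * k r))
      = (LINT s|?I. indicator {..t} s * (P s * g s))"
    using II.integral_fst'[OF kk1] A by simp
  also have "integral\<^sup>L (?I \<Otimes>\<^sub>M ?I) (\<lambda>(s, r). (if s < r then 1 else 0) * (k s * k r))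
      = (LINT r|?I. LINT s|?I. (if s < r then 1 else 0) * (k s * k r))"
    using II.integral_snd[OF kk2] by simp
  \<comment> \<open>The strict triangle may be closed, as the diagonal meets each slice in a null
    set.\<close>
  also have "\<dots> = (LINT r|?I. LINT s|?I. (if s \<le> r then 1 else 0) * (k r * k s))"
  proof (rule Bochner_Integration.integral_cong[OF refl], rule integral_cong_AE)
    fix r :: real
    have "AE s in lborel. s \<noteq> r" by (rule AE_lborel_singleton)
    then have "AE s in ?I. s \<noteq> r" by (auto simp: AE_lebesgue_on_iff elim: eventually_mono)
    then show "AE s in ?I. (if s < r then 1 else 0) * (k s * k r) = (if s \<le> r then 1 else 0) * (k r * k s)"
      by eventually_elim auto
  qed auto
  finally show ?thesis using A by simp
qed

text \<open>Test functions may be nonzero at time 0, which is how the initial value enters. If eta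
  is the antiderivative of psi that vanishes near T, Fubini turns the term with g into minus P
  against psi, and \<open>\<eta> 0\<close> is minus the integral of psi. So a - a0 - P annihilates
  every psi supported inside (0,T).\<close>

lemma weak_ODE:
  fixes a g :: "real \<Rightarrow> real"
  assumes T: "0 < T" and a: "integrable (lebesgue_on {0..T}) a" and g: "integrable (lebesgue_on {0..T}) g"
    and eq: "\<And>\<eta>. smooth \<eta> \<Longrightarrow> \<exists>c<T. \<forall>t\<ge>c. \<eta> t = 0 \<Longrightarrow>
      (LINT t|lebesgue_on {0..T}. a t * deriv \<eta> t + g t * \<eta> t) + a0 * \<eta> 0 = 0"
  shows "AE t in lebesgue_on {0..T}. a t = a0 + (LINT s|lebesgue_on {0..T}. indicator {..t} s * g s)"
proof -
  let ?I = "lebesgue_on {0..T}"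
  interpret I: finite_measure ?I by (rule finite_measure_time)
  interpret II: pair_sigma_finite ?I ?I ..
  note [measurable] = measurable_id_lebesgue_on[of "{0..T}"]
  have [measurable]: "a \<in> borel_measurable ?I" "g \<in> borel_measurable ?I" using a g by auto
  define P where "P t = (LINT s|?I. indicator {..t} s * g s)" for t
  have meas: "(\<lambda>x. indicator {..fst x} (snd x) :: real) \<in> borel_measurable (?I \<Otimes>\<^sub>M ?I)"
  proof -
    have "(\<lambda>x. if snd x \<le> fst x then 1 else 0 :: real) \<in> borel_measurable (?I \<Otimes>\<^sub>M ?I)" by measurable
    moreover have "(\<lambda>x::real \<times> real. indicator {..fst x} (snd x) :: real) = (\<lambda>x. if snd x \<le> fst x then 1 else 0)"
      by (auto simp: indicator_def)
    ultimately show ?thesis by (simp only:)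
  qed
  note [measurable] = meas
  have [measurable]: "P \<in> borel_measurable ?I" unfolding P_def by measurable
  have Pbound: "\<bar>P t\<bar> \<le> (LINT s|?I. \<bar>g s\<bar>)" for t
  proof -
    have "norm (P t) \<le> (LINT s|?I. norm (indicator {..t} s * g s))"
      unfolding P_def by (rule integral_norm_bound)
    also have "\<dots> \<le> (LINT s|?I. \<bar>g s\<bar>)"
      by (rule integral_mono) (use g integrable_norm[OF integrable_indicator_mult_lebesgue_on[OF g, of "{..t}"]] in \<open>auto simp: indicator_def abs_mult\<close>)
    finally show ?thesis by simp
  qed
  have P: "integrable ?I P"
    by (rule I.integrable_const_bound[where B = "LINT s|?I. \<bar>g s\<bar>"]) (use Pbound in auto)
  have "AE t in ?I. a t - (a0 + P t) = 0"
  proof (rule du_Bois_Reymond)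
    show "integrable ?I (\<lambda>t. a t - (a0 + P t))" using a P by simp
    fix \<psi> :: "real \<Rightarrow> real" assume sm: "smooth \<psi>" and "\<exists>b>0. \<exists>c<T. \<forall>t. t \<le> b \<or> c \<le> t \<longrightarrow> \<psi> t = 0"
    then obtain c where c: "c < T" "\<And>t. c \<le> t \<Longrightarrow> \<psi> t = 0" by blast
    obtain \<Psi> where \<Psi>: "smooth \<Psi>" "\<And>t. (\<Psi> has_real_derivative \<psi> t) (at t)"
      using smooth_antiderivative_exists[OF sm] by blast
    \<comment> \<open>Normalised to vanish at T. As psi is zero from c on, eta vanishes on all of
      [c, infinity) and is admissible.\<close>
    define \<eta> where "\<eta> t = \<Psi> t + (- \<Psi> T)" for t
    have sm\<eta>: "smooth \<eta>" unfolding \<eta>_def[abs_def] by (intro smooth_add \<Psi> smooth_const)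
    have d\<eta>: "(\<eta> has_real_derivative \<psi> t) (at t)" for t
      unfolding \<eta>_def[abs_def] using \<Psi>(2)[of t] by (auto intro!: derivative_eq_intros)
    have z\<eta>: "\<eta> t = 0" if "c \<le> t" for t
    proof -
      have "(\<eta> has_field_derivative 0) (at x within {c..})" if "x \<in> {c..}" for x
        using d\<eta>[of x] c(2)[of x] that by (simp add: has_field_derivative_at_within)
      then obtain k where k: "\<And>x. x \<in> {c..} \<Longrightarrow> \<eta> x = k"
        using has_field_derivative_zero_constant[of "{c..}" \<eta>] by auto
      have "\<eta> T = 0" by (simp add: \<eta>_def)
      then show ?thesis using k[of T] k[of t] c(1) that by simp
    qed
    have [measurable]: "\<psi> \<in> borel_measurable borel" "\<eta> \<in> borel_measurable borel"
      by (auto intro!: borel_measurable_continuous_onI smooth_continuous sm sm\<eta>)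
    have [measurable]: "\<psi> \<in> borel_measurable ?I" "\<eta> \<in> borel_measurable ?I"
      by (auto intro: borel_imp_measurable_lebesgue_on)
    have bound: "\<exists>B. \<forall>t\<in>{0..T}. \<bar>f t\<bar> \<le> B" if "smooth f" for f :: "real \<Rightarrow> real"
      using compact_imp_bounded[OF compact_continuous_image[OF smooth_continuous[OF that] compact_Icc, of 0 T]]
      by (auto simp: bounded_iff)
    have mult: "integrable ?I (\<lambda>t. f t * w t)" if "integrable ?I f" "smooth w" for f w
    proof -
      obtain B where B: "\<And>t. t \<in> {0..T} \<Longrightarrow> \<bar>w t\<bar> \<le> B" using bound[OF \<open>smooth w\<close>] by blast
      have [measurable]: "w \<in> borel_measurable ?I"
        by (intro borel_imp_measurable_lebesgue_on borel_measurable_continuous_onI smooth_continuous \<open>smooth w\<close>)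
      show ?thesis
      proof (rule Bochner_Integration.integrable_bound)
        show "integrable ?I (\<lambda>t. B * f t)" using that by simp
        show "AE t in ?I. norm (f t * w t) \<le> norm (B * f t)"
          by (rule AE_I2) (use B in \<open>auto simp: abs_mult mult.commute[of "\<bar>f _\<bar>"] intro!: mult_right_mono order_trans[OF B]\<close>)
      qed (use that in auto)
    qed
    have one: "integrable ?I (\<lambda>t. 1::real)" by simp
    have tail: "(LINT t|?I. indicator {s..} t * \<psi> t) = - \<eta> s" if s: "s \<in> {0..T}" for s
    proof -
      have "(LINT t|?I. indicator {s..} t * \<psi> t) = (LINT t|lborel. indicator {0..T} t * (indicator {s..} t * \<psi> t))"
        by (rule integral_lebesgue_on_lborel) auto
      also have "\<dots> = (LINT t|lborel. \<psi> t * indicator {s..T} t)"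
        by (rule Bochner_Integration.integral_cong) (use s in \<open>auto simp: indicator_def\<close>)
      also have "\<dots> = \<eta> T - \<eta> s"
        by (rule integral_FTC_Icc_real)
          (use s d\<eta> smooth_continuous[OF sm, of UNIV] in \<open>auto simp: continuous_on_eq_continuous_at\<close>)
      finally show ?thesis using z\<eta>[of T] c(1) by simp
    qed
    have prod: "integrable (?I \<Otimes>\<^sub>M ?I) (\<lambda>(t, s). (indicator {..t} s * g s) * \<psi> t)"
    proof (rule Bochner_Integration.integrable_bound)
      show "integrable (?I \<Otimes>\<^sub>M ?I) (\<lambda>(t, s). \<psi> t * g s)"
        by (rule II.Fubini_integrable) (use g mult[OF one sm] in \<open>auto simp: abs_mult split_beta\<close>)
    qed (auto simp: split_beta indicator_def abs_mult)
    have "(LINT t|?I. P t * \<psi> t) = (LINT t|?I. LINT s|?I. (indicator {..t} s * g s) * \<psi> t)"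
      by (simp add: P_def)
    also have "\<dots> = (LINT s|?I. LINT t|?I. (indicator {..t} s * g s) * \<psi> t)"
      using II.Fubini_integral[OF prod] by simp
    also have "\<dots> = (LINT s|?I. - (g s * \<eta> s))"
    proof (rule Bochner_Integration.integral_cong[OF refl])
      fix s assume "s \<in> space ?I"
      have "(LINT t|?I. (indicator {..t} s * g s) * \<psi> t) = (LINT t|?I. g s * (indicator {s..} t * \<psi> t))"
        by (rule Bochner_Integration.integral_cong[OF refl]) (auto simp: indicator_def)
      then show "(LINT t|?I. (indicator {..t} s * g s) * \<psi> t) = - (g s * \<eta> s)"
        using tail[of s] \<open>s \<in> space ?I\<close> by simp
    qed
    finally have 1: "(LINT t|?I. P t * \<psi> t) = - (LINT t|?I. g t * \<eta> t)" by simp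
    have 2: "(LINT t|?I. \<psi> t) = - \<eta> 0"
    proof -
      have "(LINT t|?I. \<psi> t) = (LINT t|?I. indicator {0..} t * \<psi> t)"
        by (rule Bochner_Integration.integral_cong[OF refl]) auto
      then show ?thesis using tail[of 0] T by simp
    qed
    have "deriv \<eta> t = \<psi> t" for t using d\<eta> by (rule DERIV_imp_deriv)
    then have 3: "(LINT t|?I. a t * \<psi> t + g t * \<eta> t) + a0 * \<eta> 0 = 0"
      using eq[OF sm\<eta>] z\<eta> c(1) by auto
    have i: "integrable ?I \<psi>" using mult[OF one sm] by simp
    show "(LINT t|?I. (a t - (a0 + P t)) * \<psi> t) = 0"
      using 1 2 3 i mult[OF a sm] mult[OF g sm\<eta>] mult[OF P sm]
      by (simp add: algebra_simps)
  qed
  then show ?thesis unfolding P_def by eventually_elim simp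
qed

section \<open>Integration of periodic functions\<close>

text \<open>Lattice vectors as a countable type, so that sums over lattice translates are integrals
  over \<open>count_space\<close>.\<close>

definition ivec :: "int^'n \<Rightarrow> real^'n" where
  "ivec k = (\<chi> i. real_of_int (k $ i))"

lemma ivec_nth [simp]: "ivec k $ i = real_of_int (k $ i)"
  by (simp add: ivec_def)

lemma ivec_simps: "ivec (k + l) = ivec k + ivec l" "ivec (k - l) = ivec k - ivec l"
  "ivec (- k) = - ivec k" "ivec 0 = 0"
  by (simp_all add: vec_eq_iff)

lemma torus_periodic_ivec: "torus_periodic f \<Longrightarrow> f (x + ivec k) = f x"
  unfolding torus_periodic_def by (metis Ints_of_int ivec_nth)

lemma torus_periodic_ivec_minus: "torus_periodic f \<Longrightarrow> f (x - ivec k) = f x"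
  using torus_periodic_ivec[of f x "- k"] by (simp add: ivec_simps)

lemma torus_periodicI:
  fixes f :: "real^'n \<Rightarrow> 'b"
  assumes "\<And>x k. f (x + ivec k) = f x"
  shows "torus_periodic f"
  unfolding torus_periodic_def
proof (intro allI impI)
  fix x k :: "real^'n" assume "\<forall>i. k $ i \<in> \<int>"
  then have "\<exists>m. k $ i = real_of_int m" for i by (metis Ints_cases)
  then obtain m where "\<And>i. k $ i = real_of_int (m i)" by metis
  then have "k = ivec (\<chi> i. m i)" by (simp add: vec_eq_iff)
  then show "f (x + k) = f x" using assms by simp
qed

text \<open>Shifted and reflected cubes are again fundamental domains, so the invariance of torus
  integrals reduces to their independence of the domain.\<close>

definition fundamental_domain :: "(real^'n) set \<Rightarrow> bool" where
  "fundamental_domain D \<longleftrightarrow> D \<in> sets borel \<and> (\<forall>x. \<exists>!k. x + ivec k \<in> D)"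

lemma fundamental_domainE:
  assumes "fundamental_domain D"
  obtains k0 where "\<And>k. x + ivec k \<in> D \<longleftrightarrow> k = k0"
proof -
  have "\<exists>!k. x + ivec k \<in> D" using assms by (simp add: fundamental_domain_def)
  then obtain k0 where "x + ivec k0 \<in> D" "\<And>k. x + ivec k \<in> D \<Longrightarrow> k = k0" by blast
  then show ?thesis using that[of k0] by blast
qed

text \<open>Half-open, so that every point has exactly one lattice translate in it; the closed cube
  of \<open>torus\<close> differs from it by a null set.\<close>

definition unit_cube :: "(real^'n) set" where
  "unit_cube = {x. \<forall>i. 0 \<le> x $ i \<and> x $ i < 1}"

definition vfrac :: "real^'n \<Rightarrow> real^'n" where
  "vfrac x = (\<chi> i. frac (x $ i))"

lemma vfrac_eq: "vfrac x = x + ivec (\<chi> i. - \<lfloor>x $ i\<rfloor>)"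
  by (simp add: vec_eq_iff vfrac_def frac_def)

lemma vfrac_in_cube: "vfrac x \<in> unit_cube"
  by (simp add: vfrac_def unit_cube_def frac_ge_0 frac_lt_1)

lemma torus_periodic_vfrac: "torus_periodic f \<Longrightarrow> f (vfrac x) = f x"
  by (simp add: vfrac_eq torus_periodic_ivec)

lemma vfrac_ivec [simp]: "vfrac (x + ivec k) = vfrac x"
  by (simp add: vfrac_def vec_eq_iff)

lemma vfrac_id: "x \<in> unit_cube \<Longrightarrow> vfrac x = x"
  by (simp add: vfrac_def unit_cube_def vec_eq_iff frac_eq)

lemma unit_cube_borel [measurable]: "unit_cube \<in> sets borel"
proof -
  have "unit_cube = (\<Inter>i. {x::real^'n. 0 \<le> x $ i} \<inter> {x. x $ i < 1})"
    by (auto simp: unit_cube_def)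
  also have "\<dots> \<in> sets borel"
    by (intro sets.countable_INT' sets.Int) auto
  finally show ?thesis .
qed

lemma vfrac_measurable [measurable]: "vfrac \<in> borel_measurable borel"
proof (subst borel_measurable_euclidean_space, intro ballI)
  fix b :: "real^'n" assume "b \<in> Basis"
  then obtain i where b: "b = axis i 1" by (auto simp: Basis_vec_def)
  have [measurable]: "(\<lambda>x::real^'n. x $ i) \<in> borel_measurable borel"
    by (intro borel_measurable_continuous_onI continuous_intros)
  show "(\<lambda>x. vfrac x \<bullet> b) \<in> borel_measurable borel"
    unfolding b vfrac_def frac_def
    using borel_measurable_diff[OF _ measurable_compose[OF _ borel_measurable_real_floor], of "\<lambda>x::real^'n. x $ i" borel "\<lambda>x. x $ i"]
    by (simp add: inner_axis)
qed

lemma unit_cube_sub: "unit_cube \<subseteq> cbox 0 1"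
  by (auto simp: unit_cube_def mem_box_cart less_imp_le)

lemma AE_unit_cube: "AE x in lborel. x \<in> unit_cube \<longleftrightarrow> x \<in> cbox 0 (1::real^'n)"
proof -
  have "negligible (cbox 0 1 - box 0 (1::real^'n))" by (rule negligible_frontier_interval)
  then have "cbox 0 1 - box 0 (1::real^'n) \<in> null_sets lebesgue" by (simp add: negligible_iff_null_sets)
  then have "AE x in lebesgue. x \<notin> cbox 0 1 - box 0 (1::real^'n)" by (rule AE_not_in)
  then have "AE x in lborel. x \<notin> cbox 0 1 - box 0 (1::real^'n)" by (simp add: AE_completion_iff)
  then show ?thesis
  proof eventually_elim
    fix x :: "real^'n" assume "x \<notin> cbox 0 1 - box 0 1"
    moreover have "box 0 1 \<subseteq> (unit_cube :: (real^'n) set)"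
      by (auto simp: unit_cube_def mem_box_cart less_imp_le)
    ultimately show "x \<in> unit_cube \<longleftrightarrow> x \<in> cbox 0 1"
      using unit_cube_sub by blast
  qed
qed

lemma nn_integral_torus:
  assumes [measurable]: "f \<in> borel_measurable borel"
  shows "(\<integral>\<^sup>+x. f x \<partial>torus) = (\<integral>\<^sup>+x. indicator unit_cube x * f x \<partial>lborel)"
proof -
  have "(\<integral>\<^sup>+x. f x \<partial>torus) = (\<integral>\<^sup>+x. f x * indicator (cbox 0 1) x \<partial>lebesgue)"
    by (subst nn_integral_restrict_space) auto
  also have "\<dots> = (\<integral>\<^sup>+x. f x * indicator (cbox 0 1) x \<partial>lborel)"
    by (rule nn_integral_completion)
  also have "\<dots> = (\<integral>\<^sup>+x. indicator unit_cube x * f x \<partial>lborel)"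
    by (rule nn_integral_cong_AE, use AE_unit_cube in eventually_elim) (auto simp: indicator_def)
  finally show ?thesis .
qed

lemma fundamental_domain_unit_cube: "fundamental_domain unit_cube"
  unfolding fundamental_domain_def
proof (intro conjI allI)
  fix x :: "real^'n"
  show "\<exists>!k. x + ivec k \<in> unit_cube"
  proof
    show "x + ivec (\<chi> i. - \<lfloor>x $ i\<rfloor>) \<in> unit_cube"
      using vfrac_in_cube[of x] by (simp add: vfrac_eq)
    fix k assume k: "x + ivec k \<in> unit_cube"
    have "k $ i = - \<lfloor>x $ i\<rfloor>" for i
    proof -
      have "0 \<le> x $ i + k $ i \<and> x $ i + k $ i < 1" using k by (simp add: unit_cube_def)
      then have "\<lfloor>x $ i\<rfloor> = - k $ i" by (intro floor_unique) auto
      then show ?thesis by simp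
    qed
    then show "k = (\<chi> i. - \<lfloor>x $ i\<rfloor>)" by (simp add: vec_eq_iff)
  qed
qed simp

lemma nn_integral_lborel_affine:
  fixes f :: "real^'n \<Rightarrow> ennreal"
  assumes [measurable]: "f \<in> borel_measurable borel" and s: "s = 1 \<or> s = - 1"
  shows "(\<integral>\<^sup>+x. f (v + s *\<^sub>R x) \<partial>lborel) = (\<integral>\<^sup>+x. f x \<partial>lborel)"
proof -
  have "lborel = density (distr lborel borel (\<lambda>x::real^'n. v + s *\<^sub>R x)) (\<lambda>_. ennreal (\<bar>s\<bar> ^ DIM(real^'n)))"
    by (rule lborel_affine) (use s in auto)
  also have "\<dots> = distr lborel borel (\<lambda>x. v + s *\<^sub>R x)"
    using s by (auto simp: density_1)
  finally have *: "distr lborel borel (\<lambda>x::real^'n. v + s *\<^sub>R x) = lborel" by simp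
  have "(\<integral>\<^sup>+x. f x \<partial>distr lborel borel (\<lambda>x::real^'n. v + s *\<^sub>R x)) = (\<integral>\<^sup>+x. f (v + s *\<^sub>R x) \<partial>lborel)"
    by (rule nn_integral_distr) auto
  then show ?thesis using * by simp
qed

text \<open>Insert 1 as the sum over k of the indicator of E at x + k, exchange sum and integral,
  and translate each term by k. What remains is an integral over E in which the indicators of D sum
  to 1.\<close>

lemma nn_integral_fundamental_domain:
  fixes f :: "real^'n \<Rightarrow> ennreal"
  assumes D: "fundamental_domain D" and E: "fundamental_domain E"
    and f [measurable]: "f \<in> borel_measurable borel" and per: "torus_periodic f"
  shows "(\<integral>\<^sup>+x. indicator D x * f x \<partial>lborel) = (\<integral>\<^sup>+x. indicator E x * f x \<partial>lborel)"
proof -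
  have [measurable]: "D \<in> sets borel" "E \<in> sets borel" using D E by (auto simp: fundamental_domain_def)
  have one: "(\<integral>\<^sup>+k. indicator A (x + ivec k) \<partial>count_space UNIV) = 1" if "fundamental_domain A" for A and x :: "real^'n"
  proof -
    obtain k0 where k0: "\<And>k. x + ivec k \<in> A \<longleftrightarrow> k = k0"
      using fundamental_domainE[OF \<open>fundamental_domain A\<close>] by blast
    have "(\<integral>\<^sup>+k. indicator A (x + ivec k) \<partial>count_space UNIV) = (\<integral>\<^sup>+k. indicator {k0} k \<partial>count_space UNIV)"
      by (rule nn_integral_cong) (simp add: indicator_def k0)
    then show ?thesis by simp
  qed
  have one': "(\<integral>\<^sup>+k. indicator A (x - ivec k) \<partial>count_space UNIV) = 1" if "fundamental_domain A" for A and x :: "real^'n"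
  proof -
    have bij: "bij_betw uminus UNIV (UNIV :: (int^'n) set)"
      by (rule bij_betwI[of _ _ _ uminus]) auto
    show ?thesis
      using nn_integral_bij_count_space[OF bij, of "\<lambda>k. indicator A (x + ivec k)"] one[OF that]
      by (simp add: ivec_simps)
  qed
  have "(\<integral>\<^sup>+x. indicator D x * f x \<partial>lborel)
      = (\<integral>\<^sup>+x. \<integral>\<^sup>+k. indicator D x * f x * indicator E (x + ivec k) \<partial>count_space UNIV \<partial>lborel)"
    by (simp add: nn_integral_cmult one[OF E])
  also have "\<dots> = (\<integral>\<^sup>+k. \<integral>\<^sup>+x. indicator D x * f x * indicator E (x + ivec k) \<partial>lborel \<partial>count_space UNIV)"
    by (rule nn_integral_count_space_nn_integral) auto
  also have "\<dots> = (\<integral>\<^sup>+k. \<integral>\<^sup>+x. indicator E x * f x * indicator D (x - ivec k) \<partial>lborel \<partial>count_space UNIV)"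
  proof (rule nn_integral_cong)
    fix k :: "int^'n"
    have "(\<integral>\<^sup>+x. indicator D x * f x * indicator E (x + ivec k) \<partial>lborel)
        = (\<integral>\<^sup>+x. indicator D (- ivec k + 1 *\<^sub>R x) * f (- ivec k + 1 *\<^sub>R x) * indicator E (- ivec k + 1 *\<^sub>R x + ivec k) \<partial>lborel)"
      by (rule nn_integral_lborel_affine[symmetric]) auto
    also have "\<dots> = (\<integral>\<^sup>+x. indicator E x * f x * indicator D (x - ivec k) \<partial>lborel)"
      using torus_periodic_ivec_minus[OF per] by (simp add: mult_ac)
    finally show "(\<integral>\<^sup>+x. indicator D x * f x * indicator E (x + ivec k) \<partial>lborel)
        = (\<integral>\<^sup>+x. indicator E x * f x * indicator D (x - ivec k) \<partial>lborel)" .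
  qed
  also have "\<dots> = (\<integral>\<^sup>+x. \<integral>\<^sup>+k. indicator E x * f x * indicator D (x - ivec k) \<partial>count_space UNIV \<partial>lborel)"
    by (rule nn_integral_count_space_nn_integral[symmetric]) auto
  also have "\<dots> = (\<integral>\<^sup>+x. indicator E x * f x \<partial>lborel)"
    by (simp add: nn_integral_cmult one'[OF D])
  finally show ?thesis .
qed

text \<open>The sign s = 1 gives translations and s = -1 reflections; together they provide the
  change of variables z = x - y in convolutions.\<close>

lemma nn_integral_torus_affine:
  fixes f :: "real^'n \<Rightarrow> ennreal"
  assumes f [measurable]: "f \<in> borel_measurable borel" and per: "torus_periodic f"
    and s: "s = 1 \<or> s = - 1"
  shows "(\<integral>\<^sup>+x. f (v + s *\<^sub>R x) \<partial>torus) = (\<integral>\<^sup>+x. f x \<partial>torus)"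
proof -
  \<comment> \<open>The image of the cube under x -> v + s x, because s is its own inverse.\<close>
  let ?D = "{x. s *\<^sub>R (x - v) \<in> unit_cube}"
  have ss: "s * s = 1" using s by auto
  have D: "fundamental_domain ?D"
    unfolding fundamental_domain_def
  proof (intro conjI allI)
    show "?D \<in> sets borel" by measurable
    fix x :: "real^'n"
    obtain k where k: "\<And>l. s *\<^sub>R (x - v) + ivec l \<in> unit_cube \<longleftrightarrow> l = k"
      using fundamental_domainE[OF fundamental_domain_unit_cube] by blast
    have "s *\<^sub>R (x + ivec l - v) = s *\<^sub>R (x - v) + ivec (if s = 1 then l else - l)" for l
      using s by (auto simp: ivec_simps algebra_simps)
    then have "x + ivec l \<in> ?D \<longleftrightarrow> (if s = 1 then l else - l) = k" for l
      using k by simp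
    then show "\<exists>!k. x + ivec k \<in> ?D"
      by (intro ex1I[of _ "if s = 1 then k else - k"]) (auto split: if_splits)
  qed
  have "(\<integral>\<^sup>+x. f (v + s *\<^sub>R x) \<partial>torus) = (\<integral>\<^sup>+x. indicator unit_cube x * f (v + s *\<^sub>R x) \<partial>lborel)"
    by (rule nn_integral_torus) simp
  also have "\<dots> = (\<integral>\<^sup>+x. (\<lambda>y. indicator ?D y * f y) (v + s *\<^sub>R x) \<partial>lborel)"
    by (rule nn_integral_cong) (simp add: indicator_def ss)
  also have "\<dots> = (\<integral>\<^sup>+y. indicator ?D y * f y \<partial>lborel)"
    by (rule nn_integral_lborel_affine[OF _ s]) measurable
  also have "\<dots> = (\<integral>\<^sup>+x. f x \<partial>torus)"
    using nn_integral_fundamental_domain[OF D fundamental_domain_unit_cube f per]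
    by (simp add: nn_integral_torus)
  finally show ?thesis .
qed

lemma finite_measure_torus: "finite_measure (torus :: (real^'n) measure)"
  by (rule finite_measure_lebesgue_on) simp

lemma measure_torus [simp]: "measure (torus :: (real^'n) measure) (cbox 0 1) = 1"
proof -
  have "measure (torus :: (real^'n) measure) (cbox 0 1) = measure lborel (cbox 0 (1::real^'n))"
    by (simp add: measure_restrict_space)
  also have "\<dots> = 1"
  proof -
    have "(0::real^'n) \<in> cbox 0 1" by (simp add: mem_box_cart)
    then have "cbox 0 (1::real^'n) \<noteq> {}" by blast
    from content_cbox_cart[OF this] show ?thesis by simp
  qed
  finally show ?thesis .
qed

lemma emeasure_torus [simp]: "emeasure (torus :: (real^'n) measure) (cbox 0 1) = 1"
proof -
  interpret finite_measure "torus :: (real^'n) measure" by (rule finite_measure_torus)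
  show ?thesis using emeasure_eq_measure[of "cbox 0 1"] by simp
qed

lemma integral_torus_translate:
  fixes f :: "real^'n \<Rightarrow> real"
  assumes f [measurable]: "f \<in> borel_measurable borel" and per: "torus_periodic f"
    and bd: "\<And>x. \<bar>f x\<bar> \<le> B"
  shows "(LINT x|torus. f (v + x)) = (LINT x|torus. f x)"
proof -
  interpret finite_measure "torus :: (real^'n) measure" by (rule finite_measure_torus)
  have int: "integrable torus (\<lambda>x. f (v + x))" for v
  proof (rule integrable_const_bound[where B = B])
    show "(\<lambda>x. f (v + x)) \<in> borel_measurable torus" by (rule borel_imp_measurable_lebesgue_on) simp
  qed (use bd in simp)
  have "(LINT x|torus. f (v + x)) = enn2real (\<integral>\<^sup>+x. ennreal (f x) \<partial>torus) - enn2real (\<integral>\<^sup>+x. ennreal (- f x) \<partial>torus)" for v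
  proof -
    have "(\<integral>\<^sup>+x. ennreal (g (v + x)) \<partial>torus) = (\<integral>\<^sup>+x. ennreal (g x) \<partial>torus)"
      if [measurable]: "g \<in> borel_measurable borel" and "torus_periodic g" for g
      using nn_integral_torus_affine[of "\<lambda>x. ennreal (g x)" 1 v] that
      by (simp add: torus_periodic_def)
    from this[of f] this[of "\<lambda>x. - f x"] show ?thesis
      using per by (simp add: real_lebesgue_integral_def[OF int] torus_periodic_def)
  qed
  from this[of v] this[of 0] show ?thesis by simp
qed

lemma torus_periodic_bounded:
  fixes f :: "real^'n \<Rightarrow> real"
  assumes "torus_periodic f" "continuous_on UNIV f"
  obtains B where "\<And>x. \<bar>f x\<bar> \<le> B"
proof -
  have "bounded (f ` cbox 0 1)"
    by (intro compact_imp_bounded compact_continuous_image continuous_on_subset[OF assms(2)]) auto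
  then obtain B where B: "\<And>x. x \<in> cbox 0 1 \<Longrightarrow> \<bar>f x\<bar> \<le> B"
    by (auto simp: bounded_iff)
  show ?thesis
  proof (rule that)
    fix x :: "real^'n"
    have "vfrac x \<in> cbox 0 1" using vfrac_in_cube unit_cube_sub by blast
    from B[OF this] show "\<bar>f x\<bar> \<le> B" by (simp add: torus_periodic_vfrac[OF assms(1)])
  qed
qed

section \<open>Partial derivatives of periodic functions and their integrals\<close>

lemma partial_eqI: "(f has_derivative D) (at x) \<Longrightarrow> partial i f x = D (axis i 1)"
  unfolding partial_def using frechet_derivative_at by metis

lemma smooth_partial: "smooth f \<Longrightarrow> smooth (partial i f)"
  unfolding partial_def[abs_def] by (rule smooth_frechet_derivative)

lemma torus_periodic_partial:
  assumes per: "torus_periodic f" and sm: "smooth f"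
  shows "torus_periodic (partial i f)"
proof (rule torus_periodicI)
  fix x k
  have "((\<lambda>y. f (y + ivec k)) has_derivative frechet_derivative f (at (x + ivec k))) (at x)"
  proof -
    have "((\<lambda>y. y + ivec k) has_derivative (\<lambda>v. v)) (at x)" by (auto intro!: derivative_eq_intros)
    from has_derivative_compose[OF this smooth_has_derivative[OF sm]] show ?thesis .
  qed
  then show "partial i f (x + ivec k) = partial i f x"
    using partial_eqI[of f _ x i] by (simp add: torus_periodic_ivec[OF per] partial_def)
qed

text \<open>Translation by s in direction i does not change the torus integral. Averaging over s in
  [0,1] and exchanging the integrals leaves the increment of f over one period in direction i, which
  is zero.\<close>

lemma integral_partial_zero:
  fixes f :: "real^'n \<Rightarrow> real"
  assumes sm: "smooth f" and per: "torus_periodic f"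
  shows "(LINT x|torus. partial i f x) = 0"
proof -
  let ?I = "lebesgue_on {0..1::real}" and ?X = "torus :: (real^'n) measure"
  interpret I: finite_measure ?I by (rule finite_measure_time)
  interpret X: finite_measure ?X by (rule finite_measure_torus)
  interpret IX: pair_sigma_finite ?I ?X ..
  note [measurable] = measurable_id_lebesgue_on[of "{0..1::real}"] measurable_id_lebesgue_on[of "cbox 0 (1::real^'n)"]
  let ?g = "partial i f"
  have cont: "continuous_on S ?g" for S by (intro smooth_continuous smooth_partial sm)
  have pg: "torus_periodic ?g" by (rule torus_periodic_partial[OF per sm])
  obtain B where B: "\<And>x. \<bar>?g x\<bar> \<le> B" by (rule torus_periodic_bounded[OF pg cont]) blast
  have [measurable]: "?g \<in> borel_measurable borel"
    by (rule borel_measurable_continuous_onI[OF cont])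
  have m: "(\<lambda>p. ?g (fst p *\<^sub>R axis i 1 + snd p)) \<in> borel_measurable (?I \<Otimes>\<^sub>M ?X)" by measurable
  interpret P: finite_measure "?I \<Otimes>\<^sub>M ?X" by (rule finite_measure_pair_measure) unfold_locales
  have int: "integrable (?I \<Otimes>\<^sub>M ?X) (\<lambda>(s, x). ?g (s *\<^sub>R axis i 1 + x))"
    by (rule P.integrable_const_bound[where B = B]) (use B m in \<open>auto simp: split_beta\<close>)
  have FTC: "(LINT s|?I. ?g (s *\<^sub>R axis i 1 + x)) = 0" for x
  proof -
    have der: "((\<lambda>s. f (s *\<^sub>R axis i 1 + x)) has_real_derivative ?g (s *\<^sub>R axis i 1 + x)) (at s)" for s
    proof -
      have "((\<lambda>s. s *\<^sub>R axis i 1 + x) has_derivative (\<lambda>h. h *\<^sub>R axis i 1)) (at s)"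
        by (auto intro!: derivative_eq_intros)
      from has_derivative_compose[OF this smooth_has_derivative[OF sm]]
      have "((\<lambda>s. f (s *\<^sub>R axis i 1 + x)) has_derivative
        (\<lambda>h. frechet_derivative f (at (s *\<^sub>R axis i 1 + x)) (h *\<^sub>R axis i 1))) (at s)" .
      moreover have "frechet_derivative f (at y) (h *\<^sub>R axis i 1) = ?g y * h" for h y
        using linear_scale[OF has_derivative_linear[OF smooth_has_derivative[OF sm]]] by (simp add: partial_def)
      ultimately show ?thesis by (simp add: has_field_derivative_def)
    qed
    have "(LINT s|?I. ?g (s *\<^sub>R axis i 1 + x)) = (LINT s|lborel. indicator {0..1} s * ?g (s *\<^sub>R axis i 1 + x))"
      by (rule integral_lebesgue_on_lborel) auto
    also have "\<dots> = (LINT s|lborel. ?g (s *\<^sub>R axis i 1 + x) * indicator {0..1} s)"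
      by (simp add: mult.commute)
    also have "\<dots> = f (1 *\<^sub>R axis i 1 + x) - f (0 *\<^sub>R axis i 1 + x)"
    proof (rule integral_FTC_Icc_real)
      show "isCont (\<lambda>s. ?g (s *\<^sub>R axis i 1 + x)) s" for s
      proof -
        have "continuous_on UNIV (\<lambda>s. ?g (s *\<^sub>R axis i 1 + x))"
          by (rule continuous_on_compose2[OF cont[of UNIV]]) (auto intro!: continuous_intros)
        then show ?thesis by (simp add: continuous_on_eq_continuous_at)
      qed
    qed (use der in auto)
    also have "\<dots> = 0"
    proof -
      have "ivec (axis i 1) = (axis i 1 :: real^'n)" by (simp add: vec_eq_iff axis_def)
      then show ?thesis using torus_periodic_ivec[OF per, of x "axis i 1"] by (simp add: add.commute)
    qed
    finally show ?thesis .
  qed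
  have "(LINT x|?X. ?g x) = (LINT s|?I. LINT x|?X. ?g x)"
    by (simp add: measure_restrict_space)
  also have "\<dots> = (LINT s|?I. LINT x|?X. ?g (s *\<^sub>R axis i 1 + x))"
    by (subst integral_torus_translate[OF _ pg B]) auto
  also have "\<dots> = (LINT x|?X. LINT s|?I. ?g (s *\<^sub>R axis i 1 + x))"
    using IX.Fubini_integral[OF int] by simp
  also have "\<dots> = 0" by (simp add: FTC)
  finally show ?thesis .
qed

section \<open>The Hartley basis of the torus\<close>

text \<open>The functions \<open>cos (2\<pi>k\<cdot>x) + sin (2\<pi>k\<cdot>x)\<close> form a real orthonormal basis, and differentiation maps
  the one with index \<open>k\<close> to a multiple of the one with index \<open>-k\<close>.\<close>

definition phase :: "int^'n \<Rightarrow> real^'n \<Rightarrow> real" where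
  "phase k x = 2 * pi * (ivec k \<bullet> x)"

definition hartley :: "int^'n \<Rightarrow> real^'n \<Rightarrow> real" where
  "hartley k x = cos (phase k x) + sin (phase k x)"

lemma phase_simps: "phase (k + l) x = phase k x + phase l x" "phase (k - l) x = phase k x - phase l x"
  "phase (- k) x = - phase k x" "phase k (x + y) = phase k x + phase k y"
  "phase k (x - y) = phase k x - phase k y" "phase 0 x = 0"
  by (simp_all add: phase_def ivec_simps algebra_simps)

lemma hartley_minus: "hartley (- k) x = cos (phase k x) - sin (phase k x)"
  by (simp add: hartley_def phase_simps)

lemma cos_phase: "cos (phase k x) = (hartley k x + hartley (- k) x) / 2"
  and sin_phase: "sin (phase k x) = (hartley k x - hartley (- k) x) / 2"
  by (simp_all add: hartley_minus) (simp_all add: hartley_def)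

lemma hartley_mult: "hartley k x * hartley l x = cos (phase (k - l) x) + sin (phase (k + l) x)"
  by (simp add: hartley_def phase_simps cos_diff sin_add algebra_simps)

lemma hartley_bounded: "\<bar>hartley k x\<bar> \<le> 2"
  unfolding hartley_def using abs_cos_le_one[of "phase k x"] abs_sin_le_one[of "phase k x"] by linarith

lemma hartley_0 [simp]: "hartley 0 x = 1"
  by (simp add: hartley_def phase_simps)

lemma bounded_linear_phase: "bounded_linear (phase k)"
  unfolding phase_def[abs_def] by (intro bounded_linear_const_mult bounded_linear_inner_right)

lemma smooth_hartley: "smooth (hartley k)"
  using smooth_compose_linear[OF bounded_linear_phase smooth_trig[of 1 1], of k]
  by (simp add: hartley_def[abs_def] add.commute)

lemma continuous_on_hartley: "continuous_on S (hartley k)"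
  by (rule smooth_continuous[OF smooth_hartley])

lemma hartley_measurable [measurable]: "hartley k \<in> borel_measurable borel"
  by (rule borel_measurable_continuous_onI[OF continuous_on_hartley])

lemma hartley_measurable_torus [measurable]: "hartley k \<in> borel_measurable torus"
  by (rule borel_imp_measurable_lebesgue_on[OF hartley_measurable])

lemma torus_periodic_hartley: "torus_periodic (hartley (k :: int^'n))"
proof (rule torus_periodicI)
  fix x :: "real^'n" and l :: "int^'n"
  have "phase k (ivec l) = 2 * pi * real_of_int (\<Sum>i\<in>UNIV. k $ i * l $ i)"
    by (simp add: phase_def inner_vec_def)
  then have "phase k (x + ivec l) = phase k x + 2 * pi * real_of_int (\<Sum>i\<in>UNIV. k $ i * l $ i)"
    by (simp add: phase_simps)
  then show "hartley k (x + ivec l) = hartley k x"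
    by (simp add: hartley_def cos_add sin_add del: of_int_sum)
qed

lemma hartley_has_derivative:
  "(hartley k has_derivative (\<lambda>v. phase k v * hartley (- k) x)) (at x)"
proof -
  have "(phase k has_derivative phase k) (at x)"
    by (rule bounded_linear_imp_has_derivative[OF bounded_linear_phase])
  then show ?thesis
    unfolding hartley_def[abs_def]
    by (auto intro!: derivative_eq_intros simp: phase_simps algebra_simps)
qed

lemma partial_hartley: "partial i (hartley k) x = 2 * pi * real_of_int (k $ i) * hartley (- k) x"
  using partial_eqI[OF hartley_has_derivative, of i k x] by (simp add: phase_def inner_axis)

lemma partial_hartley_fun: "partial i (hartley k) = (\<lambda>x. 2 * pi * real_of_int (k $ i) * hartley (- k) x)"
  by (simp add: fun_eq_iff partial_hartley)

text \<open>The eigenvalue of minus the Laplacian at mode k, that is 4 pi^2 |k|^2.\<close>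

definition freq :: "int^'n \<Rightarrow> real" where
  "freq k = (\<Sum>i\<in>UNIV. (2 * pi * real_of_int (k $ i))\<^sup>2)"

lemma freq_nonneg [simp]: "0 \<le> freq k"
  by (simp add: freq_def sum_nonneg)

lemma partial_cmult:
  assumes "smooth f"
  shows "partial i (\<lambda>x. c * f x) x = c * partial i f x"
  using partial_eqI[OF has_derivative_mult_right[OF smooth_has_derivative[OF assms]], of i c x]
  by (simp add: partial_def)

lemma partial_mult:
  assumes "smooth f" "smooth g"
  shows "partial i (\<lambda>x. f x * g x) x = f x * partial i g x + partial i f x * g x"
  using partial_eqI[OF has_derivative_mult[OF smooth_has_derivative[OF assms(1)] smooth_has_derivative[OF assms(2)]], of i x]
  by (simp add: partial_def)

lemma laplacian_hartley: "laplacian (hartley k) x = - freq k * hartley k x"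
proof -
  have "partial i (partial i (hartley k)) x = - ((2 * pi * real_of_int (k $ i))\<^sup>2 * hartley k x)" for i
    unfolding partial_hartley_fun partial_cmult[OF smooth_hartley] partial_hartley
    by (simp add: power2_eq_square)
  then show ?thesis by (simp add: laplacian_def freq_def sum_negf sum_distrib_right)
qed

text \<open>If some component i of k is nonzero, \<open>hartley k\<close> is a multiple of the i-th
  derivative of \<open>hartley (- k)\<close>, whose integral vanishes.\<close>

lemma integral_hartley: "(LINT x|torus. hartley k x) = (if k = 0 then 1 else 0)"
proof (cases "k = 0")
  case True
  then show ?thesis by (simp add: measure_restrict_space)
next
  case False
  then obtain i where i: "k $ i \<noteq> 0" by (auto simp: vec_eq_iff)
  have "(LINT x|torus. partial i (hartley (- k)) x) = 0"
    by (rule integral_partial_zero[OF smooth_hartley torus_periodic_hartley])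
  then show ?thesis using i False by (simp add: partial_hartley)
qed

lemma integrable_torus_bounded:
  fixes f :: "real^'n \<Rightarrow> real"
  assumes "f \<in> borel_measurable torus" "\<And>x. \<bar>f x\<bar> \<le> B"
  shows "integrable torus f"
proof -
  interpret finite_measure "torus :: (real^'n) measure" by (rule finite_measure_torus)
  show ?thesis by (rule integrable_const_bound[where B = B]) (use assms in auto)
qed

lemma integrable_hartley: "integrable torus (hartley k)"
  by (rule integrable_torus_bounded[OF hartley_measurable_torus hartley_bounded])

lemma integral_hartley_mult: "(LINT x|torus. hartley k x * hartley l x) = (if k = l then 1 else 0)"
  by (simp add: hartley_mult cos_phase sin_phase integrable_hartley integral_hartley)
    (auto simp: eq_neg_iff_add_eq_0 neg_eq_iff_add_eq_0 diff_eq_eq)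

section \<open>Trigonometric polynomials and completeness of the Hartley system\<close>

inductive trig_poly :: "(real^'n \<Rightarrow> real) \<Rightarrow> bool" where
  hartley: "trig_poly (hartley k)"
| add: "trig_poly f \<Longrightarrow> trig_poly g \<Longrightarrow> trig_poly (\<lambda>x. f x + g x)"
| scale: "trig_poly f \<Longrightarrow> trig_poly (\<lambda>x. c * f x)"

text \<open>By the product formula the span of the basis is an algebra, which is what allows
  polynomials to be pulled back into it.\<close>

lemma trig_poly_mult:
  assumes "trig_poly f" "trig_poly g"
  shows "trig_poly (\<lambda>x. f x * g x)"
  using assms
proof (induction arbitrary: g)
  case (hartley k)
  show ?case using hartley(1)
  proof induction
    case (hartley l)
    have "trig_poly (\<lambda>x. (1/2) * (hartley (k - l) x + hartley (- (k - l)) x)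
        + (1/2) * (hartley (k + l) x + (- 1) * hartley (- (k + l)) x))"
      by (intro trig_poly.intros)
    then show ?case by (simp add: hartley_mult cos_phase sin_phase field_simps)
  next
    case (add f g)
    then show ?case using trig_poly.add[OF add.IH] by (simp add: distrib_left)
  next
    case (scale f c)
    then show ?case using trig_poly.scale[OF scale.IH, of c] by (simp add: mult.left_commute)
  qed
next
  case (add f1 f2)
  then show ?case using trig_poly.add[OF add.IH(1)[OF add.prems] add.IH(2)[OF add.prems]]
    by (simp add: distrib_right)
next
  case (scale f c)
  then show ?case using trig_poly.scale[OF scale.IH[OF scale.prems], of c] by (simp add: mult.assoc)
qed

lemma trig_poly_const: "trig_poly (\<lambda>x. c)"
  using trig_poly.scale[OF trig_poly.hartley[of 0], of c] by simp

lemma trig_poly_sum: "(\<And>i. i \<in> S \<Longrightarrow> trig_poly (f i)) \<Longrightarrow> trig_poly (\<lambda>x. \<Sum>i\<in>S. f i x)"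
  by (induction S rule: infinite_finite_induct) (auto intro: trig_poly_const trig_poly.add)

text \<open>The torus as a product of circles in Euclidean space: the image is compact, and
  polynomials composed with the embedding are trigonometric polynomials, so Stone-Weierstrass
  applies.\<close>

definition torus_embedding :: "real^'n \<Rightarrow> (real^'n) \<times> (real^'n)" where
  "torus_embedding x = ((\<chi> i. cos (2 * pi * x $ i)), (\<chi> i. sin (2 * pi * x $ i)))"

lemma trig_poly_polynomial:
  fixes p :: "(real^'n) \<times> (real^'n) \<Rightarrow> real"
  assumes "real_polynomial_function p"
  shows "trig_poly (\<lambda>x. p (torus_embedding x))"
  using assms
proof induction
  case (linear f)
  interpret bounded_linear f by (rule linear)
  have ph: "phase (axis i 1) x = 2 * pi * x $ i" for i and x :: "real^'n"
  proof -
    have "ivec (axis i 1) = (axis i 1 :: real^'n)" by (simp add: vec_eq_iff axis_def)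
    then show ?thesis by (simp add: phase_def inner_axis')
  qed
  have vec: "(\<Sum>i\<in>UNIV. c i *\<^sub>R axis i 1) = (\<chi> i. c i)" for c :: "'n \<Rightarrow> real"
    by (simp add: vec_eq_iff axis_def if_distrib cong: if_cong)
  have "f (torus_embedding x) =
      (\<Sum>i\<in>UNIV. f (axis i 1, 0) * cos (phase (axis i 1) x) + f (0, axis i 1) * sin (phase (axis i 1) x))" for x
  proof -
    let ?c = "\<chi> i. cos (2 * pi * x $ i)" and ?s = "\<chi> i. sin (2 * pi * x $ i)"
    have "torus_embedding x = (\<Sum>i\<in>UNIV. ?c $ i *\<^sub>R (axis i 1, 0)) + (\<Sum>i\<in>UNIV. ?s $ i *\<^sub>R (0, axis i 1))"
      by (simp add: torus_embedding_def prod_eq_iff fst_sum snd_sum vec)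
    moreover have "f (c *\<^sub>R v, 0) = c * f (v, 0)" "f (0, c *\<^sub>R v) = c * f (0, v)" for c v
      using scale[of c "(v, 0)"] scale[of c "(0, v)"] by simp_all
    ultimately show ?thesis by (simp add: add sum ph sum.distrib mult.commute)
  qed
  moreover have "trig_poly (\<lambda>x. \<Sum>i\<in>UNIV. f (axis i 1, 0) * cos (phase (axis i 1) x) + f (0, axis i 1) * sin (phase (axis i 1) x))"
  proof (intro trig_poly_sum trig_poly.add trig_poly.scale)
    have "trig_poly (\<lambda>x. (1/2) * (hartley k x + hartley (- k) x))" for k :: "int^'n"
      by (intro trig_poly.intros)
    then show "trig_poly (\<lambda>x::real^'n. cos (phase k x))" for k
      by (simp add: cos_phase)
    have "trig_poly (\<lambda>x. (1/2) * (hartley k x + (-1) * hartley (- k) x))" for k :: "int^'n"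
      by (intro trig_poly.intros)
    then show "trig_poly (\<lambda>x::real^'n. sin (phase k x))" for k
      by (simp add: sin_phase)
  qed
  ultimately show ?case by simp
qed (auto intro: trig_poly_const trig_poly.add trig_poly_mult)

text \<open>Opposite faces of the closed cube have the same image, hence the condition that one of
  the points be interior.\<close>

lemma torus_embedding_inj:
  assumes "torus_embedding x = torus_embedding y" "x \<in> box 0 1" "y \<in> cbox 0 (1::real^'n)"
  shows "x = y"
proof -
  have "x $ i = y $ i" for i
  proof -
    have "sin (2 * pi * x $ i) = sin (2 * pi * y $ i) \<and> cos (2 * pi * x $ i) = cos (2 * pi * y $ i)"
      using assms(1) by (simp add: torus_embedding_def vec_eq_iff)
    then obtain n where "2 * pi * x $ i = 2 * pi * y $ i + 2 * pi * real_of_int n"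
      using sin_cos_eq_iff by auto
    then have "2 * pi * x $ i = 2 * pi * (y $ i + real_of_int n)" by (simp add: distrib_left)
    then have eq: "x $ i = y $ i + real_of_int n" by simp
    moreover have "0 < x $ i" "x $ i < 1" "0 \<le> y $ i" "y $ i \<le> 1"
      using assms(2,3) by (auto simp: mem_box_cart)
    ultimately have "real_of_int n < 1" "- 1 < real_of_int n" by linarith+
    then have "n = 0" by linarith
    with eq show ?thesis by simp
  qed
  then show ?thesis by (simp add: vec_eq_iff)
qed

text \<open>A function vanishing off the open cube has the same value at identified boundary points
  and so factors through the embedding. The factor is continuous because its preimages of closed
  sets are images of compact sets.\<close>

lemma trig_poly_dense:
  fixes g :: "real^'n \<Rightarrow> real"
  assumes g: "continuous_on UNIV g" and supp: "\<And>x. x \<notin> box 0 1 \<Longrightarrow> g x = 0" and e: "0 < e"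
  obtains w where "trig_poly w" "\<And>x. x \<in> cbox 0 1 \<Longrightarrow> \<bar>g x - w x\<bar> < e"
proof -
  let ?E = torus_embedding and ?C = "torus_embedding ` cbox 0 (1::real^'n)"
  have contE: "continuous_on S ?E" for S :: "(real^'n) set"
    unfolding torus_embedding_def[abs_def]
    by (intro continuous_on_Pair continuous_on_vec_lambda continuous_intros)
  have C: "compact ?C" by (intro compact_continuous_image contE) simp
  define G where "G y = g (SOME x. x \<in> cbox 0 1 \<and> ?E x = y)" for y
  have GE: "G (?E x) = g x" if x: "x \<in> cbox 0 1" for x
  proof -
    define z where "z = (SOME z. z \<in> cbox 0 1 \<and> ?E z = ?E x)"
    have z: "z \<in> cbox 0 1 \<and> ?E z = ?E x" unfolding z_def by (rule someI[of _ x]) (use x in simp)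
    have "g z = g x"
    proof (cases "x \<in> box 0 1 \<or> z \<in> box 0 1")
      case True
      then have "x = z" using torus_embedding_inj[of x z] torus_embedding_inj[of z x] x z by auto
      then show ?thesis by simp
    next
      case False
      then show ?thesis using supp by simp
    qed
    then show ?thesis by (simp add: G_def z_def)
  qed
  have "continuous_on ?C G"
    unfolding continuous_on_closed_vimage[OF compact_imp_closed[OF C]]
  proof (intro allI impI)
    fix B :: "real set" assume B: "closed B"
    have "G -` B \<inter> ?C = ?E ` (cbox 0 1 \<inter> g -` B)" using GE by auto
    moreover have "closed (g -` B)"
      using B g by (simp add: continuous_on_closed_vimage[OF closed_UNIV])
    then have "compact (cbox 0 1 \<inter> g -` B)" by (intro compact_Int_closed) auto
    then have "closed (?E ` (cbox 0 1 \<inter> g -` B))"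
      by (intro compact_imp_closed compact_continuous_image contE)
    ultimately show "closed (G -` B \<inter> ?C)" by simp
  qed
  from Stone_Weierstrass_real_polynomial_function[OF C this e] obtain p where
    p: "real_polynomial_function p" "\<And>y. y \<in> ?C \<Longrightarrow> \<bar>G y - p y\<bar> < e" by blast
  show ?thesis
  proof (rule that[OF trig_poly_polynomial[OF p(1)]])
    show "\<bar>g x - p (?E x)\<bar> < e" if "x \<in> cbox 0 1" for x
      using p(2)[of "?E x"] GE[OF that] that by simp
  qed
qed

text \<open>Orthogonality passes from the basis to trigonometric polynomials by linearity, to
  continuous functions vanishing off the open cube by uniform approximation, and to indicators of
  boxes by dominated convergence; the latter determine f.\<close>

lemma hartley_complete:
  fixes f :: "real^'n \<Rightarrow> real"
  assumes f: "square_integrable torus f" and zero: "\<And>k. (LINT x|torus. f x * hartley k x) = 0"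
  shows "AE x in torus. f x = 0"
proof (rule AE_zero_if_integral_boxes_zero_on)
  interpret finite_measure "torus :: (real^'n) measure" by (rule finite_measure_torus)
  show int: "integrable torus f" by (rule square_integrable_integrable[OF f])
  note [measurable] = measurable_id_lebesgue_on[of "cbox 0 (1::real^'n)"]
  have [measurable]: "f \<in> borel_measurable torus" using f by auto
  have fw: "integrable torus (\<lambda>x. f x * w x)"
    if "w \<in> borel_measurable borel" "\<And>x. x \<in> cbox 0 1 \<Longrightarrow> \<bar>w x\<bar> \<le> B" for w B
  proof (rule Bochner_Integration.integrable_bound)
    show "integrable torus (\<lambda>x. B * f x)" using int by simp
    show "(\<lambda>x. f x * w x) \<in> borel_measurable torus"
      using borel_imp_measurable_lebesgue_on[OF that(1)] by simp
    show "AE x in torus. norm (f x * w x) \<le> norm (B * f x)"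
      using that(2) by (intro AE_I2) (auto simp: abs_mult mult.commute[of "\<bar>f _\<bar>"] intro!: mult_right_mono order_trans[OF that(2)])
  qed
  have trig: "w \<in> borel_measurable borel \<and> (\<exists>B. \<forall>x. \<bar>w x\<bar> \<le> B) \<and> (LINT x|torus. f x * w x) = 0"
    if "trig_poly w" for w
    using that
  proof induction
    case (hartley k)
    show ?case using zero[of k] hartley_bounded[of k] by auto
  next
    case (add u v)
    then obtain B C where B: "\<And>x. \<bar>u x\<bar> \<le> B" and C: "\<And>x. \<bar>v x\<bar> \<le> C" by blast
    have "\<bar>u x + v x\<bar> \<le> B + C" for x using B[of x] C[of x] by linarith
    moreover have "integrable torus (\<lambda>x. f x * u x)" "integrable torus (\<lambda>x. f x * v x)"
      using add B C by (auto intro: fw)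
    ultimately show ?case using add by (auto simp: distrib_left)
  next
    case (scale u c)
    then obtain B where B: "\<And>x. \<bar>u x\<bar> \<le> B" by blast
    have "\<bar>c * u x\<bar> \<le> \<bar>c\<bar> * B" for x using B[of x] by (simp add: abs_mult mult_left_mono)
    then show ?case using scale by (auto simp: mult.left_commute[of _ c])
  qed
  have cont0: "(LINT x|torus. f x * g x) = 0"
    if g: "continuous_on UNIV g" "\<And>x. x \<notin> box 0 1 \<Longrightarrow> g x = 0" for g
  proof -
    have gb: "g \<in> borel_measurable borel" by (rule borel_measurable_continuous_onI[OF g(1)])
    obtain Bg where Bg: "\<And>x. x \<in> cbox 0 1 \<Longrightarrow> \<bar>g x\<bar> \<le> Bg"
      using compact_imp_bounded[OF compact_continuous_image[OF continuous_on_subset[OF g(1)], of "cbox 0 1"]]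
      by (auto simp: bounded_iff)
    have "\<bar>LINT x|torus. f x * g x\<bar> \<le> e * (LINT x|torus. \<bar>f x\<bar>)" if "0 < e" for e
    proof -
      obtain w where w: "trig_poly w" "\<And>x. x \<in> cbox 0 1 \<Longrightarrow> \<bar>g x - w x\<bar> < e"
        using trig_poly_dense[OF g \<open>0 < e\<close>] by blast
      then obtain B where B: "w \<in> borel_measurable borel" "\<And>x. \<bar>w x\<bar> \<le> B" "(LINT x|torus. f x * w x) = 0"
        using trig[OF w(1)] by blast
      have "(LINT x|torus. f x * g x) = (LINT x|torus. f x * (g x - w x))"
        using fw[OF gb Bg] fw[OF B(1,2)] B(3) by (simp add: right_diff_distrib)
      also have "\<bar>\<dots>\<bar> \<le> (LINT x|torus. \<bar>f x * (g x - w x)\<bar>)" by (rule integral_abs_bound)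
      also have "\<dots> \<le> (LINT x|torus. e * \<bar>f x\<bar>)"
      proof (rule integral_mono')
        show "integrable torus (\<lambda>x. e * \<bar>f x\<bar>)" using int by simp
        show "\<bar>f x * (g x - w x)\<bar> \<le> e * \<bar>f x\<bar>" if "x \<in> space torus" for x
          using mult_right_mono[OF less_imp_le[OF w(2)[of x]], of "\<bar>f x\<bar>"] that
          by (simp add: abs_mult mult.commute)
        show "0 \<le> e * \<bar>f x\<bar>" for x using \<open>0 < e\<close> by simp
      qed
      finally show ?thesis by simp
    qed
    then have "\<bar>LINT x|torus. f x * g x\<bar> \<le> 0 + e" if "0 < e" for e
    proof -
      have p: "0 < (LINT x|torus. \<bar>f x\<bar>) + 1" by (simp add: add_nonneg_pos)
      have "\<bar>LINT x|torus. f x * g x\<bar> \<le> e / ((LINT x|torus. \<bar>f x\<bar>) + 1) * (LINT x|torus. \<bar>f x\<bar>)"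
        by (rule \<open>\<And>e. 0 < e \<Longrightarrow> _ \<le> e * _\<close>) (use that p in simp)
      also have "\<dots> \<le> e" using p that by (simp add: field_simps)
      finally show ?thesis by simp
    qed
    then have "\<bar>LINT x|torus. f x * g x\<bar> \<le> 0" by (rule field_le_epsilon)
    then show ?thesis by simp
  qed
  fix a b :: "real^'n" assume ab: "box a b \<subseteq> box 0 1"
  \<comment> \<open>Continuous, zero off the box, and equal to 1 from distance 1/n to its complement
    on.\<close>
  define g where "g n x = min 1 (real n * infdist x (- box a b))" for n x
  have ne: "- box a b \<noteq> {}"
    using ab bounded_box[of 0 "1::real^'n"] by (metis Compl_empty_eq bounded_subset double_compl not_bounded_UNIV)
  have gc: "continuous_on UNIV (g n)" for n
    unfolding g_def[abs_def] by (intro continuous_intros)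
  have lim: "(\<lambda>n. g n x) \<longlonglongrightarrow> indicator (box a b) x" for x
  proof (cases "x \<in> box a b")
    case True
    then have pos: "0 < infdist x (- box a b)"
      using infdist_pos_not_in_closed[of "- box a b" x] ne open_box[of a b] by (simp add: open_closed)
    obtain N :: nat where N: "1 / infdist x (- box a b) < N" using reals_Archimedean2 by blast
    have "\<forall>\<^sub>F n in sequentially. g n x = 1"
      using eventually_ge_at_top[of N]
    proof eventually_elim
      fix n assume "N \<le> n"
      then have "1 / infdist x (- box a b) < real n" using N by simp
      then show "g n x = 1" using pos by (simp add: g_def field_simps)
    qed
    then show ?thesis using True by (simp add: tendsto_eventually)
  next
    case False
    then show ?thesis by (simp add: g_def)
  qed
  have [measurable]: "g n \<in> borel_measurable borel" for n
    by (rule borel_measurable_continuous_onI[OF gc])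
  have "(\<lambda>n. LINT x|torus. f x * g n x) \<longlonglongrightarrow> (LINT x|torus. f x * indicator (box a b) x)"
  proof (rule integral_dominated_convergence[where w = "\<lambda>x. \<bar>f x\<bar>"])
    show "AE x in torus. (\<lambda>n. f x * g n x) \<longlonglongrightarrow> f x * indicator (box a b) x"
      by (intro AE_I2 tendsto_intros lim)
    have "\<bar>g n x\<bar> \<le> 1" for n x
      using mult_nonneg_nonneg[OF of_nat_0_le_iff[of n] infdist_nonneg[of x "- box a b"]]
      unfolding g_def by linarith
    then show "AE x in torus. norm (f x * g n x) \<le> \<bar>f x\<bar>" for n
      by (auto simp: abs_mult mult_left_le)
    show "integrable torus (\<lambda>x. \<bar>f x\<bar>)" using int by simp
  qed measurable
  moreover have "(LINT x|torus. f x * g n x) = 0" for n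
  proof (rule cont0[OF gc])
    fix x :: "real^'n" assume "x \<notin> box 0 1"
    then have "x \<in> - box a b" using ab by blast
    then show "g n x = 0" unfolding g_def by (subst infdist_zero) auto
  qed
  ultimately have "(LINT x|torus. f x * indicator (box a b) x) = 0"
    by (simp add: LIMSEQ_const_iff)
  then show "(LINT x|torus. indicator (box a b) x * f x) = 0" by (simp add: mult.commute)
qed

interpretation torus: orthonormal_basis "torus :: (real^'n) measure" hartley
proof -
  interpret finite_measure "torus :: (real^'n) measure" by (rule finite_measure_torus)
  interpret orthonormal_system "torus :: (real^'n) measure" hartley
  proof
    show "square_integrable torus (hartley k)" for k :: "int^'n"
      by (rule square_integrable_bounded[OF hartley_measurable_torus hartley_bounded])
    show "(LINT x|torus. hartley k x * hartley l x) = (if k = l then 1 else 0)" for k l :: "int^'n"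
      by (rule integral_hartley_mult)
  qed
  show "orthonormal_basis (torus :: (real^'n) measure) hartley"
  proof
    show "AE x in torus. f x = 0" if "square_integrable torus f" "\<And>k. coef f k = 0" for f :: "real^'n \<Rightarrow> real"
      by (rule hartley_complete[OF that(1)]) (use that(2) in \<open>simp add: coef_def\<close>)
  qed
qed

section \<open>Fejer means\<close>

definition fejer_box :: "nat \<Rightarrow> (int^'n) set" where
  "fejer_box N = {k. \<forall>i. k $ i \<in> {0..<int N}}"

text \<open>The normalised autocorrelation of the box. For N > 0 it is the product of the factors
  max 0 (1 - |m_i| / N), but the counting form is what exhibits the kernel as a squared
  modulus.\<close>

definition fejer_mult :: "nat \<Rightarrow> int^'n \<Rightarrow> real" where
  "fejer_mult N m = real (card {k \<in> fejer_box N. k - m \<in> fejer_box N}) / real (card (fejer_box N :: (int^'n) set))"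

definition fejer_supp :: "nat \<Rightarrow> (int^'n) set" where
  "fejer_supp N = (\<lambda>(k, l). k - l) ` (fejer_box N \<times> fejer_box N)"

lemma card_vec_box:
  fixes A :: "'n::finite \<Rightarrow> 'a set"
  assumes "\<And>i. finite (A i)"
  shows "finite {k::'a^'n. \<forall>i. k $ i \<in> A i}" "card {k::'a^'n. \<forall>i. k $ i \<in> A i} = (\<Prod>i\<in>UNIV. card (A i))"
proof -
  have bij: "bij_betw vec_lambda (PiE UNIV A) {k::'a^'n. \<forall>i. k $ i \<in> A i}"
    by (rule bij_betwI[of _ _ _ vec_nth]) (auto simp: vec_lambda_inverse PiE_def)
  show "finite {k::'a^'n. \<forall>i. k $ i \<in> A i}"
    using bij_betw_finite[OF bij] assms by (simp add: finite_PiE)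
  show "card {k::'a^'n. \<forall>i. k $ i \<in> A i} = (\<Prod>i\<in>UNIV. card (A i))"
    using bij_betw_same_card[OF bij] by (simp add: card_PiE)
qed

lemma finite_fejer_box [simp]: "finite (fejer_box N)"
  unfolding fejer_box_def by (rule card_vec_box(1)) simp

lemma finite_fejer_supp [simp]: "finite (fejer_supp N)"
  by (simp add: fejer_supp_def)

lemma card_fejer_box: "card (fejer_box N :: (int^'n) set) = N ^ CARD('n)"
  unfolding fejer_box_def by (subst card_vec_box(2)) auto

lemma fejer_mult_nonneg [simp]: "0 \<le> fejer_mult N m"
  by (simp add: fejer_mult_def)

lemma fejer_mult_le_1: "fejer_mult N (m :: int^'n) \<le> 1"
proof -
  have "card {k \<in> fejer_box N. k - m \<in> fejer_box N} \<le> card (fejer_box N :: (int^'n) set)"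
    by (rule card_mono) auto
  then show ?thesis by (auto simp: fejer_mult_def divide_le_eq_1)
qed

lemma fejer_mult_tendsto: "(\<lambda>N. fejer_mult N (m :: int^'n)) \<longlonglongrightarrow> 1"
proof -
  have eq: "fejer_mult N m = (\<Prod>i\<in>UNIV. real (nat (int N - \<bar>m $ i\<bar>)) / real N)" for N
  proof -
    \<comment> \<open>In each coordinate the two conditions describe an interval of integers of
      length N - |m_i|, truncated at zero.\<close>
    have "{k \<in> fejer_box N. k - m \<in> fejer_box N} = {k. \<forall>i. k $ i \<in> {max 0 (m $ i)..<min (int N) (int N + m $ i)}}"
      by (auto simp: fejer_box_def algebra_simps)
    then have "card {k \<in> fejer_box N. k - m \<in> fejer_box N} = (\<Prod>i\<in>UNIV. nat (int N - \<bar>m $ i\<bar>))"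
      by (simp only:, subst card_vec_box(2)) (auto intro!: prod.cong)
    then show ?thesis by (simp add: fejer_mult_def card_fejer_box prod_dividef)
  qed
  have "(\<lambda>N. \<Prod>i\<in>UNIV. real (nat (int N - \<bar>m $ i\<bar>)) / real N) \<longlonglongrightarrow> (\<Prod>i\<in>(UNIV::'n set). 1)"
  proof (rule tendsto_prod)
    fix i
    have "(\<lambda>N. 1 - real_of_int \<bar>m $ i\<bar> / real N) \<longlonglongrightarrow> 1 - 0"
      by (intro tendsto_diff tendsto_const tendsto_divide_0[OF tendsto_const] filterlim_at_top_imp_at_infinity filterlim_real_sequentially)
    then have "(\<lambda>N. 1 - real_of_int \<bar>m $ i\<bar> / real N) \<longlonglongrightarrow> 1" by simp
    then show "(\<lambda>N. real (nat (int N - \<bar>m $ i\<bar>)) / real N) \<longlonglongrightarrow> 1"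
    proof (rule tendsto_cong[THEN iffD1, rotated])
      show "\<forall>\<^sub>F N in sequentially. 1 - real_of_int \<bar>m $ i\<bar> / real N = real (nat (int N - \<bar>m $ i\<bar>)) / real N"
        using eventually_gt_at_top[of "nat \<bar>m $ i\<bar>"]
      proof eventually_elim
        fix N assume N: "nat \<bar>m $ i\<bar> < N"
        then have "real (nat (int N - \<bar>m $ i\<bar>)) = real N - real_of_int \<bar>m $ i\<bar>" by linarith
        moreover have "0 < real N" using N by simp
        ultimately show "1 - real_of_int \<bar>m $ i\<bar> / real N = real (nat (int N - \<bar>m $ i\<bar>)) / real N"
          by (simp add: diff_divide_distrib)
      qed
    qed
  qed
  then show ?thesis by (simp add: eq)
qed

text \<open>Pairs in the box are grouped by their difference m; \<open>fejer_mult N m\<close> is the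
  number of such pairs up to normalisation.\<close>

lemma sum_fejer:
  fixes f :: "int^'n \<Rightarrow> real"
  shows "(\<Sum>m\<in>fejer_supp N. fejer_mult N m * f m)
    = (\<Sum>k\<in>fejer_box N. \<Sum>l\<in>fejer_box N. f (k - l)) / real (card (fejer_box N :: (int^'n) set))"
proof -
  let ?S = "fejer_box N :: (int^'n) set" and ?g = "\<lambda>(k, l). k - l :: int^'n"
  have "(\<Sum>k\<in>?S. \<Sum>l\<in>?S. f (k - l)) = (\<Sum>p\<in>?S \<times> ?S. f (?g p))"
    by (simp add: sum.cartesian_product split_beta)
  also have "\<dots> = (\<Sum>m\<in>?g ` (?S \<times> ?S). \<Sum>p\<in>{p \<in> ?S \<times> ?S. ?g p = m}. f (?g p))"
    by (rule sum.image_gen) simp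
  also have "\<dots> = (\<Sum>m\<in>fejer_supp N. real (card {k \<in> ?S. k - m \<in> ?S}) * f m)"
    unfolding fejer_supp_def
  proof (rule sum.cong[OF refl])
    fix m
    have bij: "bij_betw (\<lambda>k. (k, k - m)) {k \<in> ?S. k - m \<in> ?S} {p \<in> ?S \<times> ?S. ?g p = m}"
      by (rule bij_betwI[of _ _ _ fst]) auto
    have "(\<Sum>p\<in>{p \<in> ?S \<times> ?S. ?g p = m}. f (?g p)) = (\<Sum>p\<in>{p \<in> ?S \<times> ?S. ?g p = m}. f m)"
      by (rule sum.cong) auto
    then show "(\<Sum>p\<in>{p \<in> ?S \<times> ?S. ?g p = m}. f (?g p)) = real (card {k \<in> ?S. k - m \<in> ?S}) * f m"
      using bij_betw_same_card[OF bij] by simp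
  qed
  finally show ?thesis by (simp add: fejer_mult_def sum_divide_distrib)
qed

definition fejer_kernel :: "nat \<Rightarrow> real^'n \<Rightarrow> real" where
  "fejer_kernel N z = (\<Sum>m\<in>fejer_supp N. fejer_mult N m * hartley m z)"

lemma sum_sin_phase_zero:
  assumes "finite S"
  shows "(\<Sum>k\<in>S. \<Sum>l\<in>S. sin (phase (k - l) z)) = 0"
proof -
  have "(\<Sum>k\<in>S. \<Sum>l\<in>S. sin (phase (k - l) z)) = (\<Sum>l\<in>S. \<Sum>k\<in>S. sin (phase (k - l) z))"
    by (rule sum.swap)
  also have "\<dots> = - (\<Sum>k\<in>S. \<Sum>l\<in>S. sin (phase (k - l) z))"
  proof -
    have "sin (phase (k - l) z) = - sin (phase (l - k) z)" for k l
      using sin_minus[of "phase (l - k) z"] by (simp add: phase_simps)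
    then have "(\<Sum>l\<in>S. \<Sum>k\<in>S. sin (phase (k - l) z)) = (\<Sum>l\<in>S. \<Sum>k\<in>S. - sin (phase (l - k) z))"
      by (intro sum.cong refl)
    then show ?thesis by (simp add: sum_negf)
  qed
  finally show ?thesis by simp
qed

lemma fejer_kernel_cos:
  "fejer_kernel N (z :: real^'n) = (\<Sum>k\<in>fejer_box N. \<Sum>l\<in>fejer_box N. cos (phase (k - l) z)) / real (card (fejer_box N :: (int^'n) set))"
  by (simp add: fejer_kernel_def sum_fejer hartley_def sum.distrib sum_sin_phase_zero)

text \<open>The double sum of cosines is the squared modulus of the sum of exp (i
  \<open>phase k z\<close>) over the box. The sine parts of the Hartley functions have cancelled,
  being odd under exchange of k and l.\<close>

lemma fejer_kernel_nonneg: "0 \<le> fejer_kernel N (z :: real^'n)"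
proof -
  let ?S = "fejer_box N :: (int^'n) set"
  have "(\<Sum>k\<in>?S. \<Sum>l\<in>?S. cos (phase (k - l) z))
      = (\<Sum>k\<in>?S. cos (phase k z))\<^sup>2 + (\<Sum>k\<in>?S. sin (phase k z))\<^sup>2"
    by (simp add: phase_simps cos_diff sum.distrib power2_eq_square sum_product)
  then show ?thesis by (simp add: fejer_kernel_cos)
qed

text \<open>A single product of Hartley functions is not a function of x - y: it also contains sin
  (phase m (x + y)). That term is odd in m and disappears in the symmetric sum.\<close>

lemma fejer_kernel_split:
  "fejer_kernel N (x - y) = (\<Sum>m\<in>fejer_supp N. fejer_mult N m * (hartley m x * hartley m y))"
proof -
  have "hartley m x * hartley m y = cos (phase m (x - y)) + sin (phase m (x + y))" for m
    by (simp add: hartley_def phase_simps cos_diff sin_add algebra_simps)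
  then show ?thesis
    by (simp add: sum_fejer fejer_kernel_cos sum.distrib sum_sin_phase_zero)
qed

lemma fejer_kernel_measurable [measurable]: "fejer_kernel N \<in> borel_measurable borel"
  unfolding fejer_kernel_def[abs_def] by measurable

lemma torus_periodic_fejer_kernel: "torus_periodic (fejer_kernel N)"
  by (rule torus_periodicI) (simp add: fejer_kernel_def torus_periodic_ivec[OF torus_periodic_hartley])

lemma fejer_kernel_bounded: "\<exists>B. \<forall>z. \<bar>fejer_kernel N (z :: real^'n)\<bar> \<le> B"
proof (intro exI allI)
  fix z :: "real^'n"
  have "\<bar>fejer_kernel N z\<bar> \<le> (\<Sum>m\<in>fejer_supp N. \<bar>fejer_mult N m * hartley m z\<bar>)"
    unfolding fejer_kernel_def by (rule sum_abs)
  also have "\<dots> \<le> (\<Sum>m\<in>(fejer_supp N :: (int^'n) set). 1 * 2)"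
    unfolding abs_mult abs_of_nonneg[OF fejer_mult_nonneg]
    by (intro sum_mono mult_mono fejer_mult_le_1 hartley_bounded) auto
  finally show "\<bar>fejer_kernel N z\<bar> \<le> (\<Sum>m\<in>(fejer_supp N :: (int^'n) set). 1 * 2)" .
qed

text \<open>Only the mode m = 0 has nonzero mean, and its multiplier is 1 as soon as the box is
  nonempty.\<close>

lemma integral_fejer_kernel:
  fixes x :: "real^'n"
  assumes "0 < N"
  shows "(LINT y|torus. fejer_kernel N (x - y)) = 1"
proof -
  have box0: "(0::int^'n) \<in> fejer_box N" using assms by (simp add: fejer_box_def)
  then have "(0::int^'n) \<in> fejer_supp N" by (force simp: fejer_supp_def)
  moreover have "fejer_mult N (0::int^'n) = 1"
    using card_fejer_box[where 'n = 'n, of N] assms by (simp add: fejer_mult_def)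
  moreover have "(LINT y|torus. fejer_kernel N (x - y))
      = (\<Sum>m\<in>fejer_supp N. fejer_mult N m * (hartley m x * (if m = 0 then 1 else 0)))"
    by (simp add: fejer_kernel_split integrable_hartley integral_hartley)
  ultimately show ?thesis by (simp add: if_distrib cong: if_cong)
qed

definition fejer_mean :: "nat \<Rightarrow> (real^'n \<Rightarrow> real) \<Rightarrow> real^'n \<Rightarrow> real" where
  "fejer_mean N f x = (\<Sum>m\<in>fejer_supp N. fejer_mult N m * torus.coef f m * hartley m x)"

lemma fejer_mean_kernel:
  assumes f: "square_integrable torus f"
  shows "fejer_mean N f x = (LINT y|torus. fejer_kernel N (x - y) * f y)"
proof -
  have "(LINT y|torus. fejer_kernel N (x - y) * f y)
      = (LINT y|torus. f y * (\<Sum>m\<in>fejer_supp N. fejer_mult N m * hartley m x * hartley m y))"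
    by (simp add: fejer_kernel_split mult_ac)
  then show ?thesis
    using torus.inner_comb[OF f, of "\<lambda>m. fejer_mult N m * hartley m x" "fejer_supp N"]
    by (simp add: fejer_mean_def mult_ac)
qed

text \<open>Jensen's inequality for the probability density \<open>fejer_kernel N (x - y)\<close>:
  the variance of f about its mean \<open>fejer_mean N f x\<close> is nonnegative.\<close>

lemma fejer_mean_square_le:
  fixes f :: "real^'n \<Rightarrow> real"
  assumes f: "square_integrable torus f" and N: "0 < N"
  shows "integrable torus (\<lambda>y. fejer_kernel N (x - y) * (f y)\<^sup>2)"
    and "(fejer_mean N f x)\<^sup>2 \<le> (LINT y|torus. fejer_kernel N (x - y) * (f y)\<^sup>2)"
proof -
  let ?w = "\<lambda>y. fejer_kernel N (x - y)"
  obtain B where B: "\<And>z. \<bar>fejer_kernel N (z :: real^'n)\<bar> \<le> B" using fejer_kernel_bounded by blast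
  have wm: "?w \<in> borel_measurable torus"
    by (rule borel_imp_measurable_lebesgue_on) measurable
  have w: "integrable torus ?w"
    by (rule integrable_torus_bounded[OF wm B])
  have wg: "integrable torus (\<lambda>y. ?w y * g y)" if "integrable torus g" for g
  proof (rule Bochner_Integration.integrable_bound)
    show "integrable torus (\<lambda>y. B * g y)" using that by simp
    show "(\<lambda>y. ?w y * g y) \<in> borel_measurable torus" using wm that by simp
    show "AE y in torus. norm (?w y * g y) \<le> norm (B * g y)"
      using order_trans[OF B abs_ge_self] by (auto simp: abs_mult intro!: mult_right_mono)
  qed
  show wf2: "integrable torus (\<lambda>y. ?w y * (f y)\<^sup>2)" by (rule wg[OF square_integrable_square[OF f]])
  have wf: "integrable torus (\<lambda>y. ?w y * f y)" by (rule wg[OF torus.square_integrable_integrable[OF f]])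
  let ?c = "fejer_mean N f x"
  have "0 \<le> (LINT y|torus. ?w y * (f y - ?c)\<^sup>2)"
    by (simp add: fejer_kernel_nonneg)
  also have "\<dots> = (LINT y|torus. ?w y * (f y)\<^sup>2 - 2 * ?c * (?w y * f y) + ?c\<^sup>2 * ?w y)"
    by (simp add: power2_diff algebra_simps)
  also have "\<dots> = (LINT y|torus. ?w y * (f y)\<^sup>2) - 2 * ?c * ?c + ?c\<^sup>2 * 1"
    using wf2 wf w by (simp add: fejer_mean_kernel[OF f] integral_fejer_kernel[OF N])
  finally show "?c\<^sup>2 \<le> (LINT y|torus. ?w y * (f y)\<^sup>2)" by (simp add: power2_eq_square)
qed

text \<open>Weighted bounds that are uniform over all translations survive averaging with the kernel.\<close>

lemma nn_integral_fejer_mean_le: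
  fixes f :: "real^'n \<Rightarrow> real" and g :: "real^'n \<Rightarrow> ennreal"
  assumes f: "square_integrable torus f" and fb [measurable]: "f \<in> borel_measurable borel"
    and per: "torus_periodic f" and g [measurable]: "g \<in> borel_measurable borel" and N: "0 < N"
    and bound: "\<And>z. (\<integral>\<^sup>+x. ennreal ((f (x - z))\<^sup>2) * g x \<partial>torus) \<le> C"
  shows "(\<integral>\<^sup>+x. ennreal ((fejer_mean N f x)\<^sup>2) * g x \<partial>torus) \<le> C"
proof -
  let ?X = "torus :: (real^'n) measure" and ?K = "\<lambda>z. ennreal (fejer_kernel N z)"
  interpret XX: pair_sigma_finite ?X ?X ..
  note [measurable] = measurable_id_lebesgue_on[of "cbox 0 (1::real^'n)"]
  have K0: "0 \<le> fejer_kernel N z" for z :: "real^'n" by (rule fejer_kernel_nonneg)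
  have pt: "ennreal ((fejer_mean N f x)\<^sup>2) \<le> (\<integral>\<^sup>+z. ?K z * ennreal ((f (x - z))\<^sup>2) \<partial>?X)" for x
  proof -
    have "ennreal ((fejer_mean N f x)\<^sup>2) \<le> ennreal (LINT y|torus. fejer_kernel N (x - y) * (f y)\<^sup>2)"
      by (rule ennreal_leI[OF fejer_mean_square_le(2)[OF f N]])
    also have "\<dots> = (\<integral>\<^sup>+y. ennreal (fejer_kernel N (x - y) * (f y)\<^sup>2) \<partial>?X)"
      by (rule nn_integral_eq_integral[symmetric, OF fejer_mean_square_le(1)[OF f N]]) (simp add: K0)
    \<comment> \<open>The substitution y = x - z moves the translation from the kernel onto f, where
      \<open>bound\<close> applies.\<close>
    also have "\<dots> = (\<integral>\<^sup>+z. ennreal (fejer_kernel N (x - (x + (- 1) *\<^sub>R z)) * (f (x + (- 1) *\<^sub>R z))\<^sup>2) \<partial>?X)"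
    proof (rule nn_integral_torus_affine[symmetric, where f = "\<lambda>y. ennreal (fejer_kernel N (x - y) * (f y)\<^sup>2)"])
      show "torus_periodic (\<lambda>y. ennreal (fejer_kernel N (x - y) * (f y)\<^sup>2))"
      proof (rule torus_periodicI)
        fix y k
        have "fejer_kernel N (x - (y + ivec k)) = fejer_kernel N (x - y)"
          using torus_periodic_ivec_minus[OF torus_periodic_fejer_kernel, of N "x - y" k] by (simp add: algebra_simps)
        then show "ennreal (fejer_kernel N (x - (y + ivec k)) * (f (y + ivec k))\<^sup>2) = ennreal (fejer_kernel N (x - y) * (f y)\<^sup>2)"
          by (simp add: torus_periodic_ivec[OF per])
      qed
    qed auto
    also have "\<dots> = (\<integral>\<^sup>+z. ?K z * ennreal ((f (x - z))\<^sup>2) \<partial>?X)"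
      by (simp add: ennreal_mult K0)
    finally show ?thesis .
  qed
  have [measurable]: "(\<lambda>x. f (fst x - snd x)) \<in> borel_measurable (?X \<Otimes>\<^sub>M ?X)" by measurable
  have "(\<integral>\<^sup>+x. ennreal ((fejer_mean N f x)\<^sup>2) * g x \<partial>?X)
      \<le> (\<integral>\<^sup>+x. (\<integral>\<^sup>+z. ?K z * ennreal ((f (x - z))\<^sup>2) \<partial>?X) * g x \<partial>?X)"
    by (intro nn_integral_mono mult_right_mono pt) simp
  also have "\<dots> = (\<integral>\<^sup>+x. (\<integral>\<^sup>+z. ?K z * ennreal ((f (x - z))\<^sup>2) * g x \<partial>?X) \<partial>?X)"
    by (intro nn_integral_cong nn_integral_multc[symmetric]) measurable
  also have "\<dots> = (\<integral>\<^sup>+z. (\<integral>\<^sup>+x. ?K z * ennreal ((f (x - z))\<^sup>2) * g x \<partial>?X) \<partial>?X)"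
    by (rule XX.Fubini') measurable
  also have "\<dots> = (\<integral>\<^sup>+z. ?K z * (\<integral>\<^sup>+x. ennreal ((f (x - z))\<^sup>2) * g x \<partial>?X) \<partial>?X)"
    unfolding mult.assoc by (intro nn_integral_cong nn_integral_cmult) measurable
  also have "\<dots> \<le> (\<integral>\<^sup>+z. ?K z * C \<partial>?X)"
    by (intro nn_integral_mono mult_left_mono bound) simp
  also have "\<dots> = (\<integral>\<^sup>+z. ?K z \<partial>?X) * C"
    by (rule nn_integral_multc) measurable
  also have "(\<integral>\<^sup>+z. ?K z \<partial>?X) = 1"
  proof -
    have "(\<integral>\<^sup>+y. ?K (0 + (- 1) *\<^sub>R y) \<partial>?X) = (\<integral>\<^sup>+z. ?K z \<partial>?X)"
      by (rule nn_integral_torus_affine)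
        (auto intro!: torus_periodicI simp: torus_periodic_ivec[OF torus_periodic_fejer_kernel])
    moreover have "(\<integral>\<^sup>+y. ?K (0 - y) \<partial>?X) = ennreal (LINT y|?X. fejer_kernel N (0 - y))"
    proof (rule nn_integral_eq_integral)
      obtain B where B: "\<And>z. \<bar>fejer_kernel N (z :: real^'n)\<bar> \<le> B" using fejer_kernel_bounded by blast
      show "integrable ?X (\<lambda>y. fejer_kernel N (0 - y))"
        by (rule integrable_torus_bounded[OF _ B]) measurable
    qed (simp add: K0)
    ultimately show ?thesis using integral_fejer_kernel[OF N, of 0] by simp
  qed
  finally show ?thesis by simp
qed

section \<open>Mode-wise energy balance\<close>

text \<open>If f is not integrable, its integral is 0 by convention and is dominated because g is
  nonnegative. This saves integrability proofs for the smaller function.\<close>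

lemma integral_mono_nonneg_bound:
  fixes f g :: "'a \<Rightarrow> real"
  assumes "integrable M g" "\<And>x. x \<in> space M \<Longrightarrow> 0 \<le> g x" "\<And>x. x \<in> space M \<Longrightarrow> f x \<le> g x"
  shows "(LINT x|M. f x) \<le> (LINT x|M. g x)"
  by (rule integral_mono'[OF assms(1)]) (use assms in auto)

lemma abs_two_mult_le: "\<bar>2 * x * y\<bar> \<le> x\<^sup>2 + y\<^sup>2" for x y :: real
  using zero_le_power2[of "x + y"] zero_le_power2[of "x - y"]
  unfolding power2_sum power2_diff abs_le_iff by linarith

text \<open>By Tonelli, a bound on finite sums that is uniform in S bounds the double integral. It
  later licenses the exchange of the sum over modes with the time integral.\<close>

lemma integrable_count_pair:
  fixes q :: "'k::countable \<Rightarrow> 'a \<Rightarrow> real"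
  assumes M: "sigma_finite_measure M"
    and int: "\<And>k. integrable M (q k)" and pos: "\<And>k t. 0 \<le> q k t"
    and bound: "\<And>S. finite S \<Longrightarrow> (\<Sum>k\<in>S. (LINT t|M. q k t)) \<le> C"
  shows "integrable (count_space UNIV \<Otimes>\<^sub>M M) (\<lambda>(k, t). q k t)"
proof -
  interpret M: sigma_finite_measure M by (rule M)
  have meas: "(\<lambda>(k, t). q k t) \<in> borel_measurable (count_space UNIV \<Otimes>\<^sub>M M)"
    using int by (intro measurable_pair_measure_countable1) auto
  have "(\<integral>\<^sup>+p. ennreal (norm (case p of (k, t) \<Rightarrow> q k t)) \<partial>(count_space UNIV \<Otimes>\<^sub>M M))
      = (\<integral>\<^sup>+k. \<integral>\<^sup>+t. ennreal (q k t) \<partial>M \<partial>count_space UNIV)"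
    using meas pos by (subst M.nn_integral_fst[symmetric]) auto
  also have "\<dots> = (\<integral>\<^sup>+k. ennreal (LINT t|M. q k t) \<partial>count_space UNIV)"
    using int pos by (intro nn_integral_cong nn_integral_eq_integral) auto
  also have "\<dots> \<le> ennreal C"
  proof (rule nn_integral_count_le)
    fix S :: "'k set" assume "finite S"
    then show "(\<Sum>k\<in>S. ennreal (LINT t|M. q k t)) \<le> ennreal C"
      using bound[of S] pos by (subst sum_ennreal) (auto intro!: ennreal_leI Bochner_Integration.integral_nonneg)
  qed
  also have "\<dots> < \<infinity>" by simp
  finally show ?thesis using meas by (simp add: integrable_iff_bounded)
qed

lemma nth_measurable [measurable (raw)]:
  fixes f :: "'b \<Rightarrow> real^'n"
  shows "f \<in> borel_measurable M \<Longrightarrow> (\<lambda>x. f x $ j) \<in> borel_measurable M"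
  by (rule measurable_compose[of f M borel]) (auto intro!: borel_measurable_continuous_onI continuous_intros)

lemma norm_vec_square: "(norm (v :: real^'n))\<^sup>2 = (\<Sum>j\<in>UNIV. (v $ j)\<^sup>2)"
  unfolding power2_norm_eq_inner inner_vec_def by (simp add: power2_eq_square)

text \<open>The problem after reduction. Slice conditions hold at every time because U and V are
  Borel versions of u and b made zero on a null set of times. \<open>UV_bound\<close> is the Hoelder
  bound on the product, uniform over the translates of U so that Fejer means inherit it, with n as
  majorant in time. \<open>div_free\<close> and \<open>equation\<close> are what remains of the two
  distributional conditions after testing in space with products of two basis functions and with
  single basis functions.\<close>

locale advection_core =
  fixes T :: real and U :: "real \<Rightarrow> real^'n \<Rightarrow> real" and V :: "real \<Rightarrow> real^'n \<Rightarrow> real^'n"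
    and u0 :: "real^'n \<Rightarrow> real" and C :: real and n :: "real \<Rightarrow> real"
  assumes T_pos: "0 < T"
    and U_meas: "(\<lambda>p. U (fst p) (snd p)) \<in> borel_measurable borel"
    and V_meas: "(\<lambda>p. V (fst p) (snd p)) \<in> borel_measurable borel"
    and U_per: "torus_periodic (U t)"
    and U_sq [simp]: "square_integrable torus (U t)"
    and U_bound: "(LINT x|torus. (U t x)\<^sup>2) \<le> C"
    and V_sq: "(\<integral>\<^sup>+x. ennreal ((norm (V t x))\<^sup>2) \<partial>torus) < \<infinity>"
    and V_total: "(\<integral>\<^sup>+t. \<integral>\<^sup>+x. ennreal ((norm (V t x))\<^sup>2) \<partial>torus \<partial>lebesgue_on {0..T}) < \<infinity>"
    and UV_bound: "(\<integral>\<^sup>+x. ennreal ((U t (x - z))\<^sup>2) * ennreal ((norm (V t x))\<^sup>2) \<partial>torus) \<le> ennreal (n t)"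
    and n_total: "(\<integral>\<^sup>+t. ennreal (n t) \<partial>lebesgue_on {0..T}) < \<infinity>"
    and u0_sq: "square_integrable torus u0"
    and div_free: "(LINT x|torus. V t x \<bullet> grad (\<lambda>x. hartley k x * hartley l x) x) = 0"
    and equation: "smooth \<eta> \<Longrightarrow> \<exists>c<T. \<forall>t\<ge>c. \<eta> t = 0 \<Longrightarrow>
      (LINT t|lebesgue_on {0..T}. torus.coef (U t) k * deriv \<eta> t
        + ((LINT x|torus. U t x * (V t x \<bullet> grad (hartley k) x)) - freq k * torus.coef (U t) k) * \<eta> t)
      + torus.coef u0 k * \<eta> 0 = 0"
begin

abbreviation I :: "real measure" where "I \<equiv> lebesgue_on {0..T}"
abbreviation X :: "(real^'n) measure" where "X \<equiv> torus"
abbreviation K :: "(int^'n) measure" where "K \<equiv> count_space UNIV"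

sublocale I: finite_measure I by (rule finite_measure_time)
sublocale X: finite_measure X by (rule finite_measure_torus)
sublocale K: sigma_finite_measure K by (rule sigma_finite_measure_count_space)
sublocale IX: pair_sigma_finite I X ..
sublocale KI: pair_sigma_finite K I ..
sublocale P: finite_measure "I \<Otimes>\<^sub>M X" by (rule finite_measure_pair_measure) unfold_locales

lemma U_measurable [measurable (raw)]:
  "f \<in> borel_measurable M \<Longrightarrow> g \<in> borel_measurable M \<Longrightarrow> (\<lambda>x. U (f x) (g x)) \<in> borel_measurable M"
  using measurable_compose[OF borel_measurable_Pair U_meas] by simp

lemma V_measurable [measurable (raw)]:
  "f \<in> borel_measurable M \<Longrightarrow> g \<in> borel_measurable M \<Longrightarrow> (\<lambda>x. V (f x) (g x)) \<in> borel_measurable M"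
  using measurable_compose[OF borel_measurable_Pair V_meas] by simp

definition a :: "int^'n \<Rightarrow> real \<Rightarrow> real" where
  "a k t = torus.coef (U t) k"

definition W :: "'n \<Rightarrow> real \<Rightarrow> real^'n \<Rightarrow> real" where
  "W j t x = U t x * V t x $ j"

text \<open>The transport source in mode k. As \<open>grad (hartley k)\<close> involves
  \<open>hartley (- k)\<close>, it is a combination of flux coefficients at -k, which explains the
  signs in \<open>F_eq\<close> and \<open>b2\<close>.\<close>

definition F :: "int^'n \<Rightarrow> real \<Rightarrow> real" where
  "F k t = (LINT x|X. U t x * (V t x \<bullet> grad (hartley k) x))"

definition \<beta> :: "'n \<Rightarrow> int^'n \<Rightarrow> real \<Rightarrow> real" where
  "\<beta> j k t = torus.coef (W j t) k"

definition w :: "real \<Rightarrow> real" where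
  "w t = (LINT x|X. (U t x)\<^sup>2 * (norm (V t x))\<^sup>2)"

lemma W_measurable [measurable (raw)]:
  "f \<in> borel_measurable M \<Longrightarrow> g \<in> borel_measurable M \<Longrightarrow> (\<lambda>x. W j (f x) (g x)) \<in> borel_measurable M"
  unfolding W_def by (intro borel_measurable_times U_measurable nth_measurable V_measurable)

lemmas [measurable] = measurable_id_lebesgue_on[of "{0..T}"] measurable_id_lebesgue_on[of "cbox 0 (1::real^'n)"]

lemma a_measurable [measurable]: "a k \<in> borel_measurable borel"
  unfolding a_def torus.coef_def by measurable

lemma \<beta>_measurable [measurable]: "\<beta> j k \<in> borel_measurable borel"
  unfolding \<beta>_def torus.coef_def by measurable

lemma w_measurable [measurable]: "w \<in> borel_measurable borel"
  unfolding w_def by measurable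

lemma UV_le_n: "(\<integral>\<^sup>+x. ennreal ((U t x)\<^sup>2 * (norm (V t x))\<^sup>2) \<partial>X) \<le> ennreal (n t)"
  using UV_bound[of t 0] by (simp add: ennreal_mult)

lemma UV_integrable: "integrable X (\<lambda>x. (U t x)\<^sup>2 * (norm (V t x))\<^sup>2)"
  using le_less_trans[OF UV_le_n ennreal_less_top] by (simp add: integrable_iff_bounded)

lemma w_nonneg: "0 \<le> w t"
  unfolding w_def by (rule Bochner_Integration.integral_nonneg) simp

lemma w_le_n: "ennreal (w t) \<le> ennreal (n t)"
  unfolding w_def using UV_le_n[of t]
  by (subst (asm) nn_integral_eq_integral[OF UV_integrable]) auto

lemma w_integrable: "integrable I w"
proof (rule integrableI_bounded)
  show "w \<in> borel_measurable I" by measurable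
  have "(\<integral>\<^sup>+t. ennreal (norm (w t)) \<partial>I) \<le> (\<integral>\<^sup>+t. ennreal (n t) \<partial>I)"
    using w_le_n w_nonneg by (intro nn_integral_mono) simp
  then show "(\<integral>\<^sup>+t. ennreal (norm (w t)) \<partial>I) < \<infinity>" using n_total by (rule le_less_trans)
qed

lemma W_square_le: "(W j t x)\<^sup>2 \<le> (U t x)\<^sup>2 * (norm (V t x))\<^sup>2"
  unfolding W_def power_mult_distrib norm_vec_square
  by (intro mult_left_mono member_le_sum) auto

lemma W_sq [simp]: "square_integrable X (W j t)"
  unfolding square_integrable_def
proof
  show "W j t \<in> borel_measurable X" by measurable
  then show "integrable X (\<lambda>x. (W j t x)\<^sup>2)"
    by (intro Bochner_Integration.integrable_bound[OF UV_integrable[of t]]) (use W_square_le in auto)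
qed

lemma sum_W: "(\<Sum>j\<in>UNIV. (LINT x|X. (W j t x)\<^sup>2)) = w t"
proof -
  have "(\<Sum>j\<in>UNIV. (LINT x|X. (W j t x)\<^sup>2)) = (LINT x|X. (\<Sum>j\<in>UNIV. (W j t x)\<^sup>2))"
    by (rule Bochner_Integration.integral_sum[symmetric]) (rule square_integrable_square[OF W_sq])
  also have "\<dots> = w t"
    by (simp add: w_def W_def power_mult_distrib norm_vec_square sum_distrib_left)
  finally show ?thesis .
qed

lemma grad_hartley: "grad (hartley k) x = (\<chi> j. 2 * pi * real_of_int (k $ j) * hartley (- k) x)"
  by (simp add: grad_def partial_hartley)

lemma F_eq: "F k t = (\<Sum>j\<in>UNIV. 2 * pi * real_of_int (k $ j) * \<beta> j (- k) t)"
proof -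
  have "F k t = (LINT x|X. (\<Sum>j\<in>UNIV. 2 * pi * real_of_int (k $ j) * (W j t x * hartley (- k) x)))"
    unfolding F_def grad_hartley
    by (simp add: inner_vec_def sum_distrib_left W_def mult_ac)
  also have "\<dots> = (\<Sum>j\<in>UNIV. 2 * pi * real_of_int (k $ j) * \<beta> j (- k) t)"
    by (subst Bochner_Integration.integral_sum)
      (auto simp: \<beta>_def torus.coef_def intro!: integrable_mult_right square_integrable_mult)
  finally show ?thesis .
qed

lemma F_measurable [measurable]: "F k \<in> borel_measurable borel"
  unfolding F_eq[abs_def] by measurable

lemma C_nonneg: "0 \<le> C"
  by (rule order_trans[OF _ U_bound[of 0]]) simp

lemma a_square_le: "(a k t)\<^sup>2 \<le> C"
  using torus.coef_square_le[OF U_sq] U_bound order_trans unfolding a_def by blast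

lemma a_bounded: "\<bar>a k t\<bar> \<le> sqrt C"
  using a_square_le[of k t] real_le_rsqrt[of "\<bar>a k t\<bar>"] by simp

lemma a_sq: "square_integrable I (a k)"
  by (rule I.square_integrable_bounded[of _ "sqrt C"]) (use a_bounded in auto)

lemma \<beta>_square_le: "(\<beta> j k t)\<^sup>2 \<le> w t"
proof -
  have "(\<beta> j k t)\<^sup>2 \<le> (LINT x|X. (W j t x)\<^sup>2)"
    unfolding \<beta>_def by (rule torus.coef_square_le[OF W_sq])
  also have "\<dots> \<le> w t"
    unfolding sum_W[symmetric] by (rule member_le_sum) auto
  finally show ?thesis .
qed

lemma \<beta>_sq: "square_integrable I (\<beta> j k)"
  unfolding square_integrable_def
  by (auto intro!: Bochner_Integration.integrable_bound[OF w_integrable]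
      simp: \<beta>_square_le w_nonneg)

lemma F_sq: "square_integrable I (F k)"
  unfolding F_eq[abs_def] by (intro square_integrable_sum square_integrable_cmult \<beta>_sq)

text \<open>The part of Young's inequality for \<open>a k t * F k t\<close> that carries the flux;
  over any finite set of modes it sums to at most \<open>w t\<close>.\<close>

definition b2 :: "int^'n \<Rightarrow> real \<Rightarrow> real" where
  "b2 k t = (\<Sum>j\<in>UNIV. (\<beta> j (- k) t)\<^sup>2)"

lemma b2_nonneg [simp]: "0 \<le> b2 k t"
  by (simp add: b2_def sum_nonneg)

lemma b2_integrable: "integrable I (b2 k)"
  unfolding b2_def[abs_def] by (intro Bochner_Integration.integrable_sum square_integrable_square \<beta>_sq)

lemma sum_b2_le:
  assumes "finite S"
  shows "(\<Sum>k\<in>S. b2 k t) \<le> w t"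
proof -
  have "(\<Sum>k\<in>S. b2 k t) = (\<Sum>j\<in>UNIV. \<Sum>k\<in>S. (\<beta> j (- k) t)\<^sup>2)"
    unfolding b2_def by (rule sum.swap)
  also have "\<dots> = (\<Sum>j\<in>UNIV. \<Sum>k\<in>uminus ` S. (torus.coef (W j t) k)\<^sup>2)"
    by (simp add: sum.reindex \<beta>_def)
  also have "\<dots> \<le> (\<Sum>j\<in>UNIV. (LINT x|X. (W j t x)\<^sup>2))"
    using assms by (intro sum_mono torus.Bessel_finite) auto
  finally show ?thesis by (simp add: sum_W)
qed

text \<open>Young's inequality in each coordinate. The energy law of a mode dissipates 2 * freq k *
  (a k t)^2, so transport costs half of the dissipation plus a share of the flux.\<close>

lemma aF_bound: "\<bar>2 * (a k t * F k t)\<bar> \<le> freq k * (a k t)\<^sup>2 + b2 k t"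
proof -
  have "2 * (a k t * F k t) = (\<Sum>j\<in>UNIV. 2 * (2 * pi * real_of_int (k $ j) * a k t) * \<beta> j (- k) t)"
    by (simp add: F_eq sum_distrib_left mult_ac)
  also have "\<bar>\<dots>\<bar> \<le> (\<Sum>j\<in>UNIV. \<bar>2 * (2 * pi * real_of_int (k $ j) * a k t) * \<beta> j (- k) t\<bar>)"
    by (rule sum_abs)
  also have "\<dots> \<le> (\<Sum>j\<in>UNIV. (2 * pi * real_of_int (k $ j) * a k t)\<^sup>2 + (\<beta> j (- k) t)\<^sup>2)"
  proof (rule sum_mono)
    fix j
    show "\<bar>2 * (2 * pi * real_of_int (k $ j) * a k t) * \<beta> j (- k) t\<bar> \<le> (2 * pi * real_of_int (k $ j) * a k t)\<^sup>2 + (\<beta> j (- k) t)\<^sup>2"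
      by (rule abs_two_mult_le)
  qed
  also have "\<dots> = freq k * (a k t)\<^sup>2 + b2 k t"
    by (simp add: sum.distrib b2_def freq_def power_mult_distrib sum_distrib_right)
  finally show ?thesis .
qed

definition g :: "int^'n \<Rightarrow> real \<Rightarrow> real" where
  "g k t = F k t - freq k * a k t"

lemma g_sq: "square_integrable I (g k)"
  unfolding g_def[abs_def] by (intro square_integrable_diff square_integrable_cmult F_sq a_sq)

text \<open>The integrated mode equation gives a version of \<open>a k\<close> that is defined at
  every time and continuous; its value at T is the one that the energy balance refers to.\<close>

definition A :: "int^'n \<Rightarrow> real \<Rightarrow> real" where
  "A k t = torus.coef u0 k + (LINT s|I. indicator {..t} s * g k s)"

lemma AE_a_eq_A: "AE t in I. a k t = A k t"
  unfolding A_def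
proof (rule weak_ODE[OF T_pos])
  show "integrable I (a k)" "integrable I (g k)"
    by (intro I.square_integrable_integrable a_sq g_sq)+
  show "(LINT t|I. a k t * deriv \<eta> t + g k t * \<eta> t) + torus.coef u0 k * \<eta> 0 = 0"
    if "smooth \<eta>" "\<exists>c<T. \<forall>t\<ge>c. \<eta> t = 0" for \<eta>
    using equation[OF that, of k] by (simp add: a_def g_def F_def)
qed

text \<open>In \<open>square_primitive\<close> the primitive may be replaced almost everywhere by a
  minus the initial coefficient. On expanding the square of A, the cross terms with that coefficient
  cancel.\<close>

lemma A_energy: "(A k t)\<^sup>2 = (torus.coef u0 k)\<^sup>2 + 2 * (LINT s|I. indicator {..t} s * (a k s * g k s))"
proof -
  let ?c = "torus.coef u0 k" and ?P = "\<lambda>t. LINT s|I. indicator {..t} s * g k s"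
  have gi: "integrable I (g k)" by (rule I.square_integrable_integrable[OF g_sq])
  have [measurable]: "g k \<in> borel_measurable I" using g_sq by auto
  have ag: "integrable I (\<lambda>s. indicator {..t} s * (a k s * g k s))"
    by (rule integrable_indicator_mult_lebesgue_on[OF square_integrable_mult[OF a_sq g_sq]]) simp
  have cg: "integrable I (\<lambda>s. ?c * (indicator {..t} s * g k s))"
    by (intro integrable_mult_right integrable_indicator_mult_lebesgue_on[OF gi]) simp
  have ae: "AE s in I. indicator {..t} s * (a k s * g k s) - ?c * (indicator {..t} s * g k s) = indicator {..t} s * (?P s * g k s)"
    using AE_a_eq_A[of k] by eventually_elim (simp add: A_def algebra_simps)
  have Pm: "(\<lambda>s. indicator {..t} s * (?P s * g k s)) \<in> borel_measurable I"
  proof -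
    have "(\<lambda>p. if snd p \<le> fst p then g k (snd p) else 0) \<in> borel_measurable (I \<Otimes>\<^sub>M I)" by measurable
    then have "(\<lambda>(s, r). indicator {..s} r * g k r) \<in> borel_measurable (I \<Otimes>\<^sub>M I)"
      by (rule measurable_cong[THEN iffD1, rotated]) (auto simp: indicator_def)
    then have [measurable]: "?P \<in> borel_measurable I" by (rule I.borel_measurable_lebesgue_integral)
    show ?thesis by measurable
  qed
  have "(LINT s|I. indicator {..t} s * (?P s * g k s))
      = (LINT s|I. indicator {..t} s * (a k s * g k s) - ?c * (indicator {..t} s * g k s))"
    by (rule integral_cong_AE[OF Pm]) (use ae in \<open>auto elim: eventually_mono\<close>)
  also have "\<dots> = (LINT s|I. indicator {..t} s * (a k s * g k s)) - ?c * ?P t"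
    using ag cg by simp
  finally have "(?P t)\<^sup>2 = 2 * ((LINT s|I. indicator {..t} s * (a k s * g k s)) - ?c * ?P t)"
    using square_primitive[OF gi, of t] by simp
  then show ?thesis by (simp add: A_def power2_sum algebra_simps)
qed

lemma a_freq_integrable: "integrable I (\<lambda>t. freq k * (a k t)\<^sup>2)"
  using square_integrable_square[OF a_sq] by simp

lemma A_bound: "(A k t)\<^sup>2 + (LINT s|I. indicator {..t} s * (freq k * (a k s)\<^sup>2)) \<le> (torus.coef u0 k)\<^sup>2 + (LINT s|I. b2 k s)"
proof -
  have i1: "integrable I (\<lambda>s. indicator {..t} s * (a k s * g k s))"
    by (rule integrable_indicator_mult_lebesgue_on[OF square_integrable_mult[OF a_sq g_sq]]) simp
  have i2: "integrable I (\<lambda>s. indicator {..t} s * (freq k * (a k s)\<^sup>2))"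
    by (rule integrable_indicator_mult_lebesgue_on[OF a_freq_integrable]) simp
  have "2 * (LINT s|I. indicator {..t} s * (a k s * g k s)) + (LINT s|I. indicator {..t} s * (freq k * (a k s)\<^sup>2))
     = (LINT s|I. 2 * (indicator {..t} s * (a k s * g k s)) + indicator {..t} s * (freq k * (a k s)\<^sup>2))"
    using i1 i2 by simp
  also have "\<dots> \<le> (LINT s|I. b2 k s)"
  proof (rule integral_mono_nonneg_bound[OF b2_integrable])
    fix s
    show "2 * (indicator {..t} s * (a k s * g k s)) + indicator {..t} s * (freq k * (a k s)\<^sup>2) \<le> b2 k s"
      using abs_le_D1[OF aF_bound[of k s]] by (simp add: indicator_def g_def power2_eq_square algebra_simps)
  qed simp
  finally show ?thesis by (simp add: A_energy)
qed

text \<open>A preliminary energy bound in which the flux counts as an external source; it makes the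
  sums over modes converge before the cancellation is available.\<close>

definition E0 :: real where
  "E0 = (LINT x|X. (u0 x)\<^sup>2) + (LINT t|I. w t)"

lemma sum_bound:
  assumes S: "finite S"
  shows "(\<Sum>k\<in>S. (torus.coef u0 k)\<^sup>2 + (LINT s|I. b2 k s)) \<le> E0"
proof -
  have "(\<Sum>k\<in>S. (LINT s|I. b2 k s)) = (LINT s|I. (\<Sum>k\<in>S. b2 k s))"
    by (rule Bochner_Integration.integral_sum[symmetric]) (rule b2_integrable)
  also have "\<dots> \<le> (LINT s|I. w s)"
    by (rule integral_mono_nonneg_bound[OF w_integrable]) (auto simp: w_nonneg sum_b2_le[OF S])
  finally show ?thesis using torus.Bessel_finite[OF u0_sq S] by (simp add: sum.distrib E0_def)
qed

lemma sum_A_le: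
  assumes S: "finite S"
  shows "(\<Sum>k\<in>S. (A k t)\<^sup>2) \<le> E0"
proof -
  have "(\<Sum>k\<in>S. (A k t)\<^sup>2) \<le> (\<Sum>k\<in>S. (torus.coef u0 k)\<^sup>2 + (LINT s|I. b2 k s))"
  proof (rule sum_mono)
    fix k
    have "0 \<le> (LINT s|I. indicator {..t} s * (freq k * (a k s)\<^sup>2))" by (rule Bochner_Integration.integral_nonneg) simp
    then show "(A k t)\<^sup>2 \<le> (torus.coef u0 k)\<^sup>2 + (LINT s|I. b2 k s)" using A_bound[of k t] by linarith
  qed
  also have "\<dots> \<le> E0" by (rule sum_bound[OF S])
  finally show ?thesis .
qed

lemma integral_indicator_atMost_T: "(LINT s|I. indicator {..T} s * f s) = (LINT s|I. f s)" for f :: "real \<Rightarrow> real"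
  by (rule Bochner_Integration.integral_cong) auto

lemma sum_freq_a_le:
  assumes S: "finite S"
  shows "(\<Sum>k\<in>S. (LINT s|I. freq k * (a k s)\<^sup>2)) \<le> E0"
proof -
  have "(\<Sum>k\<in>S. (LINT s|I. freq k * (a k s)\<^sup>2)) \<le> (\<Sum>k\<in>S. (torus.coef u0 k)\<^sup>2 + (LINT s|I. b2 k s))"
  proof (rule sum_mono)
    fix k
    show "(LINT s|I. freq k * (a k s)\<^sup>2) \<le> (torus.coef u0 k)\<^sup>2 + (LINT s|I. b2 k s)"
      using A_bound[of k T] by (simp add: integral_indicator_atMost_T) (smt (verit) zero_le_power2)
  qed
  also have "\<dots> \<le> E0" by (rule sum_bound[OF S])
  finally show ?thesis .
qed

lemma A_square_summable: "square_integrable K (\<lambda>k. A k t)" "(LINT k|K. (A k t)\<^sup>2) \<le> E0"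
  using square_summableI[OF sum_A_le] by auto

lemma freq_a_pair: "integrable (K \<Otimes>\<^sub>M I) (\<lambda>(k, t). freq k * (a k t)\<^sup>2)"
  by (rule integrable_count_pair[OF I.sigma_finite_measure_axioms a_freq_integrable _ sum_freq_a_le]) auto

lemma b2_pair: "integrable (K \<Otimes>\<^sub>M I) (\<lambda>(k, t). b2 k t)"
proof (rule integrable_count_pair[OF I.sigma_finite_measure_axioms b2_integrable])
  show "(\<Sum>k\<in>S. (LINT s|I. b2 k s)) \<le> E0" if "finite S" for S
    using sum_bound[OF that] sum_nonneg[of S "\<lambda>k. (torus.coef u0 k)\<^sup>2"] by (simp add: sum.distrib)
qed simp

lemma aF_pair: "integrable (K \<Otimes>\<^sub>M I) (\<lambda>(k, t). a k t * F k t)"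
proof (rule Bochner_Integration.integrable_bound)
  show "integrable (K \<Otimes>\<^sub>M I) (\<lambda>p. (case p of (k, t) \<Rightarrow> freq k * (a k t)\<^sup>2) + (case p of (k, t) \<Rightarrow> b2 k t))"
    by (rule Bochner_Integration.integrable_add[OF freq_a_pair b2_pair])
  show "(\<lambda>(k, t). a k t * F k t) \<in> borel_measurable (K \<Otimes>\<^sub>M I)"
    by (rule measurable_pair_measure_countable1) auto
  have "\<bar>a k t * F k t\<bar> \<le> \<bar>freq k * (a k t)\<^sup>2 + b2 k t\<bar>" for k t
    using aF_bound[of k t] by linarith
  then show "AE p in K \<Otimes>\<^sub>M I. norm (case p of (k, t) \<Rightarrow> a k t * F k t)
      \<le> norm ((case p of (k, t) \<Rightarrow> freq k * (a k t)\<^sup>2) + (case p of (k, t) \<Rightarrow> b2 k t))"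
    by (auto simp: split_beta)
qed

lemma A_continuous: "continuous_on {0..T} (A k)"
proof -
  have gi: "integrable I (g k)" by (rule I.square_integrable_integrable[OF g_sq])
  have hk: "g k integrable_on {0..T}" using gi by (rule integrable_on_lebesgue_on) simp
  have eq: "A k t = torus.coef u0 k + integral {0..t} (g k)" if "t \<in> {0..T}" for t
  proof -
    have "(LINT s|I. indicator {..t} s * g k s) = integral {0..T} (\<lambda>s. indicator {..t} s * g k s)"
      by (rule lebesgue_integral_eq_integral)
        (use integrable_indicator_mult_lebesgue_on[OF gi, of "{..t}"] in auto)
    also have "\<dots> = integral {0..T} (\<lambda>s. if s \<in> {0..t} then g k s else 0)"
      by (rule Henstock_Kurzweil_Integration.integral_cong) auto
    also have "\<dots> = integral ({0..t} \<inter> {0..T}) (g k)"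
      by (rule integral_restrict_Int)
    also have "{0..t} \<inter> {0..T} = {0..t}" using that by auto
    finally show ?thesis by (simp add: A_def)
  qed
  have "continuous_on {0..T} (\<lambda>t. torus.coef u0 k + integral {0..t} (g k))"
    by (intro continuous_intros indefinite_integral_continuous_1 hk)
  then show ?thesis by (rule continuous_on_eq) (simp add: eq)
qed

text \<open>The mode balances at time T, summed. The double integrals are stated over the product
  measure so that they can later be evaluated in either order.\<close>

lemma energy_with_transport:
  "(LINT k|K. (A k T)\<^sup>2) + 2 * integral\<^sup>L (K \<Otimes>\<^sub>M I) (\<lambda>(k, t). freq k * (a k t)\<^sup>2)
    = (LINT x|X. (u0 x)\<^sup>2) + 2 * integral\<^sup>L (K \<Otimes>\<^sub>M I) (\<lambda>(k, t). a k t * F k t)"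
proof -
  have mode: "(A k T)\<^sup>2 + 2 * (LINT t|I. freq k * (a k t)\<^sup>2)
      = (torus.coef u0 k)\<^sup>2 + 2 * (LINT t|I. a k t * F k t)" for k
  proof -
    have "(LINT t|I. a k t * g k t) = (LINT t|I. a k t * F k t - freq k * (a k t)\<^sup>2)"
      by (simp add: g_def right_diff_distrib power2_eq_square mult_ac)
    then show ?thesis
      using a_freq_integrable[of k] square_integrable_mult[OF a_sq F_sq, of k]
      by (simp add: A_energy integral_indicator_atMost_T)
  qed
  have i1: "integrable K (\<lambda>k. LINT t|I. freq k * (a k t)\<^sup>2)"
    using KI.integrable_fst'[OF freq_a_pair] by simp
  have i2: "integrable K (\<lambda>k. LINT t|I. a k t * F k t)"
    using KI.integrable_fst'[OF aF_pair] by simp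
  have i3: "integrable K (\<lambda>k. (A k T)\<^sup>2)" "integrable K (\<lambda>k. (torus.coef u0 k)\<^sup>2)"
    using A_square_summable(1) torus.square_summable_coef(1)[OF u0_sq] by (auto simp: square_integrable_def)
  have "(LINT k|K. (A k T)\<^sup>2) + 2 * (LINT k|K. LINT t|I. freq k * (a k t)\<^sup>2)
      = (LINT k|K. (A k T)\<^sup>2 + 2 * (LINT t|I. freq k * (a k t)\<^sup>2))"
    by (subst Bochner_Integration.integral_add[OF i3(1) integrable_mult_right[OF i1]])
      (simp only: integral_mult_right_zero)
  also have "\<dots> = (LINT k|K. (torus.coef u0 k)\<^sup>2 + 2 * (LINT t|I. a k t * F k t))"
    by (simp only: mode)
  also have "\<dots> = (LINT k|K. (torus.coef u0 k)\<^sup>2) + 2 * (LINT k|K. LINT t|I. a k t * F k t)"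
    by (subst Bochner_Integration.integral_add[OF i3(2) integrable_mult_right[OF i2]])
      (simp only: integral_mult_right_zero)
  finally show ?thesis
    using KI.integral_fst'[OF freq_a_pair] KI.integral_fst'[OF aF_pair]
    by (simp only: torus.Parseval_square[OF u0_sq] prod.case)
qed

end

text \<open>Composition with \<open>vfrac\<close> makes a Borel version periodic and leaves it
  unchanged on the half-open cube, hence almost everywhere on the torus.\<close>

lemma periodic_borel_version:
  fixes f :: "real^'n \<Rightarrow> 'b::euclidean_space"
  assumes "f \<in> borel_measurable torus"
  obtains g where "g \<in> borel_measurable borel" "torus_periodic g" "AE x in torus. f x = g x"
proof -
  obtain g0 where g0 [measurable]: "g0 \<in> borel_measurable borel" and ae: "AE x in torus. f x = g0 x"
    using lebesgue_on_borel_version[OF assms] by auto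
  have "AE x in torus. x \<in> (unit_cube :: (real^'n) set)"
    using AE_unit_cube by (auto simp: AE_lebesgue_on_iff elim: eventually_mono)
  with ae have "AE x in torus. f x = g0 (vfrac x)"
    by eventually_elim (simp add: vfrac_id)
  moreover have "torus_periodic (\<lambda>x::real^'n. g0 (vfrac x))" by (rule torus_periodicI) simp
  ultimately show ?thesis using that[of "\<lambda>x. g0 (vfrac x)"] by simp
qed

lemma fejer_mult_outside: "m \<notin> fejer_supp N \<Longrightarrow> fejer_mult N m = 0"
proof -
  assume m: "m \<notin> fejer_supp N"
  have "{k \<in> fejer_box N. k - m \<in> fejer_box N} = {}"
  proof -
    have False if "k \<in> fejer_box N" "k - m \<in> fejer_box N" for k
    proof -
      have "m = k - (k - m)" by simp
      then have "m \<in> fejer_supp N" unfolding fejer_supp_def using that by force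
      with m show False by simp
    qed
    then show ?thesis by auto
  qed
  then show ?thesis by (simp only: fejer_mult_def) simp
qed

lemma square_integral_hartley_minus:
  assumes "finite B"
  shows "(LINT x|torus. (\<Sum>k\<in>B. c k * hartley (- k) x)\<^sup>2) = (\<Sum>k\<in>B. (c k)\<^sup>2)"
proof -
  have "(\<Sum>k\<in>B. c k * hartley (- k) x) = (\<Sum>k\<in>uminus ` B. c (- k) * hartley k x)" for x
    by (simp add: sum.reindex)
  moreover have "(\<Sum>k\<in>uminus ` B. (c (- k))\<^sup>2) = (\<Sum>k\<in>B. (c k)\<^sup>2)"
    by (simp add: sum.reindex)
  ultimately show ?thesis
    using torus.square_integral_comb[of "uminus ` B" "\<lambda>k. c (- k)"] assms by simp
qed

text \<open>A double limit: N to infinity at fixed M removes \<open>x M N\<close> and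
  \<open>e N\<close>, then M to infinity removes \<open>e M\<close>.\<close>

lemma LIMSEQ_zero_by_approximation:
  fixes z e :: "nat \<Rightarrow> real" and x :: "nat \<Rightarrow> nat \<Rightarrow> real"
  assumes z: "z \<longlonglongrightarrow> L" and e: "e \<longlonglongrightarrow> 0" and x: "\<And>M. x M \<longlonglongrightarrow> 0"
    and bound: "\<And>M N. 0 < N \<Longrightarrow> \<bar>z N\<bar> \<le> x M N + c * sqrt (k * (2 * e N + 2 * e M))"
  shows "L = 0"
proof -
  have "\<bar>L\<bar> \<le> c * sqrt (k * (2 * e M))" for M
  proof (rule tendsto_le[OF sequentially_bot])
    show "(\<lambda>N. \<bar>z N\<bar>) \<longlonglongrightarrow> \<bar>L\<bar>" using z by (rule tendsto_rabs)
    have "(\<lambda>N. x M N + c * sqrt (k * (2 * e N + 2 * e M))) \<longlonglongrightarrow> 0 + c * sqrt (k * (2 * 0 + 2 * e M))"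
      by (intro tendsto_intros x e)
    then show "(\<lambda>N. x M N + c * sqrt (k * (2 * e N + 2 * e M))) \<longlonglongrightarrow> c * sqrt (k * (2 * e M))" by simp
    show "\<forall>\<^sub>F N in sequentially. \<bar>z N\<bar> \<le> x M N + c * sqrt (k * (2 * e N + 2 * e M))"
      using eventually_gt_at_top[of 0] by eventually_elim (rule bound)
  qed
  moreover have "(\<lambda>M. c * sqrt (k * (2 * e M))) \<longlonglongrightarrow> c * sqrt (k * (2 * 0))"
    by (intro tendsto_intros e)
  ultimately have "\<bar>L\<bar> \<le> 0"
    by (intro tendsto_le[OF sequentially_bot _ tendsto_const, of _ 0 "\<bar>L\<bar>"]) auto
  then show ?thesis by simp
qed

context advection_core
begin

section \<open>The weakly continuous representative\<close>

text \<open>Riesz-Fischer at each time separately; a weakly continuous representative is constrained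
  only through its slices and their pairings.\<close>

lemma weak_representative_exists:
  obtains v where "\<And>t. v t \<in> borel_measurable borel" "\<And>t. torus_periodic (v t)"
    "\<And>t. square_integrable X (v t)" "\<And>t k. torus.coef (v t) k = A k t"
proof -
  have "\<exists>v. v \<in> borel_measurable borel \<and> torus_periodic v \<and> square_integrable X v \<and> (\<forall>k. torus.coef v k = A k t)" for t
  proof -
    obtain f where f: "square_integrable X f" "\<And>k. torus.coef f k = A k t"
      using torus.Riesz_Fischer[OF A_square_summable(1)[of t]] by blast
    obtain v where v [measurable]: "v \<in> borel_measurable borel" and per: "torus_periodic v" and ae: "AE x in X. f x = v x"
      using periodic_borel_version[of f] f(1) by auto
    have vX: "v \<in> borel_measurable X" by measurable
    have "square_integrable X v" by (rule square_integrable_cong_AE[OF f(1) ae vX])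
    moreover have "torus.coef v k = torus.coef f k" for k
      unfolding torus.coef_def
      by (rule integral_cong_AE) (use ae f(1) vX in auto)
    ultimately show ?thesis using v per f(2) by (intro exI[of _ v]) simp
  qed
  then obtain v where "\<And>t. v t \<in> borel_measurable borel \<and> torus_periodic (v t) \<and> square_integrable X (v t) \<and> (\<forall>k. torus.coef (v t) k = A k t)"
    by metis
  with that show ?thesis by blast
qed

text \<open>By Parseval the pairing is a series of continuous functions of t. It converges
  uniformly, since E0 bounds the coefficients A in l^2 at all times at once while the tail of the
  coefficients of f is small.\<close>

lemma weakly_continuous:
  assumes v: "\<And>t. square_integrable X (v t)" "\<And>t k. torus.coef (v t) k = A k t"
    and f: "square_integrable X f"
  shows "continuous_on {0..T} (\<lambda>t. LINT x|X. v t x * f x)"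
proof -
  let ?c = "torus.coef f"
  have c: "square_integrable K ?c" by (rule torus.square_summable_coef(1)[OF f])
  have eq: "(LINT x|X. v t x * f x) = (LINT k|K. A k t * ?c k)" for t
    using torus.Parseval[OF v(1) f, of t] by (simp add: v(2))
  let ?tail = "\<lambda>N. (LINT k|K. (?c k)\<^sup>2) - (\<Sum>k\<in>first_indices N. (?c k)\<^sup>2)"
  have tail: "?tail \<longlonglongrightarrow> 0"
    using tendsto_diff[OF tendsto_const sum_first_indices_tendsto[OF square_integrable_square[OF c]], of "LINT k|K. (?c k)\<^sup>2"]
    by simp
  note ind = integral_count_space_indicator(2)[OF finite_first_indices]
    and indi = integral_count_space_indicator(1)[OF finite_first_indices]
  have est: "\<bar>(\<Sum>k\<in>first_indices N. A k t * ?c k) - (LINT x|X. v t x * f x)\<bar> \<le> sqrt (E0 * ?tail N)" for N t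
  proof -
    let ?d = "\<lambda>k. ?c k - indicator (first_indices N) k * ?c k"
    have d: "square_integrable K ?d"
      by (intro square_integrable_diff c square_integrable_bounded_mult[OF c, where C = 1])
        (auto simp: indicator_def)
    have "(LINT k|K. (?d k)\<^sup>2) = (LINT k|K. (?c k)\<^sup>2 - indicator (first_indices N) k * (?c k)\<^sup>2)"
      by (rule Bochner_Integration.integral_cong) (auto simp: indicator_def)
    then have dn: "(LINT k|K. (?d k)\<^sup>2) = ?tail N"
      using square_integrable_square[OF c] indi[of N "\<lambda>k. (?c k)\<^sup>2"] by (simp add: ind)
    have "(LINT x|X. v t x * f x) - (\<Sum>k\<in>first_indices N. A k t * ?c k)
        = (LINT k|K. A k t * ?c k - indicator (first_indices N) k * (A k t * ?c k))"
      using square_integrable_mult[OF A_square_summable(1) c, of t] indi[of N "\<lambda>k. A k t * ?c k"]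
      by (simp add: eq ind)
    also have "\<dots> = (LINT k|K. A k t * ?d k)"
      by (rule Bochner_Integration.integral_cong) (auto simp: algebra_simps)
    finally have "((LINT x|X. v t x * f x) - (\<Sum>k\<in>first_indices N. A k t * ?c k))\<^sup>2 \<le> (LINT k|K. (A k t)\<^sup>2) * ?tail N"
      using Cauchy_Schwarz_integral[OF A_square_summable(1) d, of t] dn by simp
    also have "\<dots> \<le> E0 * ?tail N"
      by (intro mult_right_mono A_square_summable(2)) (simp add: dn[symmetric])
    finally show ?thesis by (intro real_le_rsqrt) (simp add: power2_commute)
  qed
  have unif: "uniform_limit {0..T} (\<lambda>N t. \<Sum>k\<in>first_indices N. A k t * ?c k) (\<lambda>t. LINT x|X. v t x * f x) sequentially"
  proof (rule uniform_limitI)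
    fix e :: real assume "0 < e"
    have "(\<lambda>N. sqrt (E0 * ?tail N)) \<longlonglongrightarrow> sqrt (E0 * 0)" by (intro tendsto_intros tail)
    then have "\<forall>\<^sub>F N in sequentially. sqrt (E0 * ?tail N) < e"
      using \<open>0 < e\<close> by (intro order_tendstoD) auto
    then show "\<forall>\<^sub>F N in sequentially. \<forall>t\<in>{0..T}. dist (\<Sum>k\<in>first_indices N. A k t * ?c k) (LINT x|X. v t x * f x) < e"
      by eventually_elim (auto simp: dist_real_def intro: le_less_trans[OF est])
  qed
  show ?thesis
    by (rule uniform_limit_theorem[OF _ unif])
      (auto intro!: always_eventually continuous_intros A_continuous)
qed

section \<open>The weak gradient\<close>

text \<open>The termwise differentiated series is Cauchy in L^2 of space-time by
  \<open>sum_freq_a_le\<close>. The explicit formula for its limit makes G jointly Borel, and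
  periodic in x at every time; the coefficients of its slices are identified for almost every
  t.\<close>

lemma gradient_component_exists:
  obtains G where "(\<lambda>p. G (fst p) (snd p)) \<in> borel_measurable borel" "\<And>t. torus_periodic (G t)"
    "square_integrable (I \<Otimes>\<^sub>M X) (\<lambda>(t, x). G t x)"
    "AE t in I. square_integrable X (G t) \<and> (\<forall>k. torus.coef (G t) (- k) = 2 * pi * real_of_int (k $ j) * a k t)"
proof -
  define c where "c k t = 2 * pi * real_of_int (k $ j) * a k t" for k t
  define s where "s N p = (\<Sum>k\<in>first_indices N. c k (fst p) * hartley (- k) (snd p))" for N and p :: "real \<times> (real^'n)"
  have c_m [measurable]: "c k \<in> borel_measurable borel" for k unfolding c_def by measurable
  have c_sq: "square_integrable I (c k)" for k
    unfolding c_def[abs_def] by (intro square_integrable_cmult a_sq)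
  have c_bd: "\<bar>c k t\<bar> \<le> \<bar>2 * pi * real_of_int (k $ j)\<bar> * sqrt C" for k t
    unfolding c_def abs_mult[of _ "a k t"] by (intro mult_left_mono a_bounded) simp
  have fs: "fst \<in> borel_measurable (borel :: (real \<times> (real^'n)) measure)"
      "snd \<in> borel_measurable (borel :: (real \<times> (real^'n)) measure)"
    by (auto intro!: borel_measurable_continuous_onI continuous_intros)
  have s_borel [measurable]: "s N \<in> borel_measurable borel" for N
    unfolding s_def[abs_def]
    by (intro borel_measurable_sum borel_measurable_times
        measurable_compose[OF fs(1) c_m] measurable_compose[OF fs(2) hartley_measurable])
  have s_meas: "s N \<in> borel_measurable (I \<Otimes>\<^sub>M X)" for N
    unfolding s_def[abs_def] by measurable
  have comb_sq: "square_integrable (I \<Otimes>\<^sub>M X) (\<lambda>p. \<Sum>k\<in>B. c k (fst p) * hartley (- k) (snd p))" for B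
  proof (intro square_integrable_sum)
    fix k
    show "square_integrable (I \<Otimes>\<^sub>M X) (\<lambda>p. c k (fst p) * hartley (- k) (snd p))"
    proof (rule P.square_integrable_bounded[where C = "\<bar>2 * pi * real_of_int (k $ j)\<bar> * sqrt C * 2"])
      show "\<bar>c k (fst p) * hartley (- k) (snd p)\<bar> \<le> \<bar>2 * pi * real_of_int (k $ j)\<bar> * sqrt C * 2" for p
        unfolding abs_mult[of "c k (fst p)"] by (intro mult_mono c_bd hartley_bounded) (auto simp: C_nonneg)
    qed measurable
  qed
  define q where "q k = (LINT t|I. (c k t)\<^sup>2)" for k
  have comb_int: "integral\<^sup>L (I \<Otimes>\<^sub>M X) (\<lambda>p. (\<Sum>k\<in>B. c k (fst p) * hartley (- k) (snd p))\<^sup>2) = (\<Sum>k\<in>B. q k)"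
    if "finite B" for B
  proof -
    have "integral\<^sup>L (I \<Otimes>\<^sub>M X) (\<lambda>p. (\<Sum>k\<in>B. c k (fst p) * hartley (- k) (snd p))\<^sup>2)
        = (LINT t|I. LINT x|X. (\<Sum>k\<in>B. c k t * hartley (- k) x)\<^sup>2)"
      using IX.integral_fst'[OF square_integrable_square[OF comb_sq[of B]]] by simp
    also have "\<dots> = (\<Sum>k\<in>B. q k)"
      unfolding square_integral_hartley_minus[OF that] q_def
      by (rule Bochner_Integration.integral_sum) (rule square_integrable_square[OF c_sq])
    finally show ?thesis .
  qed
  have q_le: "q k \<le> (LINT t|I. freq k * (a k t)\<^sup>2)" for k
    unfolding q_def
  proof (rule integral_mono_nonneg_bound[OF a_freq_integrable])
    fix t
    have "(2 * pi * real_of_int (k $ j))\<^sup>2 \<le> freq k"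
      unfolding freq_def by (rule member_le_sum) auto
    then show "(c k t)\<^sup>2 \<le> freq k * (a k t)\<^sup>2"
      unfolding c_def power_mult_distrib[of _ "a k t"] by (rule mult_right_mono) simp
  qed simp
  have q0: "0 \<le> q k" for k unfolding q_def by (rule Bochner_Integration.integral_nonneg) simp
  have qi: "integrable K q"
  proof -
    have "(\<Sum>k\<in>S. (sqrt (q k))\<^sup>2) \<le> E0" if "finite S" for S
      using order_trans[OF sum_mono[OF q_le] sum_freq_a_le[OF that]] q0 by simp
    from square_summableI(1)[OF this] show ?thesis using q0 by (simp add: square_integrable_def)
  qed
  note conv = sum_first_indices_tendsto[OF qi]
  have s_sq: "square_integrable (I \<Otimes>\<^sub>M X) (s N)" for N
    unfolding s_def[abs_def] by (rule comb_sq)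
  have dist: "integral\<^sup>L (I \<Otimes>\<^sub>M X) (\<lambda>p. (s N p - s M p)\<^sup>2) = (\<Sum>k\<in>first_indices N. q k) - (\<Sum>k\<in>first_indices M. q k)"
    if "M \<le> N" for M N
  proof -
    have sub: "first_indices M \<subseteq> (first_indices N :: (int^'n) set)" by (rule first_indices_mono[OF that])
    have "s N p - s M p = (\<Sum>k\<in>first_indices N - first_indices M. c k (fst p) * hartley (- k) (snd p))" for p
      unfolding s_def using sub by (simp add: sum_diff)
    then show ?thesis
      using comb_int[of "first_indices N - first_indices M"] sum_diff[OF finite_first_indices sub, of q] by simp
  qed
  have "\<exists>N. \<forall>i\<ge>N. \<forall>l\<ge>N. integral\<^sup>L (I \<Otimes>\<^sub>M X) (\<lambda>p. (s i p - s l p)\<^sup>2) < e" if "0 < e" for e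
  proof -
    obtain N where N: "\<And>i l. i \<ge> N \<Longrightarrow> l \<ge> N \<Longrightarrow>
        dist (\<Sum>k\<in>first_indices i. q k) (\<Sum>k\<in>first_indices l. q k) < e"
      using LIMSEQ_imp_Cauchy[OF conv] \<open>0 < e\<close> unfolding Cauchy_def by meson
    have "integral\<^sup>L (I \<Otimes>\<^sub>M X) (\<lambda>p. (s i p - s l p)\<^sup>2) < e" if "i \<ge> N" "l \<ge> N" for i l
    proof (cases "l \<le> i")
      case True
      with dist[OF True] N[OF that] show ?thesis by (auto simp: dist_real_def)
    next
      case False
      have "integral\<^sup>L (I \<Otimes>\<^sub>M X) (\<lambda>p. (s i p - s l p)\<^sup>2) = integral\<^sup>L (I \<Otimes>\<^sub>M X) (\<lambda>p. (s l p - s i p)\<^sup>2)"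
        by (simp add: power2_commute)
      with dist[of i l] False N[OF that] show ?thesis by (auto simp: dist_real_def)
    qed
    then show ?thesis by blast
  qed
  from P.square_integrable_complete[OF s_sq this] obtain r where
    r: "square_integrable (I \<Otimes>\<^sub>M X) (\<lambda>p. lim (\<lambda>i. s (r i) p))"
      "(\<lambda>N. integral\<^sup>L (I \<Otimes>\<^sub>M X) (\<lambda>p. (s N p - lim (\<lambda>i. s (r i) p))\<^sup>2)) \<longlonglongrightarrow> 0" by blast
  define G where "G t x = lim (\<lambda>i. s (r i) (t, x))" for t x
  have G_borel: "(\<lambda>p. G (fst p) (snd p)) \<in> borel_measurable borel"
    unfolding G_def prod.collapse by measurable
  have G_per: "torus_periodic (G t)" for t
    by (rule torus_periodicI) (simp add: G_def s_def torus_periodic_ivec[OF torus_periodic_hartley])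
  have G_sq: "square_integrable (I \<Otimes>\<^sub>M X) (\<lambda>(t, x). G t x)"
    using r(1) by (simp add: G_def split_beta')
  have lim: "(\<lambda>N. integral\<^sup>L (I \<Otimes>\<^sub>M X) (\<lambda>p. (s N p - G (fst p) (snd p))\<^sup>2)) \<longlonglongrightarrow> 0"
    using r(2) by (simp add: G_def)
  have Gsl [measurable]: "G t \<in> borel_measurable borel" for t
    using measurable_compose[OF _ G_borel, of "\<lambda>x. (t, x)" borel] by simp
  have AE_sq: "AE t in I. square_integrable X (G t)"
    using IX.AE_integrable_fst'[OF square_integrable_square[OF G_sq]]
    by eventually_elim (auto simp: square_integrable_def)
  have coefG: "AE t in I. torus.coef (G t) (- k) = c k t" for k
  proof -
    have cm [measurable]: "(\<lambda>t. torus.coef (G t) (- k)) \<in> borel_measurable I"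
    proof -
      have "(\<lambda>(t, x). G t x * hartley (- k) x) \<in> borel_measurable (I \<Otimes>\<^sub>M X)"
        using square_integrable_measurable[OF G_sq] by (simp add: split_beta')
      then show ?thesis unfolding torus.coef_def by (rule X.borel_measurable_lebesgue_integral)
    qed
    have cmI [measurable]: "c k \<in> borel_measurable I" using c_sq by auto
    \<comment> \<open>Bessel in each slice bounds the error of one coefficient by the distance of
      the partial sum from G, which tends to zero.\<close>
    have bound: "(\<integral>\<^sup>+t. ennreal ((c k t - torus.coef (G t) (- k))\<^sup>2) \<partial>I) \<le> ennreal (integral\<^sup>L (I \<Otimes>\<^sub>M X) (\<lambda>p. (s N p - G (fst p) (snd p))\<^sup>2))"
      if kN: "k \<in> first_indices N" for N
    proof -
      have d: "square_integrable (I \<Otimes>\<^sub>M X) (\<lambda>p. s N p - G (fst p) (snd p))"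
        using square_integrable_diff[OF s_sq G_sq] by (simp add: split_beta')
      have di: "integrable (I \<Otimes>\<^sub>M X) (\<lambda>p. (s N p - G (fst p) (snd p))\<^sup>2)"
        by (rule square_integrable_square[OF d])
      have "(\<integral>\<^sup>+t. ennreal ((c k t - torus.coef (G t) (- k))\<^sup>2) \<partial>I) \<le> (\<integral>\<^sup>+t. ennreal (LINT x|X. (s N (t, x) - G t x)\<^sup>2) \<partial>I)"
      proof (rule nn_integral_mono_AE, use AE_sq in eventually_elim)
        fix t assume Gt: "square_integrable X (G t)"
        have eq: "(\<lambda>x. s N (t, x)) = (\<lambda>x. \<Sum>l\<in>uminus ` first_indices N. c (- l) t * hartley l x)"
          by (simp add: s_def sum.reindex fun_eq_iff)
        have st: "square_integrable X (\<lambda>x. s N (t, x))" unfolding eq by simp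
        have "torus.coef (\<lambda>x. s N (t, x)) (- k) = c k t"
          unfolding eq using kN by (subst torus.coef_comb) auto
        then show "ennreal ((c k t - torus.coef (G t) (- k))\<^sup>2) \<le> ennreal (LINT x|X. (s N (t, x) - G t x)\<^sup>2)"
          using torus.coef_square_le[OF square_integrable_diff[OF st Gt], of "- k"] torus.coef_diff[OF st Gt, of "- k"]
          by (simp add: ennreal_leI)
      qed
      also have "\<dots> = ennreal (LINT t|I. LINT x|X. (s N (t, x) - G t x)\<^sup>2)"
        using IX.integrable_fst'[OF di] by (intro nn_integral_eq_integral) auto
      also have "(LINT t|I. LINT x|X. (s N (t, x) - G t x)\<^sup>2) = integral\<^sup>L (I \<Otimes>\<^sub>M X) (\<lambda>p. (s N p - G (fst p) (snd p))\<^sup>2)"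
        using IX.integral_fst'[OF di] by simp
      finally show ?thesis .
    qed
    have "(\<integral>\<^sup>+t. ennreal ((c k t - torus.coef (G t) (- k))\<^sup>2) \<partial>I) \<le> ennreal 0"
      by (rule tendsto_le[OF sequentially_bot tendsto_ennrealI[OF lim] tendsto_const])
        (use eventually_first_indices[of k] bound in \<open>auto elim: eventually_mono\<close>)
    then have "AE t in I. ennreal ((c k t - torus.coef (G t) (- k))\<^sup>2) = 0"
      by (subst (asm) ennreal_0, subst nn_integral_0_iff_AE[symmetric]) auto
    then show ?thesis by eventually_elim simp
  qed
  have "AE t in I. square_integrable X (G t) \<and> (\<forall>k. torus.coef (G t) (- k) = 2 * pi * real_of_int (k $ j) * a k t)"
  proof -
    have "AE t in I. \<forall>k. torus.coef (G t) (- k) = c k t"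
      using coefG unfolding AE_all_countable by blast
    with AE_sq show ?thesis unfolding c_def by eventually_elim simp
  qed
  with G_borel G_per G_sq that show ?thesis by blast
qed

end

context advection_core
begin

section \<open>Cancellation of the transport term\<close>

text \<open>Tested against a trigonometric polynomial, the transport term is antisymmetric. Passing to the
  limit along Fejer means uses that \<open>(U - U\<^sub>N) V\<close> stays bounded in \<open>L\<^sup>2\<close> and that
  \<open>U - U\<^sub>N\<close> tends to zero in \<open>L\<^sup>2\<close>.\<close>

abbreviation P :: "(real \<times> (real^'n)) measure" where "P \<equiv> I \<Otimes>\<^sub>M X"

definition mU :: "nat \<Rightarrow> real \<Rightarrow> real^'n \<Rightarrow> real" where
  "mU N t x = (\<Sum>m\<in>fejer_supp N. fejer_mult N m * a m t * hartley m x)"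

text \<open>The j-th partial derivative of \<open>mU N t\<close>, expanded in the basis.\<close>

definition mD :: "'n \<Rightarrow> nat \<Rightarrow> real \<Rightarrow> real^'n \<Rightarrow> real" where
  "mD j N t x = (\<Sum>m\<in>fejer_supp N. fejer_mult N m * (2 * pi * real_of_int (m $ j) * a m t) * hartley (- m) x)"

text \<open>The integral of U V against the gradient of \<open>mU N t\<close>, written in
  coefficients; its time integral tends to the transport term of the energy balance.\<close>

definition Z :: "nat \<Rightarrow> real \<Rightarrow> real" where
  "Z N t = (\<Sum>m\<in>fejer_supp N. fejer_mult N m * (a m t * F m t))"

lemma mU_fejer_mean: "mU N t = fejer_mean N (U t)"
  by (simp add: mU_def fejer_mean_def a_def fun_eq_iff)

lemma Vj_sq [simp]: "square_integrable X (\<lambda>x. V t x $ j)"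
  unfolding square_integrable_def
proof
  show m: "(\<lambda>x. V t x $ j) \<in> borel_measurable X"
    by (intro nth_measurable V_measurable measurable_id_lebesgue_on borel_measurable_const)
  have Vm: "V t \<in> borel_measurable X"
    by (intro V_measurable[where f = "\<lambda>x. t" and g = "\<lambda>x. x"] measurable_id_lebesgue_on borel_measurable_const)
  have "integrable X (\<lambda>x. (norm (V t x))\<^sup>2)"
    using V_sq[of t] Vm by (simp add: integrable_iff_bounded)
  then show "integrable X (\<lambda>x. (V t x $ j)\<^sup>2)"
    by (rule Bochner_Integration.integrable_bound)
      (use m in \<open>auto simp: norm_vec_square intro!: member_le_sum[of j UNIV "\<lambda>j. (V t _ $ j)\<^sup>2"] order_trans[OF _ abs_ge_self]\<close>)
qed

lemma transport_antisymmetric: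
  "(\<Sum>j\<in>UNIV. LINT x|X. mU N t x * V t x $ j * mD j N t x) = 0"
proof -
  let ?S = "fejer_supp N :: (int^'n) set"
  define y where "y m = fejer_mult N m * a m t" for m
  define c where "c l m = (LINT x|X. hartley l x * (V t x \<bullet> grad (hartley m) x))" for l m
  have hb: "\<bar>hartley k x * hartley l x\<bar> \<le> 4" for k l and x :: "real^'n"
    using mult_mono[OF hartley_bounded hartley_bounded, of k x l x] by (simp add: abs_mult mult.commute)
  have Vhh: "integrable X (\<lambda>x. hartley l x * hartley m x * V t x $ j)" for l m j
    by (rule X.square_integrable_integrable, rule square_integrable_bounded_mult[OF Vj_sq _ hb])
      (intro borel_measurable_times hartley_measurable_torus)
  have ci: "integrable X (\<lambda>x. hartley l x * (V t x \<bullet> grad (hartley m) x))" for l m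
  proof -
    have "integrable X (\<lambda>x. \<Sum>j\<in>UNIV. 2 * pi * real_of_int (m $ j) * (hartley l x * hartley (- m) x * V t x $ j))"
      by (intro Bochner_Integration.integrable_sum integrable_mult_right Vhh)
    then show ?thesis by (simp add: grad_hartley inner_vec_def sum_distrib_left mult_ac)
  qed
  \<comment> \<open>The Leibniz rule turns \<open>div_free\<close> into antisymmetry of c, while y l
    * y m is symmetric; the double sum below therefore vanishes.\<close>
  have anti: "c l m = - c m l" for l m
  proof -
    have "grad (\<lambda>x. hartley l x * hartley m x) x = hartley l x *\<^sub>R grad (hartley m) x + hartley m x *\<^sub>R grad (hartley l) x" for x
      by (simp add: grad_def vec_eq_iff partial_mult[OF smooth_hartley smooth_hartley] mult.commute)
    then have "0 = (LINT x|X. hartley l x * (V t x \<bullet> grad (hartley m) x) + hartley m x * (V t x \<bullet> grad (hartley l) x))"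
      using div_free[of t l m] by (simp add: inner_add_right)
    also have "\<dots> = c l m + c m l"
      unfolding c_def by (rule Bochner_Integration.integral_add[OF ci ci])
    finally show ?thesis by simp
  qed
  have pt: "(\<Sum>j\<in>UNIV. mU N t x * V t x $ j * mD j N t x)
      = (\<Sum>l\<in>?S. \<Sum>m\<in>?S. y l * y m * (hartley l x * (V t x \<bullet> grad (hartley m) x)))" for x
  proof -
    have "(\<Sum>j\<in>UNIV. V t x $ j * mD j N t x) = (\<Sum>m\<in>?S. y m * (V t x \<bullet> grad (hartley m) x))"
      unfolding mD_def sum_distrib_left
      by (subst sum.swap) (simp add: y_def grad_hartley inner_vec_def sum_distrib_left mult_ac)
    moreover have "mU N t x = (\<Sum>l\<in>?S. y l * hartley l x)" by (simp add: mU_def y_def)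
    ultimately have "mU N t x * (\<Sum>j\<in>UNIV. V t x $ j * mD j N t x)
        = (\<Sum>l\<in>?S. \<Sum>m\<in>?S. (y l * hartley l x) * (y m * (V t x \<bullet> grad (hartley m) x)))"
      by (simp add: sum_product)
    then show ?thesis by (simp add: sum_distrib_left mult_ac)
  qed
  have UVD: "integrable X (\<lambda>x. mU N t x * V t x $ j * mD j N t x)" for j
  proof -
    have "integrable X (\<lambda>x. \<Sum>l\<in>?S. \<Sum>m\<in>?S. y l * (y m * (2 * pi * real_of_int (m $ j))) * (hartley l x * hartley (- m) x * V t x $ j))"
      by (intro Bochner_Integration.integrable_sum integrable_mult_right Vhh)
    moreover have "(\<Sum>l\<in>?S. \<Sum>m\<in>?S. y l * (y m * (2 * pi * real_of_int (m $ j))) * (hartley l x * hartley (- m) x * V t x $ j))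
        = mU N t x * V t x $ j * mD j N t x" for x
    proof -
      have "mU N t x * mD j N t x = (\<Sum>l\<in>?S. \<Sum>m\<in>?S. (y l * hartley l x) * (y m * (2 * pi * real_of_int (m $ j)) * hartley (- m) x))"
        by (simp add: mU_def mD_def y_def sum_product mult_ac)
      then have "V t x $ j * (mU N t x * mD j N t x) = V t x $ j * (\<Sum>l\<in>?S. \<Sum>m\<in>?S. (y l * hartley l x) * (y m * (2 * pi * real_of_int (m $ j)) * hartley (- m) x))"
        by simp
      then show ?thesis by (simp add: sum_distrib_left mult_ac)
    qed
    ultimately show ?thesis by simp
  qed
  have "(\<Sum>j\<in>UNIV. LINT x|X. mU N t x * V t x $ j * mD j N t x)
      = (LINT x|X. (\<Sum>j\<in>UNIV. mU N t x * V t x $ j * mD j N t x))"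
    by (rule Bochner_Integration.integral_sum[symmetric]) (rule UVD)
  also have "\<dots> = (\<Sum>l\<in>?S. \<Sum>m\<in>?S. y l * y m * c l m)"
    unfolding pt c_def
    by (subst Bochner_Integration.integral_sum, intro Bochner_Integration.integrable_sum integrable_mult_right ci,
        rule sum.cong[OF refl], subst Bochner_Integration.integral_sum, intro integrable_mult_right ci,
        simp only: integral_mult_right_zero)
  finally have eq: "(\<Sum>j\<in>UNIV. LINT x|X. mU N t x * V t x $ j * mD j N t x) = (\<Sum>l\<in>?S. \<Sum>m\<in>?S. y l * y m * c l m)" .
  have "(\<Sum>l\<in>?S. \<Sum>m\<in>?S. y l * y m * c l m) = (\<Sum>m\<in>?S. \<Sum>l\<in>?S. y l * y m * c l m)" by (rule sum.swap)
  also have "\<dots> = (\<Sum>m\<in>?S. \<Sum>l\<in>?S. - (y m * y l * c m l))"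
  proof (intro sum.cong refl)
    show "y l * y m * c l m = - (y m * y l * c m l)" for l m using anti[of l m] by simp
  qed
  also have "\<dots> = - (\<Sum>l\<in>?S. \<Sum>m\<in>?S. y l * y m * c l m)" by (simp add: sum_negf)
  finally show ?thesis using eq by simp
qed

lemma mD_sq [simp]: "square_integrable X (mD j N t)"
  unfolding mD_def[abs_def] by (intro square_integrable_sum square_integrable_cmult torus.h_sq)

lemma mU_bounded: "\<exists>B. \<forall>t x. \<bar>mU N t x\<bar> \<le> B"
proof (intro exI allI)
  fix t x
  have "\<bar>mU N t x\<bar> \<le> (\<Sum>m\<in>fejer_supp N. \<bar>fejer_mult N m * a m t * hartley m x\<bar>)"
    unfolding mU_def by (rule sum_abs)
  also have "\<dots> \<le> (\<Sum>m\<in>(fejer_supp N :: (int^'n) set). 1 * sqrt C * 2)"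
    unfolding abs_mult abs_of_nonneg[OF fejer_mult_nonneg]
    by (intro sum_mono mult_mono fejer_mult_le_1 hartley_bounded a_bounded) (auto simp: C_nonneg)
  finally show "\<bar>mU N t x\<bar> \<le> (\<Sum>m\<in>(fejer_supp N :: (int^'n) set). 1 * sqrt C * 2)" .
qed

lemma mD_bounded: "\<exists>B. \<forall>t x. \<bar>mD j N t x\<bar> \<le> B"
proof (intro exI allI)
  fix t x
  have "\<bar>mD j N t x\<bar> \<le> (\<Sum>m\<in>fejer_supp N. \<bar>fejer_mult N m * (2 * pi * real_of_int (m $ j) * a m t) * hartley (- m) x\<bar>)"
    unfolding mD_def by (rule sum_abs)
  also have "\<dots> \<le> (\<Sum>m\<in>fejer_supp N. 1 * (\<bar>2 * pi * real_of_int (m $ j)\<bar> * sqrt C) * 2)"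
    unfolding abs_mult[of "fejer_mult N _ * _"] abs_mult[of "fejer_mult N _"] abs_mult[of _ "a _ t"] abs_of_nonneg[OF fejer_mult_nonneg]
    by (intro sum_mono mult_mono fejer_mult_le_1 hartley_bounded a_bounded) (auto simp: C_nonneg)
  finally show "\<bar>mD j N t x\<bar> \<le> (\<Sum>m\<in>fejer_supp N. 1 * (\<bar>2 * pi * real_of_int (m $ j)\<bar> * sqrt C) * 2)" .
qed

lemma mU_measurable [measurable (raw)]:
  "f \<in> borel_measurable M \<Longrightarrow> h \<in> borel_measurable M \<Longrightarrow> (\<lambda>x. mU N (f x) (h x)) \<in> borel_measurable M"
  unfolding mU_def
  by (intro borel_measurable_sum borel_measurable_times borel_measurable_const
      measurable_compose[OF _ a_measurable] measurable_compose[OF _ hartley_measurable])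

lemma mD_measurable [measurable (raw)]:
  "f \<in> borel_measurable M \<Longrightarrow> h \<in> borel_measurable M \<Longrightarrow> (\<lambda>x. mD j N (f x) (h x)) \<in> borel_measurable M"
  unfolding mD_def
  by (intro borel_measurable_sum borel_measurable_times borel_measurable_const
      measurable_compose[OF _ a_measurable] measurable_compose[OF _ hartley_measurable])

lemma fst_snd_measurable: "fst \<in> borel_measurable P" "snd \<in> borel_measurable P"
  by measurable

lemma square_integrableP:
  assumes m: "(\<lambda>p. f (fst p) (snd p)) \<in> borel_measurable P"
    and b: "(\<integral>\<^sup>+t. \<integral>\<^sup>+x. ennreal ((f t x)\<^sup>2) \<partial>X \<partial>I) \<le> ennreal B" and B: "0 \<le> B"
  shows "square_integrable P (\<lambda>p. f (fst p) (snd p))" "integral\<^sup>L P (\<lambda>p. (f (fst p) (snd p))\<^sup>2) \<le> B"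
proof -
  have "(\<integral>\<^sup>+p. ennreal ((f (fst p) (snd p))\<^sup>2) \<partial>P) = (\<integral>\<^sup>+t. \<integral>\<^sup>+x. ennreal ((f t x)\<^sup>2) \<partial>X \<partial>I)"
    using m by (subst X.nn_integral_fst[symmetric]) auto
  then have le: "(\<integral>\<^sup>+p. ennreal ((f (fst p) (snd p))\<^sup>2) \<partial>P) \<le> ennreal B" using b by simp
  then show s: "square_integrable P (\<lambda>p. f (fst p) (snd p))"
    using m by (auto simp: square_integrable_def integrable_iff_bounded intro: le_less_trans)
  show "integral\<^sup>L P (\<lambda>p. (f (fst p) (snd p))\<^sup>2) \<le> B"
    using le B by (subst (asm) nn_integral_eq_integral[OF square_integrable_square[OF s]]) auto
qed

definition n_int :: real where "n_int = enn2real (\<integral>\<^sup>+t. ennreal (n t) \<partial>I)"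

lemma n_int: "(\<integral>\<^sup>+t. ennreal (n t) \<partial>I) = ennreal n_int" "0 \<le> n_int"
  using n_total by (auto simp: n_int_def)

lemma WP: "square_integrable P (\<lambda>p. W j (fst p) (snd p))" "integral\<^sup>L P (\<lambda>p. (W j (fst p) (snd p))\<^sup>2) \<le> n_int"
proof -
  have "(\<integral>\<^sup>+t. \<integral>\<^sup>+x. ennreal ((W j t x)\<^sup>2) \<partial>X \<partial>I) \<le> (\<integral>\<^sup>+t. ennreal (n t) \<partial>I)"
  proof (rule nn_integral_mono)
    fix t
    have "(\<integral>\<^sup>+x. ennreal ((W j t x)\<^sup>2) \<partial>X) \<le> (\<integral>\<^sup>+x. ennreal ((U t x)\<^sup>2 * (norm (V t x))\<^sup>2) \<partial>X)"
      by (intro nn_integral_mono ennreal_leI W_square_le)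
    also have "\<dots> \<le> ennreal (n t)" by (rule UV_le_n)
    finally show "(\<integral>\<^sup>+x. ennreal ((W j t x)\<^sup>2) \<partial>X) \<le> ennreal (n t)" .
  qed
  then have b: "(\<integral>\<^sup>+t. \<integral>\<^sup>+x. ennreal ((W j t x)\<^sup>2) \<partial>X \<partial>I) \<le> ennreal n_int" by (simp add: n_int)
  have m: "(\<lambda>p. W j (fst p) (snd p)) \<in> borel_measurable P" by (intro W_measurable fst_snd_measurable)
  show "square_integrable P (\<lambda>p. W j (fst p) (snd p))" "integral\<^sup>L P (\<lambda>p. (W j (fst p) (snd p))\<^sup>2) \<le> n_int"
    by (rule square_integrableP[OF m b n_int(2)])+
qed

text \<open>The bound is uniform in N because \<open>UV_bound\<close> holds for all translates of U,
  hence for their averages against the Fejer kernel.\<close>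

lemma mU_V_P:
  assumes N: "0 < N"
  shows "square_integrable P (\<lambda>p. mU N (fst p) (snd p) * V (fst p) (snd p) $ j)"
    "integral\<^sup>L P (\<lambda>p. (mU N (fst p) (snd p) * V (fst p) (snd p) $ j)\<^sup>2) \<le> n_int"
proof -
  have "(\<integral>\<^sup>+t. \<integral>\<^sup>+x. ennreal ((mU N t x * V t x $ j)\<^sup>2) \<partial>X \<partial>I) \<le> (\<integral>\<^sup>+t. ennreal (n t) \<partial>I)"
  proof (rule nn_integral_mono)
    fix t
    have "(\<integral>\<^sup>+x. ennreal ((mU N t x * V t x $ j)\<^sup>2) \<partial>X) \<le> (\<integral>\<^sup>+x. ennreal ((fejer_mean N (U t) x)\<^sup>2) * ennreal ((norm (V t x))\<^sup>2) \<partial>X)"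
    proof (rule nn_integral_mono)
      fix x
      have "(mU N t x * V t x $ j)\<^sup>2 \<le> (mU N t x)\<^sup>2 * (norm (V t x))\<^sup>2"
        unfolding power_mult_distrib norm_vec_square by (intro mult_left_mono member_le_sum) auto
      then show "ennreal ((mU N t x * V t x $ j)\<^sup>2) \<le> ennreal ((fejer_mean N (U t) x)\<^sup>2) * ennreal ((norm (V t x))\<^sup>2)"
        by (simp add: ennreal_mult[symmetric] ennreal_leI mU_fejer_mean)
    qed
    also have "\<dots> \<le> ennreal (n t)"
    proof (rule nn_integral_fejer_mean_le[OF U_sq _ U_per _ N UV_bound])
      show "U t \<in> borel_measurable borel"
        by (rule U_measurable[where f = "\<lambda>x. t" and g = "\<lambda>x. x"]) auto
      have "V t \<in> borel_measurable borel"
        by (rule V_measurable[where f = "\<lambda>x. t" and g = "\<lambda>x. x"]) auto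
      then show "(\<lambda>x. ennreal ((norm (V t x))\<^sup>2)) \<in> borel_measurable borel" by simp
    qed
    finally show "(\<integral>\<^sup>+x. ennreal ((mU N t x * V t x $ j)\<^sup>2) \<partial>X) \<le> ennreal (n t)" .
  qed
  then have b: "(\<integral>\<^sup>+t. \<integral>\<^sup>+x. ennreal ((mU N t x * V t x $ j)\<^sup>2) \<partial>X \<partial>I) \<le> ennreal n_int" by (simp add: n_int)
  have m: "(\<lambda>p. mU N (fst p) (snd p) * V (fst p) (snd p) $ j) \<in> borel_measurable P"
    by (intro borel_measurable_times nth_measurable V_measurable mU_measurable fst_snd_measurable)
  show "square_integrable P (\<lambda>p. mU N (fst p) (snd p) * V (fst p) (snd p) $ j)"
    "integral\<^sup>L P (\<lambda>p. (mU N (fst p) (snd p) * V (fst p) (snd p) $ j)\<^sup>2) \<le> n_int"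
    by (rule square_integrableP[OF m b n_int(2)])+
qed

lemma V_P: "square_integrable P (\<lambda>p. V (fst p) (snd p) $ j)"
proof -
  have "(\<integral>\<^sup>+t. \<integral>\<^sup>+x. ennreal ((V t x $ j)\<^sup>2) \<partial>X \<partial>I) \<le> (\<integral>\<^sup>+t. \<integral>\<^sup>+x. ennreal ((norm (V t x))\<^sup>2) \<partial>X \<partial>I)"
    by (intro nn_integral_mono ennreal_leI) (auto simp: norm_vec_square intro!: member_le_sum)
  also have "\<dots> = ennreal (enn2real (\<integral>\<^sup>+t. \<integral>\<^sup>+x. ennreal ((norm (V t x))\<^sup>2) \<partial>X \<partial>I))"
    using V_total by simp
  finally show ?thesis
    by (intro square_integrableP(1)[of "\<lambda>t x. V t x $ j"] nth_measurable V_measurable fst_snd_measurable) auto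
qed

text \<open>In Fourier terms, the squared space-time L^2 distance between the gradient of U and that
  of its N-th Fejer mean.\<close>

definition \<epsilon> :: "nat \<Rightarrow> real" where
  "\<epsilon> N = (LINT k|K. (1 - fejer_mult N k)\<^sup>2 * (LINT t|I. freq k * (a k t)\<^sup>2))"

lemma fejer_defect: "\<bar>(1 - fejer_mult N (k :: int^'n))\<^sup>2\<bar> \<le> 1"
  using fejer_mult_le_1[of N k] by (simp add: power_le_one)

lemma q_integrable: "integrable K (\<lambda>k. LINT t|I. freq k * (a k t)\<^sup>2)"
  using KI.integrable_fst'[OF freq_a_pair] by simp

lemma q_nonneg: "0 \<le> (LINT t|I. freq k * (a k t)\<^sup>2)"
  by (rule Bochner_Integration.integral_nonneg) simp

lemma fejer_defect_integrable: "integrable K (\<lambda>k. (1 - fejer_mult N k)\<^sup>2 * q k)"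
  if "integrable K q" for q :: "int^'n \<Rightarrow> real"
  by (rule Bochner_Integration.integrable_bound[OF that])
    (use fejer_defect in \<open>auto simp: abs_mult intro!: mult_left_le_one_le\<close>)

lemma fejer_defect_tendsto:
  fixes q :: "int^'n \<Rightarrow> real"
  assumes "integrable K q"
  shows "(\<lambda>N. LINT k|K. (1 - fejer_mult N k)\<^sup>2 * q k) \<longlonglongrightarrow> 0"
proof -
  have "(\<lambda>N. LINT k|K. (1 - fejer_mult N k)\<^sup>2 * q k) \<longlonglongrightarrow> (LINT k|K. 0)"
  proof (rule integral_dominated_convergence[where w = "\<lambda>k. \<bar>q k\<bar>"])
    have "(\<lambda>N. (1 - fejer_mult N k)\<^sup>2 * q k) \<longlonglongrightarrow> (1 - 1)\<^sup>2 * q k" for k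
      by (intro tendsto_intros fejer_mult_tendsto)
    then show "AE k in K. (\<lambda>N. (1 - fejer_mult N k)\<^sup>2 * q k) \<longlonglongrightarrow> 0" by simp
    show "AE k in K. norm ((1 - fejer_mult N k)\<^sup>2 * q k) \<le> \<bar>q k\<bar>" for N
      using fejer_defect by (auto simp: abs_mult intro!: mult_left_le_one_le)
  qed (use assms in auto)
  then show ?thesis by simp
qed

lemma \<epsilon>_tendsto: "\<epsilon> \<longlonglongrightarrow> 0"
  unfolding \<epsilon>_def[abs_def] by (rule fejer_defect_tendsto[OF q_integrable])

lemma mD_P: "square_integrable P (\<lambda>p. mD j N (fst p) (snd p))"
proof -
  obtain B where "\<And>t x. \<bar>mD j N t x\<bar> \<le> B" using mD_bounded by blast
  then show ?thesis
    by (intro P.square_integrable_bounded[where C = B] mD_measurable fst_snd_measurable) auto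
qed

text \<open>The triangle inequality through the full gradient, carried out on the multipliers: their
  difference is a difference of two defects from 1, and (x - y)^2 <= 2 x^2 + 2 y^2.\<close>

lemma mD_diff_P: "integral\<^sup>L P (\<lambda>p. (mD j N (fst p) (snd p) - mD j M (fst p) (snd p))\<^sup>2) \<le> 2 * \<epsilon> N + 2 * \<epsilon> M"
proof -
  let ?B = "fejer_supp N \<union> fejer_supp M :: (int^'n) set"
  let ?d = "\<lambda>m. fejer_mult N m - fejer_mult M m" and ?q = "\<lambda>k. LINT t|I. freq k * (a k t)\<^sup>2"
  have ext: "mD j L t x = (\<Sum>m\<in>?B. fejer_mult L m * (2 * pi * real_of_int (m $ j) * a m t) * hartley (- m) x)"
    if "fejer_supp L \<subseteq> ?B" for L t x
    unfolding mD_def by (rule sum.mono_neutral_left) (use that in \<open>auto simp: fejer_mult_outside\<close>)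
  have diff: "mD j N t x - mD j M t x = (\<Sum>m\<in>?B. (?d m * (2 * pi * real_of_int (m $ j) * a m t)) * hartley (- m) x)" for t x
    by (simp add: ext sum_subtractf[symmetric] left_diff_distrib)
  have "integral\<^sup>L P (\<lambda>p. (mD j N (fst p) (snd p) - mD j M (fst p) (snd p))\<^sup>2)
      = (LINT t|I. LINT x|X. (mD j N t x - mD j M t x)\<^sup>2)"
    using IX.integral_fst'[OF square_integrable_square[OF square_integrable_diff[OF mD_P mD_P]], of j N j M] by simp
  also have "\<dots> = (LINT t|I. (\<Sum>m\<in>?B. (?d m * (2 * pi * real_of_int (m $ j) * a m t))\<^sup>2))"
    unfolding diff by (simp add: square_integral_hartley_minus)
  also have "\<dots> \<le> (LINT t|I. (\<Sum>m\<in>?B. (?d m)\<^sup>2 * (freq m * (a m t)\<^sup>2)))"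
  proof (rule integral_mono_nonneg_bound)
    show "integrable I (\<lambda>t. \<Sum>m\<in>?B. (?d m)\<^sup>2 * (freq m * (a m t)\<^sup>2))"
      by (intro Bochner_Integration.integrable_sum integrable_mult_right a_freq_integrable[unfolded])
    fix t
    have "(2 * pi * real_of_int (m $ j))\<^sup>2 \<le> freq m" for m
      unfolding freq_def by (rule member_le_sum) auto
    then show "(\<Sum>m\<in>?B. (?d m * (2 * pi * real_of_int (m $ j) * a m t))\<^sup>2) \<le> (\<Sum>m\<in>?B. (?d m)\<^sup>2 * (freq m * (a m t)\<^sup>2))"
      unfolding power_mult_distrib[of "?d _"] power_mult_distrib[of _ "a _ t"]
      by (intro sum_mono mult_left_mono mult_right_mono) auto
    show "0 \<le> (\<Sum>m\<in>?B. (?d m)\<^sup>2 * (freq m * (a m t)\<^sup>2))" by (intro sum_nonneg) simp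
  qed
  also have "\<dots> = (\<Sum>m\<in>?B. (?d m)\<^sup>2 * ?q m)"
    by (subst Bochner_Integration.integral_sum)
      (intro integrable_mult_right a_freq_integrable, simp only: integral_mult_right_zero)
  also have "\<dots> \<le> (\<Sum>m\<in>?B. 2 * ((1 - fejer_mult N m)\<^sup>2 * ?q m) + 2 * ((1 - fejer_mult M m)\<^sup>2 * ?q m))"
  proof (rule sum_mono)
    fix m :: "int^'n"
    have "(?d m)\<^sup>2 \<le> 2 * (1 - fejer_mult N m)\<^sup>2 + 2 * (1 - fejer_mult M m)\<^sup>2"
      using zero_le_power2[of "(1 - fejer_mult N m) + (1 - fejer_mult M m)"]
      by (simp add: power2_eq_square algebra_simps)
    from mult_right_mono[OF this q_nonneg[of m]]
    show "(?d m)\<^sup>2 * ?q m \<le> 2 * ((1 - fejer_mult N m)\<^sup>2 * ?q m) + 2 * ((1 - fejer_mult M m)\<^sup>2 * ?q m)"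
      by (simp only: distrib_right mult.assoc)
  qed
  also have "\<dots> = 2 * (\<Sum>m\<in>?B. (1 - fejer_mult N m)\<^sup>2 * ?q m) + 2 * (\<Sum>m\<in>?B. (1 - fejer_mult M m)\<^sup>2 * ?q m)"
    by (simp only: sum.distrib sum_distrib_left)
  also have "\<dots> \<le> 2 * \<epsilon> N + 2 * \<epsilon> M"
  proof -
    have "(\<Sum>m\<in>?B. (1 - fejer_mult L m)\<^sup>2 * ?q m) \<le> \<epsilon> L" for L
    proof -
      have "(\<Sum>m\<in>?B. (1 - fejer_mult L m)\<^sup>2 * ?q m) = (LINT k|K. indicator ?B k * ((1 - fejer_mult L k)\<^sup>2 * ?q k))"
        by (rule integral_count_space_indicator(2)[symmetric]) simp
      also have "\<dots> \<le> \<epsilon> L"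
        unfolding \<epsilon>_def
        by (rule integral_mono_nonneg_bound[OF fejer_defect_integrable[OF q_integrable]])
          (auto simp: indicator_def q_nonneg)
      finally show ?thesis .
    qed
    from this[of N] this[of M] show ?thesis by linarith
  qed
  finally show ?thesis .
qed

lemma UP: "square_integrable P (\<lambda>p. U (fst p) (snd p))"
proof (rule square_integrableP(1)[where B = "C * T"])
  show "(\<lambda>p. U (fst p) (snd p)) \<in> borel_measurable P" by (intro U_measurable fst_snd_measurable)
  have "(\<integral>\<^sup>+t. \<integral>\<^sup>+x. ennreal ((U t x)\<^sup>2) \<partial>X \<partial>I) \<le> (\<integral>\<^sup>+t. ennreal C \<partial>I)"
    by (intro nn_integral_mono, subst nn_integral_eq_integral[OF square_integrable_square[OF U_sq]])
      (auto intro: ennreal_leI U_bound)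
  also have "\<dots> = ennreal (C * T)"
    using T_pos C_nonneg by (simp add: emeasure_restrict_space ennreal_mult)
  finally show "(\<integral>\<^sup>+t. \<integral>\<^sup>+x. ennreal ((U t x)\<^sup>2) \<partial>X \<partial>I) \<le> ennreal (C * T)" .
qed (use T_pos C_nonneg in simp)

lemma mU_sq [simp]: "square_integrable X (mU N t)"
  unfolding mU_def[abs_def] by simp

lemma mU_P: "square_integrable P (\<lambda>p. mU N (fst p) (snd p))"
proof -
  obtain B where "\<And>t x. \<bar>mU N t x\<bar> \<le> B" using mU_bounded by blast
  then show ?thesis
    by (intro P.square_integrable_bounded[where C = B] mU_measurable fst_snd_measurable) auto
qed

text \<open>Dominated convergence twice: over the modes at fixed t, where the multipliers tend to 1,
  and then over time with the constant bound C.\<close>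

lemma U_minus_mU_tendsto: "(\<lambda>N. integral\<^sup>L P (\<lambda>p. (U (fst p) (snd p) - mU N (fst p) (snd p))\<^sup>2)) \<longlonglongrightarrow> 0"
proof -
  have coef: "torus.coef (\<lambda>x. U t x - mU N t x) k = (1 - fejer_mult N k) * a k t" for t N k
  proof -
    have "torus.coef (mU N t) k = fejer_mult N k * a k t"
      unfolding mU_def[abs_def] by (subst torus.coef_comb) (auto simp: fejer_mult_outside)
    then show ?thesis
      using torus.coef_diff[OF U_sq mU_sq, of t N t k] by (simp add: a_def left_diff_distrib)
  qed
  have aK: "integrable K (\<lambda>k. (a k t)\<^sup>2)" for t
    using square_integrable_square[OF torus.square_summable_coef(1)[OF U_sq]] by (simp add: a_def)
  have slice: "(LINT x|X. (U t x - mU N t x)\<^sup>2) = (LINT k|K. (1 - fejer_mult N k)\<^sup>2 * (a k t)\<^sup>2)" for t N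
    using torus.Parseval_square[OF square_integrable_diff[OF U_sq mU_sq], of t N t] by (simp add: coef power_mult_distrib)
  have slice_le: "\<bar>LINT x|X. (U t x - mU N t x)\<^sup>2\<bar> \<le> C" for t N
  proof -
    have "(LINT x|X. (U t x - mU N t x)\<^sup>2) \<le> (LINT k|K. (a k t)\<^sup>2)"
      unfolding slice
      by (rule integral_mono_nonneg_bound[OF aK]) (use fejer_defect in \<open>auto intro!: mult_left_le_one_le\<close>)
    also have "\<dots> \<le> C"
      using torus.Bessel[OF U_sq, of t] U_bound[of t] by (simp add: a_def)
    finally show ?thesis by simp
  qed
  have m: "(\<lambda>t. LINT x|X. (U t x - mU N t x)\<^sup>2) \<in> borel_measurable I" for N
    using IX.integrable_fst'[OF square_integrable_square[OF square_integrable_diff[OF UP mU_P]]] by auto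
  have "(\<lambda>N. LINT t|I. LINT x|X. (U t x - mU N t x)\<^sup>2) \<longlonglongrightarrow> (LINT t|I. 0)"
  proof (rule integral_dominated_convergence[where w = "\<lambda>t. C"])
    show "AE t in I. (\<lambda>N. LINT x|X. (U t x - mU N t x)\<^sup>2) \<longlonglongrightarrow> 0"
      unfolding slice by (intro AE_I2 fejer_defect_tendsto aK)
    show "AE t in I. norm (LINT x|X. (U t x - mU N t x)\<^sup>2) \<le> C" for N
      using slice_le by simp
  qed (use m in auto)
  then show ?thesis
    using IX.integral_fst'[OF square_integrable_square[OF square_integrable_diff[OF UP mU_P]]] by simp
qed

text \<open>By \<open>transport_antisymmetric\<close>, U may be replaced by U - \<open>mU N\<close>
  in Z without changing its value. The resulting product of (U - \<open>mU N\<close>) V with the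
  gradient of \<open>mU N\<close> is then shown to tend to zero.\<close>

lemma transport_vanishes: "(LINT k|K. LINT t|I. a k t * F k t) = 0"
proof -
  let ?L = "LINT k|K. LINT t|I. a k t * F k t"
  have aFi: "integrable I (\<lambda>t. a m t * F m t)" for m by (rule square_integrable_mult[OF a_sq F_sq])
  have pi: "integrable K (\<lambda>k. LINT t|I. a k t * F k t)"
    using KI.integrable_fst'[OF aF_pair] by simp
  have ZL: "(\<lambda>N. LINT t|I. Z N t) \<longlonglongrightarrow> ?L"
  proof -
    have "(LINT t|I. Z N t) = (LINT k|K. fejer_mult N k * (LINT t|I. a k t * F k t))" for N
    proof -
      have "(LINT t|I. Z N t) = (\<Sum>m\<in>fejer_supp N. fejer_mult N m * (LINT t|I. a m t * F m t))"
        unfolding Z_def by (subst Bochner_Integration.integral_sum) (auto intro: aFi)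
      also have "\<dots> = (\<Sum>m | fejer_mult N m * (LINT t|I. a m t * F m t) \<noteq> 0. fejer_mult N m * (LINT t|I. a m t * F m t))"
        by (rule sum.mono_neutral_right) (auto, metis fejer_mult_outside)
      also have "\<dots> = (LINT k|K. fejer_mult N k * (LINT t|I. a k t * F k t))"
      proof -
        have "{m. fejer_mult N m * (LINT t|I. a m t * F m t) \<noteq> 0} \<subseteq> fejer_supp N"
          using fejer_mult_outside by force
        then have "finite {m. fejer_mult N m * (LINT t|I. a m t * F m t) \<noteq> 0}"
          using finite_subset[OF _ finite_fejer_supp] by blast
        then show ?thesis by (subst lebesgue_integral_count_space_finite_support) auto
      qed
      finally show ?thesis .
    qed
    moreover have "(\<lambda>N. LINT k|K. fejer_mult N k * (LINT t|I. a k t * F k t)) \<longlonglongrightarrow> ?L"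
    proof (rule integral_dominated_convergence[where w = "\<lambda>k. \<bar>LINT t|I. a k t * F k t\<bar>"])
      have "(\<lambda>N. fejer_mult N k * (LINT t|I. a k t * F k t)) \<longlonglongrightarrow> 1 * (LINT t|I. a k t * F k t)" for k
        by (intro tendsto_intros fejer_mult_tendsto)
      then show "AE k in K. (\<lambda>N. fejer_mult N k * (LINT t|I. a k t * F k t)) \<longlonglongrightarrow> (LINT t|I. a k t * F k t)" by simp
      show "AE k in K. norm (fejer_mult N k * (LINT t|I. a k t * F k t)) \<le> \<bar>LINT t|I. a k t * F k t\<bar>" for N
        by (auto simp: abs_mult fejer_mult_le_1 intro!: mult_left_le_one_le)
    qed (use pi in auto)
    ultimately show ?thesis by simp
  qed
  let ?R = "\<lambda>N p. U (fst p) (snd p) - mU N (fst p) (snd p)"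
  let ?V = "\<lambda>j p. V (fst p) (snd p) $ j" and ?D = "\<lambda>j N p. mD j N (fst p) (snd p)"
  \<comment> \<open>U V and \<open>mU N\<close> times V both have squared norm at most
    \<open>n_int\<close> in each component; the 4 comes from (x - y)^2 <= 2 x^2 + 2 y^2.\<close>
  have RV: "square_integrable P (\<lambda>p. ?R N p * ?V j p)" "integral\<^sup>L P (\<lambda>p. (?R N p * ?V j p)\<^sup>2) \<le> 4 * n_int" if "0 < N" for N j
  proof -
    have eq: "?R N p * ?V j p = W j (fst p) (snd p) + (- 1) * (mU N (fst p) (snd p) * ?V j p)" for p
      by (simp add: W_def left_diff_distrib)
    show "square_integrable P (\<lambda>p. ?R N p * ?V j p)"
      unfolding eq by (intro square_integrable_add square_integrable_cmult WP mU_V_P that)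
    show "integral\<^sup>L P (\<lambda>p. (?R N p * ?V j p)\<^sup>2) \<le> 4 * n_int"
      using square_integral_add_le[OF WP(1) square_integrable_cmult[OF mU_V_P(1)[OF that]], of j "- 1" j] WP(2)[of j] mU_V_P(2)[OF that, of j]
      unfolding eq by simp
  qed
  have Zeq: "(LINT t|I. Z N t) = (\<Sum>j\<in>UNIV. integral\<^sup>L P (\<lambda>p. ?R N p * ?V j p * ?D j N p))" if N: "0 < N" for N
  proof -
    have int: "integrable P (\<lambda>p. ?R N p * ?V j p * ?D j N p)" for j
      by (rule square_integrable_mult[OF RV(1)[OF N] mD_P])
    have slice: "(\<Sum>j\<in>UNIV. LINT x|X. (U t x - mU N t x) * V t x $ j * mD j N t x) = Z N t" for t
    proof -
      obtain B where B: "\<And>t x. \<bar>mU N t x\<bar> \<le> B" using mU_bounded by blast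
      have UV: "square_integrable X (\<lambda>x. mU N t x * V t x $ j)" for j
        by (rule square_integrable_bounded_mult[OF Vj_sq _ B]) (use mU_sq in auto)
      have "(LINT x|X. (U t x - mU N t x) * V t x $ j * mD j N t x)
          = (LINT x|X. W j t x * mD j N t x) - (LINT x|X. mU N t x * V t x $ j * mD j N t x)" for j
        using square_integrable_mult[OF W_sq mD_sq, of j t j N t] square_integrable_mult[OF UV mD_sq, of j j N t]
        by (subst Bochner_Integration.integral_diff[symmetric]) (auto simp: W_def left_diff_distrib)
      then have "(\<Sum>j\<in>UNIV. LINT x|X. (U t x - mU N t x) * V t x $ j * mD j N t x) = (\<Sum>j\<in>UNIV. LINT x|X. W j t x * mD j N t x)"
        using transport_antisymmetric[of N t] by (simp add: sum_subtractf)
      also have "\<dots> = (\<Sum>j\<in>UNIV. \<Sum>m\<in>fejer_supp N. fejer_mult N m * (2 * pi * real_of_int (m $ j) * a m t) * \<beta> j (- m) t)"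
      proof (rule sum.cong[OF refl])
        fix j
        have "(LINT x|X. W j t x * mD j N t x) = (LINT x|X. (\<Sum>m\<in>fejer_supp N. fejer_mult N m * (2 * pi * real_of_int (m $ j) * a m t) * (W j t x * hartley (- m) x)))"
          by (simp add: mD_def sum_distrib_left mult_ac)
        also have "\<dots> = (\<Sum>m\<in>fejer_supp N. fejer_mult N m * (2 * pi * real_of_int (m $ j) * a m t) * \<beta> j (- m) t)"
          by (subst Bochner_Integration.integral_sum)
            (auto simp: \<beta>_def torus.coef_def intro!: integrable_mult_right square_integrable_mult)
        finally show "(LINT x|X. W j t x * mD j N t x) = (\<Sum>m\<in>fejer_supp N. fejer_mult N m * (2 * pi * real_of_int (m $ j) * a m t) * \<beta> j (- m) t)" .
      qed
      also have "\<dots> = Z N t"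
        unfolding Z_def F_eq by (subst sum.swap) (simp add: sum_distrib_left mult_ac)
      finally show ?thesis .
    qed
    have "(\<Sum>j\<in>UNIV. integral\<^sup>L P (\<lambda>p. ?R N p * ?V j p * ?D j N p))
        = (\<Sum>j\<in>UNIV. LINT t|I. LINT x|X. (U t x - mU N t x) * V t x $ j * mD j N t x)"
      using IX.integral_fst'[OF int] by simp
    also have "\<dots> = (LINT t|I. (\<Sum>j\<in>UNIV. LINT x|X. (U t x - mU N t x) * V t x $ j * mD j N t x))"
      using IX.integrable_fst'[OF int] by (intro Bochner_Integration.integral_sum[symmetric]) simp
    finally show ?thesis by (simp only: slice)
  qed
  obtain B where B: "\<And>j N t x. \<bar>mD j N t x\<bar> \<le> B j N" using mD_bounded by metis
  let ?r = "\<lambda>N. integral\<^sup>L P (\<lambda>p. (?R N p)\<^sup>2)"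
  let ?x = "\<lambda>M N. \<Sum>j\<in>UNIV. sqrt (?r N * integral\<^sup>L P (\<lambda>p. (?D j M p * ?V j p)\<^sup>2))"
  show ?thesis
  \<comment> \<open>There is one Cauchy-Schwarz remainder per coordinate, which gives c, and k is
    the bound from \<open>RV\<close>.\<close>
  proof (rule LIMSEQ_zero_by_approximation[OF ZL \<epsilon>_tendsto, where x = ?x and c = "real CARD('n)" and k = "4 * n_int"])
    fix M
    have "(\<lambda>N. ?x M N) \<longlonglongrightarrow> (\<Sum>j\<in>(UNIV::'n set). sqrt (0 * integral\<^sup>L P (\<lambda>p. (?D j M p * ?V j p)\<^sup>2)))"
      by (intro tendsto_intros U_minus_mU_tendsto)
    then show "(\<lambda>N. ?x M N) \<longlonglongrightarrow> 0" by simp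
    fix N :: nat assume N: "0 < N"
    have "\<bar>integral\<^sup>L P (\<lambda>p. ?R N p * ?V j p * ?D j N p)\<bar>
        \<le> sqrt (?r N * integral\<^sup>L P (\<lambda>p. (?D j M p * ?V j p)\<^sup>2)) + sqrt (4 * n_int * (2 * \<epsilon> N + 2 * \<epsilon> M))" for j
    proof -
      have DV: "square_integrable P (\<lambda>p. ?D j M p * ?V j p)"
        by (rule square_integrable_bounded_mult[OF V_P _ B]) (use mD_P in auto)
      have R: "square_integrable P (?R N)" by (rule square_integrable_diff[OF UP mU_P])
      have dD: "square_integrable P (\<lambda>p. ?D j N p - ?D j M p)" by (rule square_integrable_diff[OF mD_P mD_P])
      \<comment> \<open>The derivative is split at a fixed index M. Against the bounded derivative
        at M, the convergence of U - \<open>mU N\<close> to zero in L^2 suffices; the rest pairs the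
        bounded (U - \<open>mU N\<close>) V with a small difference of gradients.\<close>
      have "integral\<^sup>L P (\<lambda>p. ?R N p * ?V j p * ?D j N p)
          = integral\<^sup>L P (\<lambda>p. ?R N p * (?D j M p * ?V j p) + ?R N p * ?V j p * (?D j N p - ?D j M p))"
        by (simp add: algebra_simps)
      also have "\<dots> = integral\<^sup>L P (\<lambda>p. ?R N p * (?D j M p * ?V j p)) + integral\<^sup>L P (\<lambda>p. ?R N p * ?V j p * (?D j N p - ?D j M p))"
        by (rule Bochner_Integration.integral_add[OF square_integrable_mult[OF R DV] square_integrable_mult[OF RV(1)[OF N] dD]])
      finally have split: "integral\<^sup>L P (\<lambda>p. ?R N p * ?V j p * ?D j N p)
        = integral\<^sup>L P (\<lambda>p. ?R N p * (?D j M p * ?V j p)) + integral\<^sup>L P (\<lambda>p. ?R N p * ?V j p * (?D j N p - ?D j M p))" .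
      have 1: "\<bar>integral\<^sup>L P (\<lambda>p. ?R N p * (?D j M p * ?V j p))\<bar> \<le> sqrt (?r N * integral\<^sup>L P (\<lambda>p. (?D j M p * ?V j p)\<^sup>2))"
        using Cauchy_Schwarz_integral[OF R DV] by (intro real_le_rsqrt) simp
      have 2: "\<bar>integral\<^sup>L P (\<lambda>p. ?R N p * ?V j p * (?D j N p - ?D j M p))\<bar> \<le> sqrt (4 * n_int * (2 * \<epsilon> N + 2 * \<epsilon> M))"
      proof (rule real_le_rsqrt)
        have "\<bar>integral\<^sup>L P (\<lambda>p. ?R N p * ?V j p * (?D j N p - ?D j M p))\<bar>\<^sup>2
            \<le> integral\<^sup>L P (\<lambda>p. (?R N p * ?V j p)\<^sup>2) * integral\<^sup>L P (\<lambda>p. (?D j N p - ?D j M p)\<^sup>2)"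
          using Cauchy_Schwarz_integral[OF RV(1)[OF N] dD, of j] by simp
        also have "\<dots> \<le> 4 * n_int * (2 * \<epsilon> N + 2 * \<epsilon> M)"
          using n_int(2) by (intro mult_mono RV(2)[OF N] mD_diff_P) auto
        finally show "\<bar>integral\<^sup>L P (\<lambda>p. ?R N p * ?V j p * (?D j N p - ?D j M p))\<bar>\<^sup>2 \<le> 4 * n_int * (2 * \<epsilon> N + 2 * \<epsilon> M)" .
      qed
      show ?thesis using split 1 2 by linarith
    qed
    then have "(\<Sum>j\<in>UNIV. \<bar>integral\<^sup>L P (\<lambda>p. ?R N p * ?V j p * ?D j N p)\<bar>)
        \<le> (\<Sum>j\<in>(UNIV::'n set). sqrt (?r N * integral\<^sup>L P (\<lambda>p. (?D j M p * ?V j p)\<^sup>2)) + sqrt (4 * n_int * (2 * \<epsilon> N + 2 * \<epsilon> M)))"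
      by (intro sum_mono)
    also have "\<dots> = ?x M N + real CARD('n) * sqrt (4 * n_int * (2 * \<epsilon> N + 2 * \<epsilon> M))"
      by (simp add: sum.distrib)
    finally have "(\<Sum>j\<in>UNIV. \<bar>integral\<^sup>L P (\<lambda>p. ?R N p * ?V j p * ?D j N p)\<bar>)
      \<le> ?x M N + real CARD('n) * sqrt (4 * n_int * (2 * \<epsilon> N + 2 * \<epsilon> M))" .
    then show "\<bar>LINT t|I. Z N t\<bar> \<le> ?x M N + real CARD('n) * sqrt (4 * n_int * (2 * \<epsilon> N + 2 * \<epsilon> M))"
      unfolding Zeq[OF N] by (rule order_trans[OF sum_abs])
  qed
qed

lemma energy_identity:
  "1 / 2 * (LINT k|K. (A k T)\<^sup>2) + (LINT t|I. LINT k|K. freq k * (a k t)\<^sup>2) = 1 / 2 * (LINT x|X. (u0 x)\<^sup>2)"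
proof -
  have "integral\<^sup>L (K \<Otimes>\<^sub>M I) (\<lambda>(k, t). freq k * (a k t)\<^sup>2) = (LINT t|I. LINT k|K. freq k * (a k t)\<^sup>2)"
    using KI.integral_snd[OF freq_a_pair] by simp
  moreover have "integral\<^sup>L (K \<Otimes>\<^sub>M I) (\<lambda>(k, t). a k t * F k t) = 0"
    using KI.integral_fst'[OF aF_pair] transport_vanishes by simp
  ultimately show ?thesis using energy_with_transport by simp
qed

end

section \<open>Complete measures\<close>

text \<open>Preimages under f and g differ by a null set, and Lebesgue measure is complete.\<close>

lemma borel_measurable_lebesgue_on_AE:
  fixes f g :: "'a::euclidean_space \<Rightarrow> 'b::euclidean_space"
  assumes f: "f \<in> borel_measurable (lebesgue_on S)" and S: "S \<in> sets borel"
    and ae: "AE x in lebesgue_on S. f x = g x"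
  shows "g \<in> borel_measurable (lebesgue_on S)"
proof -
  let ?f = "\<lambda>x. if x \<in> S then f x else 0" and ?g = "\<lambda>x. if x \<in> S then g x else 0"
  have fm: "?f \<in> borel_measurable lebesgue"
    using borel_measurable_if_I[OF f] S by simp
  have "AE x in lebesgue. x \<in> S \<longrightarrow> f x = g x"
    using ae S by (simp add: AE_restrict_space_iff)
  then have ae': "AE x in lebesgue. ?f x = ?g x"
    by eventually_elim simp
  have "?g \<in> borel_measurable lebesgue"
  proof (rule measurableI)
    fix A :: "'b set" assume A: "A \<in> sets borel"
    have "?f -` A \<inter> space lebesgue \<in> sets lebesgue" by (rule measurable_sets[OF fm A])
    moreover have "AE x in lebesgue. x \<in> ?f -` A \<longleftrightarrow> x \<in> ?g -` A"
      using ae' by eventually_elim (simp only: vimage_eq)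
    ultimately show "?g -` A \<inter> space lebesgue \<in> sets lebesgue"
      using completion.in_sets_AE[of "?f -` A" "?g -` A"] by simp
  qed simp
  then show ?thesis by (rule borel_measurable_if_D)
qed

text \<open>By completeness either both functions are measurable or neither is, and in the second
  case both integrals are 0 by convention. This permits rewriting under the integral when no
  measurability is at hand.\<close>

lemma integral_lebesgue_on_cong_AE:
  fixes f g :: "'a::euclidean_space \<Rightarrow> real"
  assumes S: "S \<in> sets borel" and ae: "AE x in lebesgue_on S. f x = g x"
  shows "(LINT x|lebesgue_on S. f x) = (LINT x|lebesgue_on S. g x)"
proof (cases "f \<in> borel_measurable (lebesgue_on S)")
  case True
  show ?thesis by (rule integral_cong_AE[OF True borel_measurable_lebesgue_on_AE[OF True S ae] ae])
next
  case False
  have "AE x in lebesgue_on S. g x = f x" using ae by eventually_elim simp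
  then have "g \<notin> borel_measurable (lebesgue_on S)"
    using False borel_measurable_lebesgue_on_AE[OF _ S] by blast
  with False have "\<not> integrable (lebesgue_on S) f" "\<not> integrable (lebesgue_on S) g" by auto
  then show ?thesis by (simp add: not_integrable_integral_eq)
qed

text \<open>A difference at T would by continuity persist on an interval ending at T, which has
  positive measure.\<close>

lemma AE_eq_continuous_imp_eq:
  fixes f g :: "real \<Rightarrow> real"
  assumes T: "0 < T" and f: "continuous_on {0..T} f" and g: "continuous_on {0..T} g"
    and ae: "AE t in lebesgue_on {0..T}. f t = g t"
  shows "f T = g T"
proof (rule ccontr)
  assume ne: "f T \<noteq> g T"
  have "continuous_on {0..T} (\<lambda>t. f t - g t)" by (intro continuous_on_diff f g)
  then obtain d where d: "0 < d" "\<And>t. t \<in> {0..T} \<Longrightarrow> dist t T < d \<Longrightarrow> dist (f t - g t) (f T - g T) < \<bar>f T - g T\<bar>"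
    using ne T unfolding continuous_on_iff by (metis abs_eq_0 atLeastAtMost_iff diff_self eq_iff_diff_eq_0 less_eq_real_def zero_less_abs_iff)
  define s where "s = max 0 (T - d / 2)"
  have s: "0 \<le> s" "s < T" "T - s < d" using T d(1) by (auto simp: s_def)
  have "f t \<noteq> g t" if "t \<in> {s..T}" for t
    using d(2)[of t] that s by (auto simp: dist_real_def)
  moreover have "AE t in lborel. t \<in> {0..T} \<longrightarrow> f t = g t"
    using ae by (simp add: AE_lebesgue_on_iff)
  ultimately have "AE t in lborel. t \<notin> {s..T}"
    using s by (auto elim!: eventually_mono)
  then have "emeasure lborel {s..T} = 0"
    by (subst (asm) AE_iff_measurable[of "{s..T}"]) auto
  then show False using s by simp
qed

section \<open>Estimates in Lebesgue spaces\<close>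

text \<open>\<open>\<integral> young r (f / c) \<le> 1\<close> expresses \<open>\<parallel>f\<parallel>\<^sub>r \<le> c\<close> uniformly in \<open>r \<in> [1,\<infinity>]\<close>.\<close>

definition young :: "ennreal \<Rightarrow> real \<Rightarrow> ennreal" where
  "young r y = (if r = \<infinity> then (if \<bar>y\<bar> \<le> 1 then 0 else \<infinity>) else ennreal (\<bar>y\<bar> powr enn2real r))"

lemma young_measurable [measurable]: "young r \<in> borel_measurable borel"
  unfolding young_def[abs_def] by measurable

lemma ennreal_one_div: "1 \<le> r \<Longrightarrow> r \<noteq> \<infinity> \<Longrightarrow> 1 / r = ennreal (1 / enn2real r)" for r :: ennreal
  by (cases r) (auto simp: divide_ennreal[symmetric] ennreal_1[symmetric] simp del: ennreal_1)

text \<open>Let m be the right-hand side, assumed finite. Then |y| <= m^(1/q) and |z| <= m^(1/p), so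
  the left-hand side is at most m^(2/p + 2/q), which is at most m because m >= 1 and the exponent is
  at most 1. The summand 1 thus absorbs a strict inequality between the exponents, and 1 / infinity
  = 0 covers infinite ones.\<close>

lemma young_pointwise:
  assumes p: "1 \<le> p" and q: "1 \<le> q" and pq: "1 / p + 1 / q \<le> (1 / 2 :: ennreal)"
  shows "ennreal (y\<^sup>2 * z\<^sup>2) \<le> 1 + young q y + young p z"
proof (cases "young q y = \<infinity> \<or> young p z = \<infinity>")
  case True
  then show ?thesis by auto
next
  case False
  define ip iq where "ip = enn2real (1 / p)" and "iq = enn2real (1 / q)"
  define m where "m = 1 + enn2real (young q y) + enn2real (young p z)"
  have m1: "1 \<le> m" by (simp add: m_def)
  have half: "(1 / 2 :: ennreal) = ennreal (1 / 2)" using divide_ennreal[of 1 2] by simp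
  have "1 / p \<le> 1 / p + 1 / q" "1 / q \<le> 1 / p + 1 / q" by auto
  then have le: "1 / p \<le> ennreal (1 / 2)" "1 / q \<le> ennreal (1 / 2)"
    using order_trans[OF _ pq] unfolding half by blast+
  have fin: "1 / p < \<infinity>" "1 / q < \<infinity>"
    using le_less_trans[OF le(1) ennreal_less_top] le_less_trans[OF le(2) ennreal_less_top] by simp_all
  have ipq: "ip + iq \<le> 1 / 2"
  proof -
    have "ennreal (ip + iq) = 1 / p + 1 / q"
      using fin by (simp add: ip_def iq_def)
    also have "\<dots> \<le> ennreal (1 / 2)" using pq unfolding half .
    finally show ?thesis by (subst (asm) ennreal_le_iff) auto
  qed
  have key: "\<bar>x\<bar> \<le> m powr enn2real (1 / r)"
    if r: "1 \<le> r" and f: "young r x \<noteq> \<infinity>" and le: "enn2real (young r x) \<le> m" for r x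
  proof (cases "r = \<infinity>")
    case True
    then have "\<bar>x\<bar> \<le> 1" using f by (auto simp: young_def split: if_splits)
    then show ?thesis using True m1 by simp
  next
    case False
    define s where "s = enn2real r"
    have s: "1 \<le> s" using r False by (cases r) (auto simp: s_def)
    have "enn2real (1 / r) = 1 / s" using ennreal_one_div[OF r False] s by (simp add: s_def)
    moreover have "\<bar>x\<bar> powr s \<le> m" using le False by (simp add: young_def s_def)
    then have "(\<bar>x\<bar> powr s) powr (1 / s) \<le> m powr (1 / s)" using s by (intro powr_mono2) auto
    then have "\<bar>x\<bar> \<le> m powr (1 / s)" using s by (simp add: powr_powr)
    ultimately show ?thesis by simp
  qed
  have y: "\<bar>y\<bar> \<le> m powr iq" unfolding iq_def by (rule key[OF q]) (use False in \<open>auto simp: m_def\<close>)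
  have z: "\<bar>z\<bar> \<le> m powr ip" unfolding ip_def by (rule key[OF p]) (use False in \<open>auto simp: m_def\<close>)
  have "y\<^sup>2 * z\<^sup>2 = (\<bar>y\<bar> * \<bar>z\<bar>)\<^sup>2" by (simp add: power_mult_distrib)
  also have "\<dots> \<le> (m powr iq * m powr ip)\<^sup>2" by (intro power_mono mult_mono y z) auto
  also have "\<dots> = m powr (2 * (ip + iq))"
    using m1 by (simp add: power2_eq_square powr_add[symmetric] algebra_simps)
  also have "\<dots> \<le> m powr 1" using m1 ipq by (intro powr_mono) auto
  also have "\<dots> = m" using m1 by simp
  finally have "ennreal (y\<^sup>2 * z\<^sup>2) \<le> ennreal m" by (rule ennreal_leI)
  also have "\<dots> = 1 + young q y + young p z"
    using False by (simp add: m_def top.not_eq_extremum)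
  finally show ?thesis .
qed

lemma nn_integral_young_le_1:
  fixes f :: "'a \<Rightarrow> 'b::euclidean_space"
  assumes r: "1 \<le> r" and [measurable]: "f \<in> borel_measurable M" and c: "0 < c"
    and le: "Lp_enorm r M (\<lambda>x. ennreal (norm (f x))) \<le> ennreal c"
  shows "(\<integral>\<^sup>+x. young r (norm (f x) / c) \<partial>M) \<le> 1"
proof (cases "r = \<infinity>")
  case True
  have "AE x in M. ennreal (norm (f x)) \<le> esssup M (\<lambda>x. ennreal (norm (f x)))"
    by (rule esssup_AE)
  then have "AE x in M. young r (norm (f x) / c) = 0"
  proof eventually_elim
    fix x assume "ennreal (norm (f x)) \<le> esssup M (\<lambda>x. ennreal (norm (f x)))"
    also have "\<dots> \<le> ennreal c" using le True by (simp add: Lp_enorm_def)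
    finally have "norm (f x) \<le> c" using c by simp
    then show "young r (norm (f x) / c) = 0" using c True by (simp add: young_def)
  qed
  then have "(\<integral>\<^sup>+x. young r (norm (f x) / c) \<partial>M) = (\<integral>\<^sup>+x. 0 \<partial>M)" by (rule nn_integral_cong_AE)
  then show ?thesis by simp
next
  case False
  define s where "s = enn2real r"
  have s: "1 \<le> s" using r False by (cases r) (auto simp: s_def)
  let ?J = "\<integral>\<^sup>+x. ennreal (norm (f x) powr s) \<partial>M"
  have "ennreal_powr ?J (1 / s) \<le> ennreal c"
    using le False by (simp add: Lp_enorm_def s_def ennreal_powr_def)
  then have J: "?J \<noteq> \<infinity>" "enn2real ?J powr (1 / s) \<le> c"
    using c by (auto simp: ennreal_powr_def top_unique split: if_splits)
  have "(enn2real ?J powr (1 / s)) powr s \<le> c powr s" using J(2) s by (intro powr_mono2) auto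
  then have "enn2real ?J \<le> c powr s" using s by (simp add: powr_powr)
  then have "?J \<le> ennreal (c powr s)" using J(1) by (metis ennreal_enn2real_if ennreal_leI infinity_ennreal_def)
  have "(\<integral>\<^sup>+x. young r (norm (f x) / c) \<partial>M) = (\<integral>\<^sup>+x. ennreal (1 / c powr s) * ennreal (norm (f x) powr s) \<partial>M)"
    using False c by (intro nn_integral_cong) (simp add: young_def s_def powr_divide ennreal_mult[symmetric])
  also have "\<dots> = ennreal (1 / c powr s) * ?J" by (rule nn_integral_cmult) measurable
  also have "\<dots> \<le> ennreal (1 / c powr s) * ennreal (c powr s)" by (intro mult_left_mono \<open>?J \<le> _\<close>) simp
  also have "\<dots> = 1" using c by (simp add: ennreal_mult[symmetric])
  finally show ?thesis .
qed

lemma Lp_enorm_cong_AE: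
  assumes f: "f \<in> borel_measurable M" and g: "g \<in> borel_measurable M" and ae: "AE x in M. f x = g x"
  shows "Lp_enorm r M f = Lp_enorm r M g"
proof (cases "r = \<infinity>")
  case True
  have ae': "AE x in M. g x = f x" using ae by eventually_elim simp
  have "esssup M f = esssup M g"
    using f g ae ae' by (intro antisym esssup_AE_mono) (auto elim: eventually_mono)
  then show ?thesis using True by (simp add: Lp_enorm_def)
next
  case False
  have "(\<integral>\<^sup>+x. ennreal_powr (f x) (enn2real r) \<partial>M) = (\<integral>\<^sup>+x. ennreal_powr (g x) (enn2real r) \<partial>M)"
    by (rule nn_integral_cong_AE, use ae in eventually_elim) simp
  then show ?thesis using False by (simp add: Lp_enorm_def)
qed

lemma ennreal_powr_measurable [measurable (raw)]:
  "f \<in> borel_measurable M \<Longrightarrow> (\<lambda>x. ennreal_powr (f x) r) \<in> borel_measurable M"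
proof -
  have "{a :: ennreal. a = \<infinity>} \<in> sets borel" by (rule borel_closed) simp
  then have "(\<lambda>a. ennreal_powr a r) \<in> borel_measurable borel"
    unfolding ennreal_powr_def by (intro measurable_If) auto
  then show "f \<in> borel_measurable M \<Longrightarrow> (\<lambda>x. ennreal_powr (f x) r) \<in> borel_measurable M"
    by (rule measurable_compose[rotated])
qed

text \<open>For finite r this is Tonelli. For infinite r, the essential supremum exceeds y exactly
  if the set where f exceeds y has positive measure, and that measure is again a Tonelli
  integral.\<close>

lemma Lp_enorm_measurable:
  assumes M: "sigma_finite_measure M"
    and f [measurable]: "(\<lambda>p. f (fst p) (snd p)) \<in> borel_measurable (N \<Otimes>\<^sub>M M)"
  shows "(\<lambda>t. Lp_enorm r M (f t)) \<in> borel_measurable N"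
proof -
  interpret sigma_finite_measure M by (rule M)
  have slice: "f t \<in> borel_measurable M" if "t \<in> space N" for t
    using measurable_compose[OF measurable_Pair1'[OF that] f] by simp
  show ?thesis
  proof (cases "r = \<infinity>")
    case True
    have "(\<lambda>t. esssup M (f t)) \<in> borel_measurable N"
    proof (rule borel_measurableI_greater)
      fix y
      have "{t \<in> space N. y < esssup M (f t)} = {t \<in> space N. 0 < (\<integral>\<^sup>+x. indicator {y<..} (f t x) \<partial>M)}"
      proof (rule Collect_cong, rule conj_cong[OF refl])
        fix t assume t: "t \<in> space N"
        note [measurable] = slice[OF t]
        have "(\<integral>\<^sup>+x. indicator {y<..} (f t x) \<partial>M) = 0 \<longleftrightarrow> (AE x in M. f t x \<le> y)"
          by (subst nn_integral_0_iff_AE) (auto simp: indicator_def not_less)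
        moreover have "(AE x in M. f t x \<le> y) \<longleftrightarrow> esssup M (f t) \<le> y"
        proof
          assume "AE x in M. f t x \<le> y"
          then show "esssup M (f t) \<le> y" by (rule esssup_I[OF slice[OF t]])
        next
          assume le: "esssup M (f t) \<le> y"
          show "AE x in M. f t x \<le> y"
            using esssup_AE[of "f t" M] by eventually_elim (rule order_trans[OF _ le])
        qed
        ultimately show "y < esssup M (f t) \<longleftrightarrow> 0 < (\<integral>\<^sup>+x. indicator {y<..} (f t x) \<partial>M)"
          by (simp add: not_le[symmetric] zero_less_iff_neq_zero)
      qed
      moreover have "(\<lambda>t. \<integral>\<^sup>+x. indicator {y<..} (f t x) \<partial>M) \<in> borel_measurable N"
      proof (rule borel_measurable_nn_integral)
        have "(\<lambda>p. indicator {y<..} (f (fst p) (snd p)) :: ennreal) \<in> borel_measurable (N \<Otimes>\<^sub>M M)"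
          by (rule measurable_compose[OF f]) simp
        then show "(\<lambda>(t, x). indicator {y<..} (f t x) :: ennreal) \<in> borel_measurable (N \<Otimes>\<^sub>M M)"
          by (simp add: split_beta')
      qed
      then have "{t \<in> space N. 0 < (\<integral>\<^sup>+x. indicator {y<..} (f t x) \<partial>M)} \<in> sets N"
        by (rule borel_measurable_less[OF borel_measurable_const])
      ultimately show "{t \<in> space N. y < esssup M (f t)} \<in> sets N" by simp
    qed
    then show ?thesis using True by (simp add: Lp_enorm_def)
  next
    case False
    have "(\<lambda>t. \<integral>\<^sup>+x. ennreal_powr (f t x) (enn2real r) \<partial>M) \<in> borel_measurable N"
    proof (rule borel_measurable_nn_integral)
      show "(\<lambda>(t, x). ennreal_powr (f t x) (enn2real r)) \<in> borel_measurable (N \<Otimes>\<^sub>M M)"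
        using ennreal_powr_measurable[OF f] by (simp add: split_beta')
    qed
    then show ?thesis using False by (simp add: Lp_enorm_def ennreal_powr_measurable)
  qed
qed

lemma ennreal_powr_half_2: "ennreal_powr (ennreal_powr a (1 / 2)) 2 = a"
proof (cases "a = \<infinity>")
  case False
  then show ?thesis by (cases a) (auto simp: ennreal_powr_def powr_powr)
qed (simp add: ennreal_powr_def)

lemma ennreal_powr_less_top: "ennreal_powr a r < top \<longleftrightarrow> a < top"
  by (cases a) (auto simp: ennreal_powr_def)

lemma ennreal_powr_norm_2: "ennreal_powr (ennreal (norm y)) 2 = ennreal ((norm y)\<^sup>2)"
  by (simp add: ennreal_powr_def)

lemma Lp_enorm_2: "Lp_enorm 2 M (\<lambda>x. ennreal (norm (f x))) = ennreal_powr (\<integral>\<^sup>+x. ennreal ((norm (f x))\<^sup>2) \<partial>M) (1 / 2)"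
  by (simp add: Lp_enorm_def ennreal_powr_norm_2)

lemma torus_Lp_2_iff:
  fixes f :: "real^'n \<Rightarrow> real"
  shows "torus_Lp 2 f \<longleftrightarrow> torus_periodic f \<and> square_integrable torus f"
  unfolding torus_Lp_def Lp_enorm_2 infinity_ennreal_def ennreal_powr_less_top square_integrable_def
  by (auto simp: integrable_iff_bounded)

lemma Lr_Lp_2_2I:
  fixes f :: "real \<Rightarrow> real^'n \<Rightarrow> 'b::euclidean_space"
  assumes "\<And>t. t \<in> {0..T} \<Longrightarrow> torus_periodic (f t)"
    and "(\<lambda>(t, x). f t x) \<in> borel_measurable (lebesgue_on ({0..T} \<times> cbox 0 1))"
    and "(\<integral>\<^sup>+t. \<integral>\<^sup>+x. ennreal ((norm (f t x))\<^sup>2) \<partial>torus \<partial>lebesgue_on {0..T}) < \<infinity>"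
  shows "Lr_Lp T 2 2 f"
proof -
  have "Lp_enorm 2 (lebesgue_on {0..T}) (\<lambda>t. Lp_enorm 2 torus (\<lambda>x. ennreal (norm (f t x))))
      = ennreal_powr (\<integral>\<^sup>+t. \<integral>\<^sup>+x. ennreal ((norm (f t x))\<^sup>2) \<partial>torus \<partial>lebesgue_on {0..T}) (1 / 2)"
    unfolding Lp_enorm_2 by (simp add: Lp_enorm_def ennreal_powr_half_2)
  then show ?thesis using assms by (auto simp: Lr_Lp_def ennreal_powr_less_top)
qed

text \<open>Both factors are normalised to norm at most 1, so each of the three summands of
  \<open>young_pointwise\<close> integrates to at most 1, whence the 3. The summand with f does not
  see the translation z, by periodicity.\<close>

lemma nn_integral_weighted_le:
  fixes f :: "real^'n \<Rightarrow> real" and g :: "real^'n \<Rightarrow> 'b::euclidean_space"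
  assumes p: "1 \<le> p" and q: "1 \<le> q" and pq: "1 / p + 1 / q \<le> (1 / 2 :: ennreal)"
    and f [measurable]: "f \<in> borel_measurable borel" and per: "torus_periodic f"
    and g [measurable]: "g \<in> borel_measurable borel"
    and c: "0 < c" "Lp_enorm q torus (\<lambda>x. ennreal (norm (f x))) \<le> ennreal c"
    and d: "0 < d" "Lp_enorm p torus (\<lambda>x. ennreal (norm (g x))) \<le> ennreal d"
  shows "(\<integral>\<^sup>+x. ennreal ((f (x - z))\<^sup>2) * ennreal ((norm (g x))\<^sup>2) \<partial>torus) \<le> ennreal (3 * c\<^sup>2 * d\<^sup>2)"
proof -
  have fX: "f \<in> borel_measurable torus" and gX: "g \<in> borel_measurable torus"
    by (auto intro: borel_imp_measurable_lebesgue_on f g)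
  have yf: "(\<integral>\<^sup>+x. young q (f (x - z) / c) \<partial>torus) \<le> 1"
  proof -
    have yabs: "young q (\<bar>y\<bar> / c) = young q (y / c)" for y
      using c(1) by (simp add: young_def abs_divide)
    have "(\<integral>\<^sup>+x. young q (f (- z + 1 *\<^sub>R x) / c) \<partial>torus) = (\<integral>\<^sup>+x. young q (f x / c) \<partial>torus)"
      by (rule nn_integral_torus_affine[where f = "\<lambda>x. young q (f x / c)"])
        (auto intro!: torus_periodicI simp: torus_periodic_ivec[OF per])
    then show ?thesis
      using nn_integral_young_le_1[OF q fX c] by (simp add: yabs)
  qed
  have yg: "(\<integral>\<^sup>+x. young p (norm (g x) / d) \<partial>torus) \<le> 1"
    by (rule nn_integral_young_le_1[OF p gX d])
  have m1: "(\<lambda>x. young q (f (x - z) / c)) \<in> borel_measurable torus" "(\<lambda>x. young p (norm (g x) / d)) \<in> borel_measurable torus"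
    by (auto intro!: borel_imp_measurable_lebesgue_on)
  have "(\<integral>\<^sup>+x. ennreal ((f (x - z))\<^sup>2) * ennreal ((norm (g x))\<^sup>2) \<partial>torus)
      \<le> (\<integral>\<^sup>+x. ennreal (c\<^sup>2 * d\<^sup>2) * (1 + young q (f (x - z) / c) + young p (norm (g x) / d)) \<partial>torus)"
  proof (rule nn_integral_mono)
    fix x
    have "ennreal ((f (x - z))\<^sup>2) * ennreal ((norm (g x))\<^sup>2)
        = ennreal (c\<^sup>2 * d\<^sup>2) * ennreal ((f (x - z) / c)\<^sup>2 * (norm (g x) / d)\<^sup>2)"
      using c(1) d(1) by (simp add: ennreal_mult[symmetric] power_divide)
    also have "\<dots> \<le> ennreal (c\<^sup>2 * d\<^sup>2) * (1 + young q (f (x - z) / c) + young p (norm (g x) / d))"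
      by (intro mult_left_mono young_pointwise[OF p q pq]) simp
    finally show "ennreal ((f (x - z))\<^sup>2) * ennreal ((norm (g x))\<^sup>2)
        \<le> ennreal (c\<^sup>2 * d\<^sup>2) * (1 + young q (f (x - z) / c) + young p (norm (g x) / d))" .
  qed
  also have "\<dots> = ennreal (c\<^sup>2 * d\<^sup>2) * (1 + (\<integral>\<^sup>+x. young q (f (x - z) / c) \<partial>torus) + (\<integral>\<^sup>+x. young p (norm (g x) / d) \<partial>torus))"
    using m1 by (simp add: nn_integral_cmult nn_integral_add)
  also have "\<dots> \<le> ennreal (c\<^sup>2 * d\<^sup>2) * (1 + 1 + 1)"
    by (intro mult_left_mono add_mono yf yg) auto
  also have "\<dots> = ennreal (3 * c\<^sup>2 * d\<^sup>2)"
  proof -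
    have "(1 + 1 + 1 :: ennreal) = ennreal 3" by simp
    then show ?thesis by (simp only: ennreal_mult[symmetric] zero_le_mult_iff zero_le_power2 zero_le_numeral simp_thms mult_ac)
  qed
  finally show ?thesis .
qed

section \<open>Functions in the Sobolev space\<close>

lemma torus_Lp_2_vec_iff:
  fixes g :: "real^'n \<Rightarrow> real^'n"
  shows "torus_Lp 2 g \<longleftrightarrow> torus_periodic g \<and> (\<forall>i. square_integrable torus (\<lambda>x. g x $ i))"
proof (intro iffI conjI allI)
  assume g: "torus_Lp 2 g"
  then show "torus_periodic g" by (simp add: torus_Lp_def)
  fix i
  have m: "g \<in> borel_measurable torus" using g by (simp add: torus_Lp_def)
  have mi: "(\<lambda>x. g x $ i) \<in> borel_measurable torus" by (rule nth_measurable[OF m])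
  have "(\<integral>\<^sup>+x. ennreal ((norm (g x))\<^sup>2) \<partial>torus) < \<infinity>"
    using g unfolding torus_Lp_def Lp_enorm_2 infinity_ennreal_def ennreal_powr_less_top by simp
  then have "integrable torus (\<lambda>x. (norm (g x))\<^sup>2)" using m by (simp add: integrable_iff_bounded)
  then have "integrable torus (\<lambda>x. (g x $ i)\<^sup>2)"
    by (rule Bochner_Integration.integrable_bound)
      (use mi in \<open>auto simp: norm_vec_square intro!: member_le_sum[of i UNIV "\<lambda>j. (g _ $ j)\<^sup>2"] order_trans[OF _ abs_ge_self]\<close>)
  then show "square_integrable torus (\<lambda>x. g x $ i)" using mi by (simp add: square_integrable_def)
next
  assume g: "torus_periodic g \<and> (\<forall>i. square_integrable torus (\<lambda>x. g x $ i))"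
  have m: "g \<in> borel_measurable torus"
  proof (subst borel_measurable_euclidean_space, intro ballI)
    fix c :: "real^'n" assume "c \<in> Basis"
    then obtain i where c: "c = axis i 1" by (auto simp: Basis_vec_def)
    have "(\<lambda>x. g x $ i) \<in> borel_measurable torus"
      using g square_integrable_measurable by blast
    then show "(\<lambda>x. g x \<bullet> c) \<in> borel_measurable torus" by (simp add: c inner_axis)
  qed
  have "integrable torus (\<lambda>x. \<Sum>i\<in>UNIV. (g x $ i)\<^sup>2)"
    using g by (intro Bochner_Integration.integrable_sum square_integrable_square) auto
  then have "integrable torus (\<lambda>x. (norm (g x))\<^sup>2)" by (simp add: norm_vec_square)
  then have "(\<integral>\<^sup>+x. ennreal ((norm (g x))\<^sup>2) \<partial>torus) < \<infinity>" by (simp add: integrable_iff_bounded)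
  then show "torus_Lp 2 g"
    using g m unfolding torus_Lp_def Lp_enorm_2 infinity_ennreal_def ennreal_powr_less_top by simp
qed

lemma bij_uminus_ivec: "bij_betw uminus UNIV (UNIV :: (int^'n) set)"
  by (rule bij_betwI[of _ _ _ uminus]) auto

lemma coef_partial:
  fixes \<psi> :: "real^'n \<Rightarrow> real"
  assumes sm: "smooth \<psi>" and per: "torus_periodic \<psi>"
  shows "torus.coef (partial i \<psi>) k = - (2 * pi * real_of_int (k $ i)) * torus.coef \<psi> (- k)"
proof -
  have ps: "torus_periodic (\<lambda>x. \<psi> x * hartley k x)"
    by (rule torus_periodicI) (simp add: torus_periodic_ivec[OF per] torus_periodic_ivec[OF torus_periodic_hartley])
  have b: "integrable torus f" if pf: "torus_periodic f" and sf: "smooth f" for f :: "real^'n \<Rightarrow> real"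
  proof -
    have c: "continuous_on UNIV f" by (rule smooth_continuous[OF sf])
    obtain B where "\<And>x. \<bar>f x\<bar> \<le> B" using torus_periodic_bounded[OF pf c] by blast
    then show ?thesis
      by (rule integrable_torus_bounded[OF borel_imp_measurable_lebesgue_on[OF borel_measurable_continuous_onI[OF c]]])
  qed
  have i1: "integrable torus (\<lambda>x. \<psi> x * hartley (- k) x)"
    by (rule b)
      (auto intro!: torus_periodicI smooth_mult sm smooth_hartley
        simp: torus_periodic_ivec[OF per] torus_periodic_ivec[OF torus_periodic_hartley])
  have i2: "integrable torus (\<lambda>x. partial i \<psi> x * hartley k x)"
    by (rule b)
      (auto intro!: torus_periodicI smooth_mult smooth_partial sm smooth_hartley
        simp: torus_periodic_ivec[OF torus_periodic_partial[OF per sm]] torus_periodic_ivec[OF torus_periodic_hartley])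
  have "0 = (LINT x|torus. partial i (\<lambda>x. \<psi> x * hartley k x) x)"
    by (rule integral_partial_zero[symmetric, OF smooth_mult[OF sm smooth_hartley] ps])
  also have "\<dots> = (LINT x|torus. (2 * pi * real_of_int (k $ i)) * (\<psi> x * hartley (- k) x) + partial i \<psi> x * hartley k x)"
    by (simp add: partial_mult[OF sm smooth_hartley] partial_hartley mult_ac)
  also have "\<dots> = (2 * pi * real_of_int (k $ i)) * torus.coef \<psi> (- k) + torus.coef (partial i \<psi>) k"
    unfolding torus.coef_def
    by (subst Bochner_Integration.integral_add[OF integrable_mult_right[OF i1] i2]) (simp only: integral_mult_right_zero)
  finally show ?thesis by simp
qed

lemma smooth_periodic_square_integrable:
  fixes \<psi> :: "real^'n \<Rightarrow> real"
  assumes sm: "smooth \<psi>" and per: "torus_periodic \<psi>"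
  shows "square_integrable torus \<psi>"
proof -
  have c: "continuous_on UNIV \<psi>" by (rule smooth_continuous[OF sm])
  obtain B where "\<And>x. \<bar>\<psi> x\<bar> \<le> B" using torus_periodic_bounded[OF per c] by blast
  then show ?thesis
    by (rule torus.square_integrable_bounded[OF borel_imp_measurable_lebesgue_on[OF borel_measurable_continuous_onI[OF c]]])
qed

text \<open>Parseval on both sides: \<open>coef_partial\<close> moves the factor 2 pi k_i from psi
  onto f, where it forms the coefficients of g, and reindexing the sum undoes the reflection k ->
  -k.\<close>

lemma H1_gradientI:
  fixes f :: "real^'n \<Rightarrow> real"
  assumes f: "torus_Lp 2 f" and g: "torus_Lp 2 g"
    and coef: "\<And>i k. torus.coef (\<lambda>x. g x $ i) (- k) = 2 * pi * real_of_int (k $ i) * torus.coef f k"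
  shows "H1_gradient f g"
  unfolding H1_gradient_def
proof (intro conjI allI impI f g)
  fix \<psi> :: "real^'n \<Rightarrow> real" and i
  assume "smooth \<psi> \<and> torus_periodic \<psi>"
  then have sm: "smooth \<psi>" and per: "torus_periodic \<psi>" by auto
  have fs: "square_integrable torus f" using f by (simp add: torus_Lp_2_iff)
  have gs: "square_integrable torus (\<lambda>x. g x $ i)" using g by (simp add: torus_Lp_2_vec_iff)
  have \<psi>s: "square_integrable torus \<psi>" by (rule smooth_periodic_square_integrable[OF sm per])
  have ps: "square_integrable torus (partial i \<psi>)"
    by (rule smooth_periodic_square_integrable[OF smooth_partial[OF sm] torus_periodic_partial[OF per sm]])
  have "(LINT x|torus. f x * partial i \<psi> x) = (LINT k|count_space UNIV. torus.coef f k * torus.coef (partial i \<psi>) k)"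
    by (rule torus.Parseval[OF fs ps, symmetric])
  also have "\<dots> = (LINT k|count_space UNIV. - (torus.coef (\<lambda>x. g x $ i) (- k) * torus.coef \<psi> (- k)))"
    by (simp add: coef_partial[OF sm per] coef mult_ac)
  also have "\<dots> = - (LINT k|count_space UNIV. torus.coef (\<lambda>x. g x $ i) k * torus.coef \<psi> k)"
    using integral_bij_count_space[OF bij_uminus_ivec, of "\<lambda>k. torus.coef (\<lambda>x. g x $ i) k * torus.coef \<psi> k"] by simp
  also have "\<dots> = - (LINT x|torus. g x $ i * \<psi> x)"
    by (simp only: torus.Parseval[OF gs \<psi>s])
  finally show "(LINT x|torus. f x * partial i \<psi> x) = - (LINT x|torus. g x $ i * \<psi> x)" .
qed

lemma H1_gradient_coef:
  assumes "H1_gradient f g"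
  shows "torus.coef (\<lambda>x. g x $ i) (- k) = 2 * pi * real_of_int (k $ i) * torus.coef f k"
proof -
  have "(LINT x|torus. f x * partial i (hartley (- k)) x) = - (LINT x|torus. g x $ i * hartley (- k) x)"
    using assms smooth_hartley[of "- k"] torus_periodic_hartley[of "- k"] unfolding H1_gradient_def by blast
  then have "- (LINT x|torus. g x $ i * hartley (- k) x) = - (2 * pi * real_of_int (k $ i) * (LINT x|torus. f x * hartley k x))"
    by (simp add: partial_hartley mult.left_commute[of "f _"])
  then show ?thesis by (simp add: torus.coef_def)
qed

text \<open>The coefficients of a weak gradient are forced by those of f, so all weak gradients have
  the same norm and the choice made in \<open>weak_grad\<close> is immaterial.\<close>

lemma H1_gradient_norm:
  assumes "H1_gradient f g"
  shows "(LINT x|torus. (norm (g x))\<^sup>2) = (LINT k|count_space UNIV. freq k * (torus.coef f k)\<^sup>2)"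
proof -
  have gs: "square_integrable torus (\<lambda>x. g x $ i)" for i
    using assms by (simp add: H1_gradient_def torus_Lp_2_vec_iff)
  have cs: "integrable (count_space UNIV) (\<lambda>k. (torus.coef (\<lambda>x. g x $ i) k)\<^sup>2)" for i
    by (rule square_integrable_square[OF torus.square_summable_coef(1)[OF gs]])
  have cs': "integrable (count_space UNIV) (\<lambda>k. (torus.coef (\<lambda>x. g x $ i) (- k))\<^sup>2)" for i
    using integrable_bij_count_space[OF bij_uminus_ivec, of "\<lambda>k. (torus.coef (\<lambda>x. g x $ i) k)\<^sup>2"] cs by simp
  have "(LINT x|torus. (norm (g x))\<^sup>2) = (\<Sum>i\<in>UNIV. LINT x|torus. (g x $ i)\<^sup>2)"
    unfolding norm_vec_square by (rule Bochner_Integration.integral_sum) (rule square_integrable_square[OF gs])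
  also have "\<dots> = (\<Sum>i\<in>UNIV. LINT k|count_space UNIV. (torus.coef (\<lambda>x. g x $ i) (- k))\<^sup>2)"
    using integral_bij_count_space[OF bij_uminus_ivec, of "\<lambda>k. (torus.coef (\<lambda>x. g x $ _) k)\<^sup>2"]
    by (simp add: torus.Parseval_square[OF gs, symmetric])
  also have "\<dots> = (LINT k|count_space UNIV. (\<Sum>i\<in>UNIV. (torus.coef (\<lambda>x. g x $ i) (- k))\<^sup>2))"
    by (rule Bochner_Integration.integral_sum[symmetric]) (rule cs')
  also have "\<dots> = (LINT k|count_space UNIV. freq k * (torus.coef f k)\<^sup>2)"
    by (simp only: H1_gradient_coef[OF assms] power_mult_distrib[of _ "torus.coef f _"] freq_def sum_distrib_right)
  finally show ?thesis .
qed

section \<open>Solutions of the core problem\<close>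

context advection_core
begin

context
  fixes u :: "real \<Rightarrow> real^'n \<Rightarrow> real"
  assumes u_per: "\<And>t. t \<in> {0..T} \<Longrightarrow> torus_periodic (u t)"
    and u_meas: "(\<lambda>(t, x). u t x) \<in> borel_measurable (lebesgue_on ({0..T} \<times> cbox 0 1))"
    and u_eq: "AE t in lebesgue_on {0..T}. AE x in torus. u t x = U t x"
begin

text \<open>The solution u agrees with U only almost everywhere; completeness of Lebesgue measure
  makes almost every slice measurable with the coefficients of U.\<close>

lemma slice_facts: "AE t in I. torus_Lp 2 (u t) \<and> (\<forall>k. torus.coef (u t) k = a k t) \<and>
    (\<integral>\<^sup>+x. ennreal ((norm (u t x))\<^sup>2) \<partial>X) \<le> ennreal C"
  using u_eq AE_space
proof eventually_elim
  fix t assume ae: "AE x in X. u t x = U t x" and t: "t \<in> space I"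
  have ae': "AE x in X. U t x = u t x" using ae by eventually_elim simp
  have Um: "U t \<in> borel_measurable X" using U_sq by auto
  have um: "u t \<in> borel_measurable X" by (rule borel_measurable_lebesgue_on_AE[OF Um _ ae']) simp
  have sq: "square_integrable X (u t)" by (rule square_integrable_cong_AE[OF U_sq ae' um])
  have "torus.coef (u t) k = a k t" for k
    unfolding a_def torus.coef_def by (rule integral_cong_AE) (use um Um ae in auto)
  moreover have "(\<integral>\<^sup>+x. ennreal ((norm (u t x))\<^sup>2) \<partial>X) = (\<integral>\<^sup>+x. ennreal ((U t x)\<^sup>2) \<partial>X)"
    by (rule nn_integral_cong_AE, use ae in eventually_elim) simp
  moreover have "(\<integral>\<^sup>+x. ennreal ((U t x)\<^sup>2) \<partial>X) \<le> ennreal C"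
    by (subst nn_integral_eq_integral[OF square_integrable_square[OF U_sq]]) (auto intro: ennreal_leI U_bound)
  ultimately show "torus_Lp 2 (u t) \<and> (\<forall>k. torus.coef (u t) k = a k t) \<and>
      (\<integral>\<^sup>+x. ennreal ((norm (u t x))\<^sup>2) \<partial>X) \<le> ennreal C"
    using sq t u_per by (simp add: torus_Lp_2_iff)
qed

lemma u_L2_L2: "Lr_Lp T 2 2 u"
proof (rule Lr_Lp_2_2I[OF u_per u_meas])
  have "(\<integral>\<^sup>+t. \<integral>\<^sup>+x. ennreal ((norm (u t x))\<^sup>2) \<partial>X \<partial>I) \<le> (\<integral>\<^sup>+t. ennreal C \<partial>I)"
    by (rule nn_integral_mono_AE, use slice_facts in eventually_elim) simp
  also have "\<dots> < \<infinity>" using T_pos by (simp add: emeasure_restrict_space ennreal_mult_less_top)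
  finally show "(\<integral>\<^sup>+t. \<integral>\<^sup>+x. ennreal ((norm (u t x))\<^sup>2) \<partial>X \<partial>I) < \<infinity>" .
qed simp

lemma weak_gradient_exists:
  obtains G where "Lr_Lp T 2 2 G" "AE t in I. H1_gradient (u t) (G t)"
proof -
  define Q where "Q j G \<longleftrightarrow> (\<lambda>p. G (fst p) (snd p)) \<in> borel_measurable borel \<and> (\<forall>t. torus_periodic (G t)) \<and>
      square_integrable (I \<Otimes>\<^sub>M X) (\<lambda>(t, x). G t x) \<and>
      (AE t in I. square_integrable X (G t) \<and> (\<forall>k. torus.coef (G t) (- k) = 2 * pi * real_of_int (k $ j) * a k t))" for j G
  have "\<exists>G. Q j G" for j
  proof (rule gradient_component_exists[of j])
    fix G
    assume "(\<lambda>p. G (fst p) (snd p)) \<in> borel_measurable borel" "\<And>t. torus_periodic (G t)"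
      "square_integrable (I \<Otimes>\<^sub>M X) (\<lambda>(t, x). G t x)"
      "AE t in I. square_integrable X (G t) \<and> (\<forall>k. torus.coef (G t) (- k) = 2 * pi * real_of_int (k $ j) * a k t)"
    then show "\<exists>G. Q j G" unfolding Q_def by (intro exI[of _ G]) simp
  qed
  then obtain H where "\<And>j. Q j (H j)" by metis
  then have H: "\<And>j. (\<lambda>p. H j (fst p) (snd p)) \<in> borel_measurable borel" "\<And>j t. torus_periodic (H j t)"
      "\<And>j. square_integrable (I \<Otimes>\<^sub>M X) (\<lambda>(t, x). H j t x)"
      "\<And>j. AE t in I. square_integrable X (H j t) \<and> (\<forall>k. torus.coef (H j t) (- k) = 2 * pi * real_of_int (k $ j) * a k t)"
    unfolding Q_def by simp_all
  define G where "G t x = (\<chi> j. H j t x)" for t x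
  have G_per: "torus_periodic (G t)" for t
    by (rule torus_periodicI) (simp add: G_def torus_periodic_ivec[OF H(2)])
  have "(\<lambda>p. G (fst p) (snd p)) \<in> borel_measurable borel"
  proof (subst borel_measurable_euclidean_space, intro ballI)
    fix c :: "real^'n" assume "c \<in> Basis"
    then obtain i where c: "c = axis i 1" by (auto simp: Basis_vec_def)
    show "(\<lambda>p. G (fst p) (snd p) \<bullet> c) \<in> borel_measurable borel"
      using H(1)[of i] by (simp add: c inner_axis G_def)
  qed
  then have G_m: "(\<lambda>(t, x). G t x) \<in> borel_measurable (lebesgue_on ({0..T} \<times> cbox 0 1))"
    by (intro borel_imp_measurable_lebesgue_on) (simp add: split_beta')
  have "(\<integral>\<^sup>+t. \<integral>\<^sup>+x. ennreal ((norm (G t x))\<^sup>2) \<partial>X \<partial>I) = (\<integral>\<^sup>+p. ennreal (\<Sum>j\<in>UNIV. (H j (fst p) (snd p))\<^sup>2) \<partial>(I \<Otimes>\<^sub>M X))"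
  proof -
    have m: "(\<lambda>p. H j (fst p) (snd p)) \<in> borel_measurable (I \<Otimes>\<^sub>M X)" for j
      using square_integrable_measurable[OF H(3), of j] by (simp add: split_beta')
    show ?thesis
      by (subst X.nn_integral_fst[symmetric])
        (auto simp: norm_vec_square G_def intro!: measurable_compose[OF _ measurable_ennreal]
          borel_measurable_sum borel_measurable_power m)
  qed
  also have "\<dots> < \<infinity>"
  proof -
    have "integrable (I \<Otimes>\<^sub>M X) (\<lambda>p. \<Sum>j\<in>UNIV. (H j (fst p) (snd p))\<^sup>2)"
      using H(3) by (intro Bochner_Integration.integrable_sum square_integrable_square) (simp add: split_beta')
    then show ?thesis by (simp add: integrable_iff_bounded sum_nonneg)
  qed
  finally have "Lr_Lp T 2 2 G" by (rule Lr_Lp_2_2I[OF G_per G_m])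
  moreover have "AE t in I. H1_gradient (u t) (G t)"
  proof -
    have "AE t in I. \<forall>j. square_integrable X (H j t) \<and> (\<forall>k. torus.coef (H j t) (- k) = 2 * pi * real_of_int (k $ j) * a k t)"
      using H(4) by (subst AE_all_countable) blast
    with slice_facts show ?thesis
    proof eventually_elim
      fix t
      assume s: "torus_Lp 2 (u t) \<and> (\<forall>k. torus.coef (u t) k = a k t) \<and> (\<integral>\<^sup>+x. ennreal ((norm (u t x))\<^sup>2) \<partial>X) \<le> ennreal C"
        and h: "\<forall>j. square_integrable X (H j t) \<and> (\<forall>k. torus.coef (H j t) (- k) = 2 * pi * real_of_int (k $ j) * a k t)"
      have e: "(\<lambda>x. G t x $ i) = H i t" for i by (simp add: G_def fun_eq_iff)
      show "H1_gradient (u t) (G t)"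
      proof (rule H1_gradientI)
        show "torus_Lp 2 (G t)" using h G_per by (simp add: torus_Lp_2_vec_iff e)
      qed (use s h in \<open>auto simp: e\<close>)
    qed
  qed
  ultimately show ?thesis using that by blast
qed

lemma weakly_continuous_rep_exists: "\<exists>v. weakly_continuous_rep T u v"
proof -
  obtain v where v: "\<And>t. v t \<in> borel_measurable borel" "\<And>t. torus_periodic (v t)"
    "\<And>t. square_integrable X (v t)" "\<And>t k. torus.coef (v t) k = A k t"
    by (rule weak_representative_exists) blast
  have "AE t in I. \<forall>k. a k t = A k t"
    using AE_a_eq_A by (subst AE_all_countable) blast
  with slice_facts have "AE t in I. AE x in X. v t x = u t x"
  proof eventually_elim
    fix t
    assume s: "torus_Lp 2 (u t) \<and> (\<forall>k. torus.coef (u t) k = a k t) \<and> (\<integral>\<^sup>+x. ennreal ((norm (u t x))\<^sup>2) \<partial>X) \<le> ennreal C"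
      and aA: "\<forall>k. a k t = A k t"
    then have us: "square_integrable X (u t)" by (simp add: torus_Lp_2_iff)
    have "AE x in X. v t x - u t x = 0"
      by (rule torus.complete[OF square_integrable_diff[OF v(3) us]])
        (use s aA in \<open>simp add: torus.coef_diff[OF v(3) us] v(4)\<close>)
    then show "AE x in X. v t x = u t x" by eventually_elim simp
  qed
  moreover have "continuous_on {0..T} (\<lambda>t. LINT x|X. v t x * f x)" if "torus_Lp 2 f" for f
    using that by (intro weakly_continuous v) (simp add: torus_Lp_2_iff)
  ultimately show ?thesis
    using v unfolding weakly_continuous_rep_def by (intro exI[of _ v]) (simp add: torus_Lp_2_iff)
qed

text \<open>Here v is an arbitrary representative. Testing with basis functions makes its
  coefficients continuous; they agree with the continuous A almost everywhere, hence also at the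
  single time T.\<close>

lemma weakly_continuous_rep_final:
  assumes v: "weakly_continuous_rep T u v"
  shows "(LINT x|X. \<bar>v T x\<bar>\<^sup>2) = (LINT k|K. (A k T)\<^sup>2)"
proof -
  have vs: "square_integrable X (v T)"
    using v T_pos by (simp add: weakly_continuous_rep_def torus_Lp_2_iff)
  have "torus.coef (v T) k = A k T" for k
  proof (rule AE_eq_continuous_imp_eq[OF T_pos _ A_continuous])
    have "torus_Lp 2 (hartley k)" by (simp add: torus_Lp_2_iff torus_periodic_hartley)
    then show "continuous_on {0..T} (\<lambda>t. torus.coef (v t) k)"
      using v unfolding weakly_continuous_rep_def torus.coef_def by blast
    have "AE t in I. AE x in X. v t x = u t x"
      using v by (simp add: weakly_continuous_rep_def)
    then show "AE t in I. torus.coef (v t) k = A k t"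
      using slice_facts AE_a_eq_A[of k]
    proof eventually_elim
      fix t assume ae: "AE x in X. v t x = u t x" and "a k t = A k t"
        and "torus_Lp 2 (u t) \<and> (\<forall>k. torus.coef (u t) k = a k t) \<and> (\<integral>\<^sup>+x. ennreal ((norm (u t x))\<^sup>2) \<partial>X) \<le> ennreal C"
      moreover have "torus.coef (v t) k = torus.coef (u t) k"
        unfolding torus.coef_def
        by (rule integral_lebesgue_on_cong_AE) (use ae in \<open>auto elim: eventually_mono\<close>)
      ultimately show "torus.coef (v t) k = A k t" by simp
    qed
  qed
  then show ?thesis using torus.Parseval_square[OF vs] by simp
qed

text \<open>The gradients are chosen independently at each time, but their norms agree almost
  everywhere with an expression in the coefficients, which determines the time integral.\<close>

lemma weak_grad_norm: "(LINT t|I. LINT x|X. (norm (weak_grad (u t) x))\<^sup>2) = (LINT t|I. LINT k|K. freq k * (a k t)\<^sup>2)"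
proof (rule integral_lebesgue_on_cong_AE)
  obtain G where "AE t in I. H1_gradient (u t) (G t)" by (rule weak_gradient_exists) blast
  then show "AE t in I. (LINT x|X. (norm (weak_grad (u t) x))\<^sup>2) = (LINT k|K. freq k * (a k t)\<^sup>2)"
    using slice_facts
  proof eventually_elim
    fix t assume h1: "H1_gradient (u t) (G t)"
      and s: "torus_Lp 2 (u t) \<and> (\<forall>k. torus.coef (u t) k = a k t) \<and> (\<integral>\<^sup>+x. ennreal ((norm (u t x))\<^sup>2) \<partial>X) \<le> ennreal C"
    have "H1_gradient (u t) (weak_grad (u t))"
      unfolding weak_grad_def by (rule someI[of "H1_gradient (u t)", OF h1])
    from H1_gradient_norm[OF this] s
    show "(LINT x|X. (norm (weak_grad (u t) x))\<^sup>2) = (LINT k|K. freq k * (a k t)\<^sup>2)" by simp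
  qed
qed simp

lemma energy_balance:
  "L2_H1 T u \<and> (\<exists>v. weakly_continuous_rep T u v) \<and>
    (\<forall>v. weakly_continuous_rep T u v \<longrightarrow>
       1 / 2 * (LINT x|torus. \<bar>v T x\<bar>\<^sup>2)
         + (LINT t|lebesgue_on {0..T}. (LINT x|torus. (norm (weak_grad (u t) x))\<^sup>2))
       = 1 / 2 * (LINT x|torus. \<bar>u0 x\<bar>\<^sup>2))"
proof (intro conjI allI impI)
  obtain G where "Lr_Lp T 2 2 G" "AE t in I. H1_gradient (u t) (G t)" by (rule weak_gradient_exists) blast
  then show "L2_H1 T u" using u_L2_L2 unfolding L2_H1_def by blast
  show "\<exists>v. weakly_continuous_rep T u v" by (rule weakly_continuous_rep_exists)
  fix v assume "weakly_continuous_rep T u v"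
  from weakly_continuous_rep_final[OF this]
  show "1 / 2 * (LINT x|torus. \<bar>v T x\<bar>\<^sup>2)
      + (LINT t|lebesgue_on {0..T}. (LINT x|torus. (norm (weak_grad (u t) x))\<^sup>2))
    = 1 / 2 * (LINT x|torus. \<bar>u0 x\<bar>\<^sup>2)"
    using energy_identity by (simp only: weak_grad_norm power2_abs)
qed

end

end

section \<open>Reduction to the core problem\<close>

lemma AE_torus_unit_cube: "AE x in torus. x \<in> (unit_cube :: (real^'n) set)"
  using AE_unit_cube by (auto simp: AE_lebesgue_on_iff elim: eventually_mono)

lemma sigma_finite_torus: "sigma_finite_measure (torus :: (real^'n) measure)"
proof -
  interpret finite_measure "torus :: (real^'n) measure" by (rule finite_measure_torus)
  show ?thesis by unfold_locales
qed

lemma space_time_slice: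
  fixes g :: "real \<Rightarrow> real^'n \<Rightarrow> 'b::topological_space"
  assumes g: "(\<lambda>p. g (fst p) (snd p)) \<in> borel_measurable borel"
  shows "g t \<in> borel_measurable borel"
proof -
  have "(\<lambda>x. (t, x)) \<in> borel_measurable borel"
    by (intro borel_measurable_continuous_onI continuous_intros)
  from measurable_compose[OF this g] show ?thesis by simp
qed

lemma space_time_compose:
  fixes g :: "real \<Rightarrow> real^'n \<Rightarrow> 'b::topological_space"
  assumes g: "(\<lambda>p. g (fst p) (snd p)) \<in> borel_measurable borel"
    and "f \<in> borel_measurable M" "h \<in> borel_measurable M"
  shows "(\<lambda>x. g (f x) (h x)) \<in> borel_measurable M"
  using measurable_compose[OF borel_measurable_Pair[OF assms(2,3)] g] by simp

text \<open>Fubini turns a null set of space-time into null sets in almost all slices, and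
  composition with \<open>vfrac\<close> makes every slice periodic.\<close>

lemma space_time_borel_version:
  fixes f :: "real \<Rightarrow> real^'n \<Rightarrow> 'b::euclidean_space"
  assumes m: "(\<lambda>(t, x). f t x) \<in> borel_measurable (lebesgue_on ({0..T} \<times> cbox 0 1))"
  obtains g where "(\<lambda>p. g (fst p) (snd p)) \<in> borel_measurable borel" "\<And>t. torus_periodic (g t)"
    "AE t in lebesgue_on {0..T}. AE x in torus. f t x = g t x"
proof -
  let ?S = "{0..T} \<times> cbox 0 (1::real^'n)"
  have S: "?S \<in> sets borel" by (intro borel_closed closed_Times) auto
  obtain g0 where g0: "g0 \<in> borel_measurable borel" and ae: "AE p in lebesgue_on ?S. (case p of (t, x) \<Rightarrow> f t x) = g0 p"
    using lebesgue_on_borel_version[OF m S] by blast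
  have "AE p in lborel. p \<in> ?S \<longrightarrow> (case p of (t, x) \<Rightarrow> f t x) = g0 p"
    using ae by (simp only: AE_lebesgue_on_iff[OF S])
  then have "AE p in lborel \<Otimes>\<^sub>M lborel. p \<in> ?S \<longrightarrow> (case p of (t, x) \<Rightarrow> f t x) = g0 p"
    by (simp only: lborel_prod)
  from lborel_pair.AE_pair[OF this]
  have ae2: "AE t in lborel. AE x in lborel. t \<in> {0..T} \<longrightarrow> x \<in> cbox 0 1 \<longrightarrow> f t x = g0 (t, x)"
  proof eventually_elim
    fix t
    assume "AE x in lborel. (t, x) \<in> ?S \<longrightarrow> (case (t, x) of (t, x) \<Rightarrow> f t x) = g0 (t, x)"
    then show "AE x in lborel. t \<in> {0..T} \<longrightarrow> x \<in> cbox 0 1 \<longrightarrow> f t x = g0 (t, x)"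
      by eventually_elim simp
  qed
  have "AE t in lebesgue_on {0..T}. AE x in torus. f t x = g0 (t, x)"
  proof (subst AE_lebesgue_on_iff[of "{0..T}"], simp, use ae2 in eventually_elim, rule impI)
    fix t
    assume "AE x in lborel. t \<in> {0..T} \<longrightarrow> x \<in> cbox 0 1 \<longrightarrow> f t x = g0 (t, x)" and t: "t \<in> {0..T}"
    then have "AE x in lborel. x \<in> cbox 0 1 \<longrightarrow> f t x = g0 (t, x)" by simp
    then show "AE x in torus. f t x = g0 (t, x)" by (subst AE_lebesgue_on_iff) simp_all
  qed
  then have ae3: "AE t in lebesgue_on {0..T}. AE x in torus. f t x = g0 (t, vfrac x)"
  proof eventually_elim
    fix t assume "AE x in torus. f t x = g0 (t, x)"
    then show "AE x in torus. f t x = g0 (t, vfrac x)"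
      using AE_torus_unit_cube by eventually_elim (simp add: vfrac_id)
  qed
  have "(\<lambda>p::real \<times> (real^'n). (fst p, vfrac (snd p))) \<in> borel_measurable borel"
    by (intro borel_measurable_Pair measurable_compose[OF _ vfrac_measurable] borel_measurable_continuous_onI continuous_intros)
  from measurable_compose[OF this g0]
  have "(\<lambda>p::real \<times> (real^'n). g0 (fst p, vfrac (snd p))) \<in> borel_measurable borel" .
  moreover have "torus_periodic (\<lambda>x::real^'n. g0 (t, vfrac x))" for t by (rule torus_periodicI) simp
  ultimately show ?thesis using ae3 that[of "\<lambda>t x. g0 (t, vfrac x)"] by blast
qed

text \<open>\<open>young_pointwise\<close> with second factor 1 and exponent infinity, for which
  \<open>young\<close> vanishes. On a probability space the two remaining summands integrate to at
  most 1 each, whence the 2.\<close>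

lemma nn_integral_square_le:
  fixes f :: "'a \<Rightarrow> 'b::euclidean_space"
  assumes M: "emeasure M (space M) = 1" and r: "1 \<le> r" "1 / r \<le> (1 / 2 :: ennreal)" and [measurable]: "f \<in> borel_measurable M" and c: "0 < c"
    and le: "Lp_enorm r M (\<lambda>x. ennreal (norm (f x))) \<le> ennreal c"
  shows "(\<integral>\<^sup>+x. ennreal ((norm (f x))\<^sup>2) \<partial>M) \<le> ennreal (2 * c\<^sup>2)"
proof -
  have "(\<integral>\<^sup>+x. ennreal ((norm (f x))\<^sup>2) \<partial>M) \<le> (\<integral>\<^sup>+x. ennreal (c\<^sup>2) * (1 + young r (norm (f x) / c)) \<partial>M)"
  proof (rule nn_integral_mono)
    fix x
    have "ennreal ((norm (f x) / c)\<^sup>2 * 1\<^sup>2) \<le> 1 + young r (norm (f x) / c) + young \<infinity> 1"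
      by (rule young_pointwise) (use r in auto)
    then have "ennreal ((norm (f x) / c)\<^sup>2) \<le> 1 + young r (norm (f x) / c)"
      by (simp add: young_def)
    then have "ennreal (c\<^sup>2) * ennreal ((norm (f x) / c)\<^sup>2) \<le> ennreal (c\<^sup>2) * (1 + young r (norm (f x) / c))"
      by (rule mult_left_mono) simp
    moreover have "ennreal (c\<^sup>2) * ennreal ((norm (f x) / c)\<^sup>2) = ennreal ((norm (f x))\<^sup>2)"
      using c by (simp add: ennreal_mult[symmetric] power_divide)
    ultimately show "ennreal ((norm (f x))\<^sup>2) \<le> ennreal (c\<^sup>2) * (1 + young r (norm (f x) / c))" by simp
  qed
  also have "\<dots> = ennreal (c\<^sup>2) * (1 + (\<integral>\<^sup>+x. young r (norm (f x) / c) \<partial>M))"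
    by (simp add: nn_integral_cmult nn_integral_add M)
  also have "\<dots> \<le> ennreal (c\<^sup>2) * (1 + 1)"
    by (intro mult_left_mono add_mono nn_integral_young_le_1[OF r(1) _ c le]) auto
  also have "\<dots> = ennreal (2 * c\<^sup>2)"
  proof -
    have "(1 + 1 :: ennreal) = ennreal 2" by simp
    then show ?thesis by (simp only: ennreal_mult[symmetric] zero_le_power2 zero_le_numeral mult.commute)
  qed
  finally show ?thesis .
qed

lemma emeasure_space_torus: "emeasure (torus :: (real^'n) measure) (space torus) = 1"
  by simp

lemma grad_cmult: "smooth w \<Longrightarrow> grad (\<lambda>x. c * w x) x = c *\<^sub>R grad w x"
  by (simp add: grad_def vec_eq_iff partial_cmult)

lemma laplacian_cmult:
  assumes "smooth w"
  shows "laplacian (\<lambda>x. c * w x) x = c * laplacian w x"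
proof -
  have "partial i (\<lambda>x. c * w x) = (\<lambda>x. c * partial i w x)" for i
    by (simp add: fun_eq_iff partial_cmult[OF assms])
  then show ?thesis
    by (simp add: laplacian_def partial_cmult[OF smooth_partial[OF assms]] sum_distrib_left)
qed

lemma spacetime_smooth_product:
  assumes "smooth \<eta>" "smooth w" "torus_periodic w"
  shows "spacetime_smooth (\<lambda>t x. \<eta> t * w x)"
proof -
  have "smooth (\<lambda>p. \<eta> (fst p) * w (snd p))"
    by (intro smooth_mult smooth_compose_linear[OF bounded_linear_fst] smooth_compose_linear[OF bounded_linear_snd] assms)
  then show ?thesis
    using assms(3) by (simp add: spacetime_smooth_def split_beta' torus_periodic_def)
qed

text \<open>Separated test functions psi(t) w(x), then \<open>du_Bois_Reymond\<close> in time. The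
  exceptional null set depends on w, so later only countably many w are used.\<close>

lemma divergence_free_slices:
  fixes b V :: "real \<Rightarrow> real^'n \<Rightarrow> real^'n"
  assumes div: "divergence_free T b"
    and V: "(\<lambda>p. V (fst p) (snd p)) \<in> borel_measurable borel"
    and eq: "AE t in lebesgue_on {0..T}. AE x in torus. b t x = V t x"
    and fin: "(\<integral>\<^sup>+t. \<integral>\<^sup>+x. ennreal ((norm (V t x))\<^sup>2) \<partial>torus \<partial>lebesgue_on {0..T}) < \<infinity>"
    and w: "smooth w" "torus_periodic w"
  shows "AE t in lebesgue_on {0..T}. (LINT x|torus. V t x \<bullet> grad w x) = 0"
proof (rule du_Bois_Reymond)
  let ?I = "lebesgue_on {0..T}" and ?X = "torus :: (real^'n) measure"
  interpret I: finite_measure ?I by (rule finite_measure_time)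
  interpret IX: pair_sigma_finite ?I ?X ..
  interpret P: finite_measure "?I \<Otimes>\<^sub>M ?X" by (rule finite_measure_pair_measure) unfold_locales
  note [measurable] = measurable_id_lebesgue_on[of "{0..T}"] measurable_id_lebesgue_on[of "cbox 0 (1::real^'n)"]
  have fsP: "fst \<in> borel_measurable (?I \<Otimes>\<^sub>M ?X)" "snd \<in> borel_measurable (?I \<Otimes>\<^sub>M ?X)" by measurable
  have VP: "(\<lambda>p. V (fst p) (snd p)) \<in> borel_measurable (?I \<Otimes>\<^sub>M ?X)"
    by (rule space_time_compose[OF V fsP])
  have pc: "continuous_on UNIV (partial i w)" for i by (rule smooth_continuous[OF smooth_partial[OF w(1)]])
  have "\<exists>B. \<forall>x. \<bar>partial i w x\<bar> \<le> B" for i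
    by (rule torus_periodic_bounded[OF torus_periodic_partial[OF w(2,1)] pc]) blast
  then obtain B where B: "\<And>i x. \<bar>partial i w x\<bar> \<le> B i" by metis
  have sqi: "integrable (?I \<Otimes>\<^sub>M ?X) (\<lambda>p. (norm (V (fst p) (snd p)))\<^sup>2)"
  proof -
    have "(\<integral>\<^sup>+p. ennreal ((norm (V (fst p) (snd p)))\<^sup>2) \<partial>(?I \<Otimes>\<^sub>M ?X)) < \<infinity>"
      using fin VP by (subst torus.nn_integral_fst[symmetric]) auto
    then show ?thesis using VP by (simp add: integrable_iff_bounded)
  qed
  have Vsq: "square_integrable (?I \<Otimes>\<^sub>M ?X) (\<lambda>p. V (fst p) (snd p) $ i)" for i
    unfolding square_integrable_def
  proof
    show m: "(\<lambda>p. V (fst p) (snd p) $ i) \<in> borel_measurable (?I \<Otimes>\<^sub>M ?X)" by (rule nth_measurable[OF VP])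
    show "integrable (?I \<Otimes>\<^sub>M ?X) (\<lambda>p. (V (fst p) (snd p) $ i)\<^sup>2)"
      by (rule Bochner_Integration.integrable_bound[OF sqi])
        (use m in \<open>auto simp: norm_vec_square intro!: member_le_sum[of i UNIV "\<lambda>j. (V _ _ $ j)\<^sup>2"] order_trans[OF _ abs_ge_self]\<close>)
  qed
  have int: "integrable (?I \<Otimes>\<^sub>M ?X) (\<lambda>p. V (fst p) (snd p) \<bullet> grad w (snd p))"
  proof -
    have "integrable (?I \<Otimes>\<^sub>M ?X) (\<lambda>p. \<Sum>i\<in>UNIV. partial i w (snd p) * V (fst p) (snd p) $ i)"
    proof (rule Bochner_Integration.integrable_sum)
      fix i
      have "square_integrable (?I \<Otimes>\<^sub>M ?X) (\<lambda>p. partial i w (snd p) * V (fst p) (snd p) $ i)"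
        by (rule square_integrable_bounded_mult[OF Vsq _ B])
          (rule measurable_compose[OF fsP(2) borel_measurable_continuous_onI[OF pc]])
      then show "integrable (?I \<Otimes>\<^sub>M ?X) (\<lambda>p. partial i w (snd p) * V (fst p) (snd p) $ i)"
        by (rule P.square_integrable_integrable)
    qed
    then show ?thesis by (simp add: inner_vec_def grad_def mult.commute)
  qed
  show "integrable ?I (\<lambda>t. LINT x|?X. V t x \<bullet> grad w x)"
    using IX.integrable_fst'[OF int] by simp
  fix \<psi> :: "real \<Rightarrow> real"
  assume sm: "smooth \<psi>" and supp: "\<exists>a>0. \<exists>c<T. \<forall>t. t \<le> a \<or> c \<le> t \<longrightarrow> \<psi> t = 0"
  have "test_fun_interior T (\<lambda>t x. \<psi> t * w x)"
    unfolding test_fun_interior_def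
    using spacetime_smooth_product[OF sm w] supp by (auto simp: spacetime_smooth_def)
  then have "0 = (LINT t|?I. LINT x|?X. b t x \<bullet> grad (\<lambda>x. \<psi> t * w x) x)"
    using div unfolding divergence_free_def by simp
  also have "\<dots> = (LINT t|?I. (LINT x|?X. V t x \<bullet> grad w x) * \<psi> t)"
  proof (rule integral_lebesgue_on_cong_AE)
    show "AE t in ?I. (LINT x|?X. b t x \<bullet> grad (\<lambda>x. \<psi> t * w x) x) = (LINT x|?X. V t x \<bullet> grad w x) * \<psi> t"
      using eq
    proof eventually_elim
      fix t assume ae: "AE x in ?X. b t x = V t x"
      have "(LINT x|?X. b t x \<bullet> grad (\<lambda>x. \<psi> t * w x) x) = (LINT x|?X. \<psi> t * (V t x \<bullet> grad w x))"
        by (rule integral_lebesgue_on_cong_AE, simp, use ae in eventually_elim) (simp add: grad_cmult[OF w(1)])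
      then show "(LINT x|?X. b t x \<bullet> grad (\<lambda>x. \<psi> t * w x) x) = (LINT x|?X. V t x \<bullet> grad w x) * \<psi> t"
        by (simp add: mult.commute)
    qed
  qed simp
  finally show "(LINT t|?I. (LINT x|?X. V t x \<bullet> grad w x) * \<psi> t) = 0" by simp
qed

text \<open>Separated test functions again, with eta free at time 0 so that the initial value is
  kept; on a basis function the Laplacian is multiplication by - freq k.\<close>

lemma distributional_solution_mode:
  fixes b V :: "real \<Rightarrow> real^'n \<Rightarrow> real^'n" and u U :: "real \<Rightarrow> real^'n \<Rightarrow> real"
  assumes sol: "distributional_solution T q b u0 u"
    and eq: "AE t in lebesgue_on {0..T}. (AE x in torus. u t x = U t x) \<and> (AE x in torus. b t x = V t x)"
    and U: "\<And>t. square_integrable torus (U t)" and V: "\<And>t i. square_integrable torus (\<lambda>x. V t x $ i)"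
    and \<eta>: "smooth \<eta>" "\<exists>c<T. \<forall>t\<ge>c. \<eta> t = 0"
  shows "(LINT t|lebesgue_on {0..T}. torus.coef (U t) k * deriv \<eta> t
        + ((LINT x|torus. U t x * (V t x \<bullet> grad (hartley k) x)) - freq k * torus.coef (U t) k) * \<eta> t)
      + torus.coef u0 k * \<eta> 0 = 0"
proof -
  let ?I = "lebesgue_on {0..T}" and ?X = "torus :: (real^'n) measure"
  let ?F = "\<lambda>t. LINT x|torus. U t x * (V t x \<bullet> grad (hartley k) x)"
  have UV: "integrable ?X (\<lambda>x. U t x * (V t x \<bullet> grad (hartley k) x))" for t
  proof -
    have "integrable ?X (\<lambda>x. \<Sum>i\<in>UNIV. (2 * pi * real_of_int (k $ i)) * (U t x * (hartley (- k) x * V t x $ i)))"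
      by (intro Bochner_Integration.integrable_sum integrable_mult_right square_integrable_mult U
          square_integrable_bounded_mult[OF V hartley_measurable_torus hartley_bounded])
    then show ?thesis by (simp add: inner_vec_def grad_def partial_hartley sum_distrib_left mult_ac)
  qed
  have Uh: "integrable ?X (\<lambda>x. U t x * hartley k x)" for t
    by (rule square_integrable_mult[OF U torus.h_sq])
  have "test_fun_initial T (\<lambda>t x. \<eta> t * hartley k x)"
    unfolding test_fun_initial_def
    using spacetime_smooth_product[OF \<eta>(1) smooth_hartley torus_periodic_hartley, of k] \<eta>(2) by auto
  then have "(LINT t|?I. LINT x|?X. u t x * (deriv (\<lambda>s. \<eta> s * hartley k x) t
        + b t x \<bullet> grad (\<lambda>x. \<eta> t * hartley k x) x + laplacian (\<lambda>x. \<eta> t * hartley k x) x))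
      + (LINT x|?X. u0 x * (\<eta> 0 * hartley k x)) = 0"
    using sol unfolding distributional_solution_def by blast
  moreover have "(LINT x|?X. u0 x * (\<eta> 0 * hartley k x)) = torus.coef u0 k * \<eta> 0"
  proof -
    have "(LINT x|?X. u0 x * (\<eta> 0 * hartley k x)) = (LINT x|?X. u0 x * hartley k x * \<eta> 0)"
      by (simp add: mult_ac)
    then show ?thesis by (simp add: torus.coef_def)
  qed
  moreover have "(LINT t|?I. LINT x|?X. u t x * (deriv (\<lambda>s. \<eta> s * hartley k x) t
        + b t x \<bullet> grad (\<lambda>x. \<eta> t * hartley k x) x + laplacian (\<lambda>x. \<eta> t * hartley k x) x))
      = (LINT t|?I. torus.coef (U t) k * deriv \<eta> t + (?F t - freq k * torus.coef (U t) k) * \<eta> t)"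
  proof (rule integral_lebesgue_on_cong_AE)
    show "AE t in ?I. (LINT x|?X. u t x * (deriv (\<lambda>s. \<eta> s * hartley k x) t
        + b t x \<bullet> grad (\<lambda>x. \<eta> t * hartley k x) x + laplacian (\<lambda>x. \<eta> t * hartley k x) x))
      = torus.coef (U t) k * deriv \<eta> t + (?F t - freq k * torus.coef (U t) k) * \<eta> t"
      using eq
    proof eventually_elim
      fix t assume "(AE x in ?X. u t x = U t x) \<and> (AE x in ?X. b t x = V t x)"
      then have ae: "AE x in ?X. u t x = U t x" "AE x in ?X. b t x = V t x" by auto
      have "\<eta> differentiable (at t)"
        using smooth_has_derivative[OF \<eta>(1)] by (auto simp: differentiable_def)
      then have d: "(\<eta> has_real_derivative deriv \<eta> t) (at t)"
        by (simp add: DERIV_deriv_iff_real_differentiable)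
      have dh: "deriv (\<lambda>s. \<eta> s * hartley k x) t = deriv \<eta> t * hartley k x" for x
        by (rule DERIV_imp_deriv) (use d in \<open>auto intro!: derivative_eq_intros\<close>)
      have "(LINT x|?X. u t x * (deriv (\<lambda>s. \<eta> s * hartley k x) t
          + b t x \<bullet> grad (\<lambda>x. \<eta> t * hartley k x) x + laplacian (\<lambda>x. \<eta> t * hartley k x) x))
        = (LINT x|?X. deriv \<eta> t * (U t x * hartley k x) + \<eta> t * (U t x * (V t x \<bullet> grad (hartley k) x))
            + (- freq k * \<eta> t) * (U t x * hartley k x))"
        by (rule integral_lebesgue_on_cong_AE, simp, use ae in eventually_elim)
          (simp add: dh grad_cmult[OF smooth_hartley] laplacian_cmult[OF smooth_hartley] laplacian_hartley algebra_simps)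
      also have "\<dots> = deriv \<eta> t * torus.coef (U t) k + \<eta> t * ?F t + (- freq k * \<eta> t) * torus.coef (U t) k"
        unfolding torus.coef_def
        by (simp only: Bochner_Integration.integral_add integrable_mult_right integral_mult_right_zero
            Bochner_Integration.integrable_add UV Uh)
      finally show "(LINT x|?X. u t x * (deriv (\<lambda>s. \<eta> s * hartley k x) t
          + b t x \<bullet> grad (\<lambda>x. \<eta> t * hartley k x) x + laplacian (\<lambda>x. \<eta> t * hartley k x) x))
        = torus.coef (U t) k * deriv \<eta> t + (?F t - freq k * torus.coef (U t) k) * \<eta> t"
        by (simp add: algebra_simps)
    qed
  qed simp
  ultimately show ?thesis by simp
qed

text \<open>The norm of u is bounded in time by c and that of b has a square integrable majorant d,
  so the Hoelder bound 3 * c^2 * (d t)^2 from \<open>nn_integral_weighted_le\<close> is integrable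
  in time.\<close>

lemma advection_core_exists:
  fixes T :: real and p q :: ennreal
    and b :: "real \<Rightarrow> real^'n \<Rightarrow> real^'n"
    and u0 :: "real^'n \<Rightarrow> real"
    and u :: "real \<Rightarrow> real^'n \<Rightarrow> real"
  assumes T: "0 < T" and p: "1 \<le> p" and q: "1 \<le> q" and pq: "1 / p + 1 / q \<le> 1 / 2"
    and b: "Lr_Lp T 2 p b" and div: "divergence_free T b"
    and u0: "torus_Lp q u0"
    and sol: "distributional_solution T q b u0 u"
  shows "\<exists>U V C n. advection_core T U V u0 C n \<and> (AE t in lebesgue_on {0..T}. AE x in torus. u t x = U t x)"
proof -
  let ?I = "lebesgue_on {0..T}" and ?X = "torus :: (real^'n) measure"
  have p2: "1 / p \<le> (1 / 2 :: ennreal)" and q2: "1 / q \<le> (1 / 2 :: ennreal)"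
    using order_trans[OF _ pq, of "1 / p"] order_trans[OF _ pq, of "1 / q"] by auto
  have u: "Lr_Lp T \<infinity> q u" using sol by (simp add: distributional_solution_def)
  have um: "(\<lambda>(t, x). u t x) \<in> borel_measurable (lebesgue_on ({0..T} \<times> cbox 0 1))"
    and bm: "(\<lambda>(t, x). b t x) \<in> borel_measurable (lebesgue_on ({0..T} \<times> cbox 0 1))"
    using u b by (simp_all add: Lr_Lp_def)
  obtain U0 where U0: "(\<lambda>p. U0 (fst p) (snd p)) \<in> borel_measurable borel" "\<And>t. torus_periodic (U0 t)"
      and uU: "AE t in ?I. AE x in ?X. u t x = U0 t x"
    by (rule space_time_borel_version[OF um]) (rule that)
  obtain V0 where V0: "(\<lambda>p. V0 (fst p) (snd p)) \<in> borel_measurable borel" "\<And>t. torus_periodic (V0 t)"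
      and bV: "AE t in ?I. AE x in ?X. b t x = V0 t x"
    by (rule space_time_borel_version[OF bm]) (rule that)
  have U0b: "U0 t \<in> borel_measurable borel" and V0b: "V0 t \<in> borel_measurable borel" for t
    by (rule space_time_slice[OF U0(1)], rule space_time_slice[OF V0(1)])
  have U0X: "U0 t \<in> borel_measurable ?X" and V0X: "V0 t \<in> borel_measurable ?X" for t
    by (rule borel_imp_measurable_lebesgue_on[OF U0b], rule borel_imp_measurable_lebesgue_on[OF V0b])
  have slice_norm: "Lp_enorm r ?X (\<lambda>x. ennreal (norm (f x))) = Lp_enorm r ?X (\<lambda>x. ennreal (norm (g x)))"
    if g: "g \<in> borel_measurable ?X" and ae: "AE x in ?X. f x = g x" for r and f g :: "real^'n \<Rightarrow> 'c::euclidean_space"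
  proof (rule Lp_enorm_cong_AE)
    have "AE x in ?X. g x = f x" using ae by eventually_elim simp
    then have "f \<in> borel_measurable ?X" by (rule borel_measurable_lebesgue_on_AE[OF g, rotated]) simp
    then show "(\<lambda>x. ennreal (norm (f x))) \<in> borel_measurable ?X" by simp
    show "(\<lambda>x. ennreal (norm (g x))) \<in> borel_measurable ?X" using g by simp
    show "AE x in ?X. ennreal (norm (f x)) = ennreal (norm (g x))" using ae by eventually_elim simp
  qed

  define cs where "cs = esssup ?I (\<lambda>t. Lp_enorm q ?X (\<lambda>x. ennreal (norm (u t x))))"
  \<comment> \<open>Adding 1 makes the bound strictly positive, as the normalisation in
    \<open>nn_integral_weighted_le\<close> requires; d is formed in the same way.\<close>
  define c where "c = enn2real cs + 1"
  have c: "0 < c" by (simp add: c_def add_nonneg_pos)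
  have cs: "cs < top" using u by (simp add: Lr_Lp_def Lp_enorm_def cs_def)
  have csc: "cs \<le> ennreal c"
  proof -
    have "cs = ennreal (enn2real cs)" using cs by simp
    also have "\<dots> \<le> ennreal c" by (rule ennreal_leI) (simp add: c_def)
    finally show ?thesis .
  qed
  have U_le: "AE t in ?I. Lp_enorm q ?X (\<lambda>x. ennreal (norm (U0 t x))) \<le> ennreal c"
    using uU esssup_AE[of "\<lambda>t. Lp_enorm q ?X (\<lambda>x. ennreal (norm (u t x)))" ?I]
  proof eventually_elim
    fix t assume ae: "AE x in ?X. u t x = U0 t x"
      and "Lp_enorm q ?X (\<lambda>x. ennreal (norm (u t x))) \<le> esssup ?I (\<lambda>t. Lp_enorm q ?X (\<lambda>x. ennreal (norm (u t x))))"
    then show "Lp_enorm q ?X (\<lambda>x. ennreal (norm (U0 t x))) \<le> ennreal c"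
      using slice_norm[OF U0X ae, of q] csc by (simp add: cs_def)
  qed

  define Nb where "Nb t = Lp_enorm p ?X (\<lambda>x. ennreal (norm (V0 t x)))" for t
  have Nb_borel: "Nb \<in> borel_measurable borel"
    unfolding Nb_def[abs_def]
  proof (rule Lp_enorm_measurable[OF sigma_finite_torus])
    have "(\<lambda>p. V0 (fst p) (snd p)) \<in> borel_measurable (borel \<Otimes>\<^sub>M ?X)"
      by (rule space_time_compose[OF V0(1)])
        (auto intro: measurable_compose[OF measurable_snd measurable_id_lebesgue_on])
    then show "(\<lambda>p. ennreal (norm (V0 (fst p) (snd p)))) \<in> borel_measurable (borel \<Otimes>\<^sub>M ?X)" by simp
  qed
  have NbI [measurable]: "Nb \<in> borel_measurable ?I" by (rule borel_imp_measurable_lebesgue_on[OF Nb_borel])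
  have Nb_fin: "(\<integral>\<^sup>+t. ennreal_powr (Nb t) 2 \<partial>?I) < top"
  proof -
    have "(\<integral>\<^sup>+t. ennreal_powr (Lp_enorm p ?X (\<lambda>x. ennreal (norm (b t x)))) 2 \<partial>?I) < top"
      using b by (simp add: Lr_Lp_def Lp_enorm_def[of 2 ?I] ennreal_powr_less_top)
    moreover have "(\<integral>\<^sup>+t. ennreal_powr (Lp_enorm p ?X (\<lambda>x. ennreal (norm (b t x)))) 2 \<partial>?I) = (\<integral>\<^sup>+t. ennreal_powr (Nb t) 2 \<partial>?I)"
      by (rule nn_integral_cong_AE, use bV in eventually_elim) (simp add: Nb_def slice_norm[OF V0X])
    ultimately show ?thesis by simp
  qed
  have Nb_top: "AE t in ?I. Nb t < top"
  proof -
    have "AE t in ?I. ennreal_powr (Nb t) 2 \<noteq> \<infinity>"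
      by (rule nn_integral_PInf_AE[OF ennreal_powr_measurable[OF NbI]]) (use Nb_fin in auto)
    then show ?thesis
    proof eventually_elim
      fix t assume "ennreal_powr (Nb t) 2 \<noteq> \<infinity>"
      then have "ennreal_powr (Nb t) 2 < top" by (simp add: less_top)
      then show "Nb t < top" by (simp only: ennreal_powr_less_top)
    qed
  qed
  define d where "d t = enn2real (Nb t) + 1" for t
  have d: "0 < d t" for t by (simp add: d_def add_nonneg_pos)
  have Nd: "Nb t \<le> ennreal (d t)" if "Nb t < top" for t
  proof -
    have "Nb t = ennreal (enn2real (Nb t))" using that by simp
    also have "\<dots> \<le> ennreal (d t)" by (rule ennreal_leI) (simp add: d_def)
    finally show ?thesis .
  qed
  have d_fin: "(\<integral>\<^sup>+t. ennreal (k * (d t)\<^sup>2) \<partial>?I) < top" if k: "0 \<le> k" for k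
  proof -
    have "(\<integral>\<^sup>+t. ennreal (k * (d t)\<^sup>2) \<partial>?I) \<le> (\<integral>\<^sup>+t. ennreal (2 * k) * (ennreal_powr (Nb t) 2 + 1) \<partial>?I)"
    proof (rule nn_integral_mono_AE, use Nb_top in eventually_elim)
      fix t assume t: "Nb t < top"
      have "(d t)\<^sup>2 \<le> 2 * ((enn2real (Nb t))\<^sup>2 + 1)"
        using zero_le_power2[of "enn2real (Nb t) - 1"] by (simp add: d_def power2_eq_square algebra_simps)
      then have "k * (d t)\<^sup>2 \<le> k * (2 * ((enn2real (Nb t))\<^sup>2 + 1))" using k by (rule mult_left_mono)
      then have "ennreal (k * (d t)\<^sup>2) \<le> ennreal (2 * k * ((enn2real (Nb t))\<^sup>2 + 1))"
        by (intro ennreal_leI) (simp add: mult_ac)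
      also have "\<dots> = ennreal (2 * k) * (ennreal_powr (Nb t) 2 + 1)"
        using k t by (simp add: ennreal_mult ennreal_powr_def less_top[symmetric])
      finally show "ennreal (k * (d t)\<^sup>2) \<le> ennreal (2 * k) * (ennreal_powr (Nb t) 2 + 1)" .
    qed
    also have "\<dots> = ennreal (2 * k) * ((\<integral>\<^sup>+t. ennreal_powr (Nb t) 2 \<partial>?I) + (\<integral>\<^sup>+t. 1 \<partial>?I))"
      using ennreal_powr_measurable[OF NbI, of 2] by (simp add: nn_integral_cmult nn_integral_add)
    also have "\<dots> < top"
      using Nb_fin T by (simp add: ennreal_mult_less_top emeasure_restrict_space)
    finally show ?thesis .
  qed
  have V0_sq: "(\<integral>\<^sup>+x. ennreal ((norm (V0 t x))\<^sup>2) \<partial>?X) \<le> ennreal (2 * (d t)\<^sup>2)" if "Nb t < top" for t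
    by (rule nn_integral_square_le[OF emeasure_space_torus p p2 V0X d]) (use Nd[OF that] in \<open>simp add: Nb_def\<close>)
  have V0_total: "(\<integral>\<^sup>+t. \<integral>\<^sup>+x. ennreal ((norm (V0 t x))\<^sup>2) \<partial>?X \<partial>?I) < \<infinity>"
  proof -
    have "(\<integral>\<^sup>+t. \<integral>\<^sup>+x. ennreal ((norm (V0 t x))\<^sup>2) \<partial>?X \<partial>?I) \<le> (\<integral>\<^sup>+t. ennreal (2 * (d t)\<^sup>2) \<partial>?I)"
      by (rule nn_integral_mono_AE, use Nb_top in eventually_elim) (rule V0_sq)
    also have "\<dots> < top" by (rule d_fin) simp
    finally show ?thesis by simp
  qed
  \<comment> \<open>There are countably many products of basis functions, hence one null set of
    times for all of them.\<close>
  have div_ae: "AE t in ?I. \<forall>k l. (LINT x|?X. V0 t x \<bullet> grad (\<lambda>x. hartley k x * hartley l x) x) = 0"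
  proof -
    have "AE t in ?I. (LINT x|?X. V0 t x \<bullet> grad (\<lambda>x. hartley k x * hartley l x) x) = 0" for k l
      by (rule divergence_free_slices[OF div V0(1) bV V0_total smooth_mult[OF smooth_hartley smooth_hartley]])
        (rule torus_periodicI, simp add: torus_periodic_ivec[OF torus_periodic_hartley])
    then have "AE t in ?I. \<forall>l. (LINT x|?X. V0 t x \<bullet> grad (\<lambda>x. hartley k x * hartley l x) x) = 0" for k
      by (subst AE_all_countable) blast
    then show ?thesis by (subst AE_all_countable) blast
  qed

  define good where "good t \<longleftrightarrow> (AE x in ?X. u t x = U0 t x) \<and> (AE x in ?X. b t x = V0 t x) \<and>
    Lp_enorm q ?X (\<lambda>x. ennreal (norm (U0 t x))) \<le> ennreal c \<and> Nb t < top \<and>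
    (\<forall>k l. (LINT x|?X. V0 t x \<bullet> grad (\<lambda>x. hartley k x * hartley l x) x) = 0)" for t
  have "AE t in ?I. good t"
    using uU bV U_le Nb_top div_ae unfolding good_def by eventually_elim simp
  then have "AE t in lborel. t \<in> {0..T} \<longrightarrow> good t" by (simp add: AE_lebesgue_on_iff)
  then obtain N where N: "{t \<in> space lborel. \<not> (t \<in> {0..T} \<longrightarrow> good t)} \<subseteq> N" "N \<in> null_sets lborel"
    by (rule AE_E3) blast
  \<comment> \<open>N is a Borel null set, so E is Borel and cutting off at times outside E keeps
    joint Borel measurability.\<close>
  define E where "E = {0..T} - N"
  have E_sets: "E \<in> sets borel" using N(2) by (auto simp: E_def)
  have E_good: "good t" if "t \<in> E" for t using N(1) that by (auto simp: E_def)
  have E_ae: "AE t in ?I. t \<in> E"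
    using AE_not_in[OF N(2)] by (auto simp: AE_lebesgue_on_iff E_def elim!: eventually_mono)
  \<comment> \<open>Zero slices satisfy every condition that \<open>advection_core\<close> imposes
    at a single time, so nothing has to be known off E.\<close>
  define U where "U t x = (if t \<in> E then U0 t x else 0)" for t x
  define V where "V t x = (if t \<in> E then V0 t x else 0)" for t x
  have fstE: "{p :: real \<times> (real^'n). fst p \<in> E} \<in> sets borel"
  proof -
    have "fst -` E \<inter> space (borel :: (real \<times> (real^'n)) measure) \<in> sets borel"
      by (rule measurable_sets[OF _ E_sets]) (intro borel_measurable_continuous_onI continuous_intros)
    then show ?thesis by (simp add: vimage_def)
  qed
  have U_m: "(\<lambda>p. U (fst p) (snd p)) \<in> borel_measurable borel"
    unfolding U_def by (rule measurable_If[OF U0(1)]) (use fstE in auto)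
  have V_m: "(\<lambda>p. V (fst p) (snd p)) \<in> borel_measurable borel"
    unfolding V_def by (rule measurable_If[OF V0(1)]) (use fstE in auto)
  have Ub: "U t \<in> borel_measurable borel" and Vb: "V t \<in> borel_measurable borel" for t
    by (rule space_time_slice[OF U_m], rule space_time_slice[OF V_m])
  have UX: "U t \<in> borel_measurable ?X" and VX: "V t \<in> borel_measurable ?X" for t
    by (rule borel_imp_measurable_lebesgue_on[OF Ub], rule borel_imp_measurable_lebesgue_on[OF Vb])
  have UE: "U t = U0 t" "V t = V0 t" if "t \<in> E" for t using that by (auto simp: U_def V_def fun_eq_iff)
  have UE0: "U t = (\<lambda>x. 0)" "V t = (\<lambda>x. 0)" if "t \<notin> E" for t using that by (auto simp: U_def V_def fun_eq_iff)
  have U_nn: "(\<integral>\<^sup>+x. ennreal ((U t x)\<^sup>2) \<partial>?X) \<le> ennreal (2 * c\<^sup>2)" for t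
  proof (cases "t \<in> E")
    case True
    have "(\<integral>\<^sup>+x. ennreal ((norm (U t x))\<^sup>2) \<partial>?X) \<le> ennreal (2 * c\<^sup>2)"
      by (rule nn_integral_square_le[OF emeasure_space_torus q q2 UX c])
        (use E_good[OF True] in \<open>simp add: good_def UE[OF True]\<close>)
    then show ?thesis by simp
  qed (simp add: UE0)
  have U_sq: "square_integrable ?X (U t)" for t
    using le_less_trans[OF U_nn[of t] ennreal_less_top] UX by (simp add: square_integrable_def integrable_iff_bounded)
  have V_nn: "(\<integral>\<^sup>+x. ennreal ((norm (V t x))\<^sup>2) \<partial>?X) \<le> ennreal (2 * (d t)\<^sup>2)" for t
  proof (cases "t \<in> E")
    case True
    then show ?thesis using V0_sq[of t] E_good[OF True] by (simp add: good_def UE[OF True])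
  qed (simp add: UE0)
  have V_sq: "square_integrable ?X (\<lambda>x. V t x $ i)" for t i
  proof -
    have "(\<integral>\<^sup>+x. ennreal ((V t x $ i)\<^sup>2) \<partial>?X) \<le> (\<integral>\<^sup>+x. ennreal ((norm (V t x))\<^sup>2) \<partial>?X)"
      by (intro nn_integral_mono ennreal_leI) (auto simp: norm_vec_square intro!: member_le_sum)
    also have "\<dots> < top" using le_less_trans[OF V_nn[of t] ennreal_less_top] by simp
    finally show ?thesis using nth_measurable[OF VX[of t], of i] by (simp add: square_integrable_def integrable_iff_bounded)
  qed
  have u0_sq: "square_integrable ?X u0"
  proof -
    define e where "e = enn2real (Lp_enorm q ?X (\<lambda>x. ennreal (norm (u0 x)))) + 1"
    have "Lp_enorm q ?X (\<lambda>x. ennreal (norm (u0 x))) < top" using u0 by (simp add: torus_Lp_def)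
    then have "Lp_enorm q ?X (\<lambda>x. ennreal (norm (u0 x))) = ennreal (enn2real (Lp_enorm q ?X (\<lambda>x. ennreal (norm (u0 x)))))" by simp
    also have "\<dots> \<le> ennreal e" by (rule ennreal_leI) (simp add: e_def)
    finally have le: "Lp_enorm q ?X (\<lambda>x. ennreal (norm (u0 x))) \<le> ennreal e" .
    have e: "0 < e" by (simp add: e_def add_nonneg_pos)
    have m: "u0 \<in> borel_measurable ?X" using u0 by (simp add: torus_Lp_def)
    from le_less_trans[OF nn_integral_square_le[OF emeasure_space_torus q q2 m e le] ennreal_less_top]
    show ?thesis using m by (simp add: square_integrable_def integrable_iff_bounded)
  qed
  have ae: "AE t in ?I. (AE x in ?X. u t x = U t x) \<and> (AE x in ?X. b t x = V t x)"
    using E_ae by eventually_elim (use E_good in \<open>auto simp: good_def UE\<close>)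
  have "advection_core T U V u0 (2 * c\<^sup>2) (\<lambda>t. 3 * c\<^sup>2 * (d t)\<^sup>2)"
  proof (rule advection_core.intro)
    show "0 < T" by (rule T)
    show "(\<lambda>p. U (fst p) (snd p)) \<in> borel_measurable borel" by (rule U_m)
    show "(\<lambda>p. V (fst p) (snd p)) \<in> borel_measurable borel" by (rule V_m)
    show "torus_periodic (U t)" for t using U0(2)[of t] by (simp add: U_def torus_periodic_def)
    show "square_integrable ?X (U t)" for t by (rule U_sq)
    show "(LINT x|?X. (U t x)\<^sup>2) \<le> 2 * c\<^sup>2" for t
      using U_nn[of t] by (subst (asm) nn_integral_eq_integral[OF square_integrable_square[OF U_sq]]) auto
    show "(\<integral>\<^sup>+x. ennreal ((norm (V t x))\<^sup>2) \<partial>?X) < \<infinity>" for t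
      using le_less_trans[OF V_nn[of t] ennreal_less_top] by simp
    have "(\<integral>\<^sup>+t. \<integral>\<^sup>+x. ennreal ((norm (V t x))\<^sup>2) \<partial>?X \<partial>?I) \<le> (\<integral>\<^sup>+t. ennreal (2 * (d t)\<^sup>2) \<partial>?I)"
      by (intro nn_integral_mono V_nn)
    also have "\<dots> < top" by (rule d_fin) simp
    finally show "(\<integral>\<^sup>+t. \<integral>\<^sup>+x. ennreal ((norm (V t x))\<^sup>2) \<partial>?X \<partial>?I) < \<infinity>" by simp
    show "(\<integral>\<^sup>+x. ennreal ((U t (x - z))\<^sup>2) * ennreal ((norm (V t x))\<^sup>2) \<partial>?X) \<le> ennreal (3 * c\<^sup>2 * (d t)\<^sup>2)" for t z
    proof (cases "t \<in> E")
      case True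
      have "(\<integral>\<^sup>+x. ennreal ((U0 t (x - z))\<^sup>2) * ennreal ((norm (V0 t x))\<^sup>2) \<partial>?X) \<le> ennreal (3 * c\<^sup>2 * (d t)\<^sup>2)"
      proof (rule nn_integral_weighted_le[OF p q pq U0b U0(2) V0b c _ d])
        show "Lp_enorm q ?X (\<lambda>x. ennreal (norm (U0 t x))) \<le> ennreal c" using E_good[OF True] by (simp add: good_def)
        show "Lp_enorm p ?X (\<lambda>x. ennreal (norm (V0 t x))) \<le> ennreal (d t)"
          using E_good[OF True] Nd[of t] by (simp add: good_def Nb_def)
      qed
      then show ?thesis by (simp add: UE[OF True])
    qed (simp add: UE0)
    show "(\<integral>\<^sup>+t. ennreal (3 * c\<^sup>2 * (d t)\<^sup>2) \<partial>?I) < \<infinity>" using d_fin[of "3 * c\<^sup>2"] by simp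
    show "square_integrable ?X u0" by (rule u0_sq)
    show "(LINT x|?X. V t x \<bullet> grad (\<lambda>x. hartley k x * hartley l x) x) = 0" for t k l
    proof (cases "t \<in> E")
      case True
      then show ?thesis using E_good[OF True] by (simp add: good_def UE[OF True])
    qed (simp add: UE0)
    show "(LINT t|?I. torus.coef (U t) k * deriv \<eta> t
        + ((LINT x|?X. U t x * (V t x \<bullet> grad (hartley k) x)) - freq k * torus.coef (U t) k) * \<eta> t)
      + torus.coef u0 k * \<eta> 0 = 0" if "smooth \<eta>" "\<exists>c<T. \<forall>t\<ge>c. \<eta> t = 0" for \<eta> k
      by (rule distributional_solution_mode[OF sol ae U_sq V_sq that])
  qed
  moreover have "AE t in ?I. AE x in ?X. u t x = U t x" using ae by eventually_elim simp
  ultimately show ?thesis by blast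
qed

theorem theorem3p3:
  fixes T :: real and p q :: ennreal
    and b :: "real \<Rightarrow> real^'n \<Rightarrow> real^'n"
    and u0 :: "real^'n \<Rightarrow> real"
    and u :: "real \<Rightarrow> real^'n \<Rightarrow> real"
  assumes "0 < T" and "1 \<le> p" and "1 \<le> q" and "1 / p + 1 / q \<le> 1 / 2"
    and "Lr_Lp T 2 p b" and "divergence_free T b"
    and "torus_Lp q u0"
    and "distributional_solution T q b u0 u"
  shows "L2_H1 T u \<and>
    (\<exists>v. weakly_continuous_rep T u v) \<and>
    (\<forall>v. weakly_continuous_rep T u v \<longrightarrow>
       1 / 2 * (LINT x|torus. \<bar>v T x\<bar>\<^sup>2)
         + (LINT t|lebesgue_on {0..T}. (LINT x|torus. (norm (weak_grad (u t) x))\<^sup>2))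
       = 1 / 2 * (LINT x|torus. \<bar>u0 x\<bar>\<^sup>2))"
proof -
  obtain U V C n where core: "advection_core T U V u0 C n"
    and ae: "AE t in lebesgue_on {0..T}. AE x in torus. u t x = U t x"
    using advection_core_exists[OF assms] by blast
  have "Lr_Lp T \<infinity> q u" using assms(8) by (simp add: distributional_solution_def)
  then have "\<And>t. t \<in> {0..T} \<Longrightarrow> torus_periodic (u t)"
      "(\<lambda>(t, x). u t x) \<in> borel_measurable (lebesgue_on ({0..T} \<times> cbox 0 1))"
    by (auto simp: Lr_Lp_def)
  from advection_core.energy_balance[OF core this ae] show ?thesis .
qed

end
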